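(* Let $n\ge 3$ and $1\le k<n-1$ be integers. There exist origin-symmetric convex bodies $K$ and $L$ in the hyperbolic space $\mathbb{H}^n$ such that $$\mathrm{vol}_{n-k}(K\cap H)\le \mathrm{vol}_{n-k}(L\cap H)$$ for every $(n-k)$-dimensional totally geodesic plane $H$ through the origin, but $$\mathrm{vol}_{n}(K)> \mathrm{vol}_{n}(L).$$
   Context: The hyperbolic space $\mathbb{H}^n$ is identified with the open unit ball $B^n=\{x\in\mathbb{R}^n:|x|<1\}$ equipped with the Riemannian metric $ds^2=4\,\frac{dx_1^2+\cdots+dx_n^2}{(1-(x_1^2+\cdots+x_n^2))^2}$ (Poincaré ball model), where $|\cdot|$ is the Euclidean norm; the origin of $\mathbb{H}^n$ is the center $0$ of the ball. Geodesics in this model are arcs of circles orthogonal to the boundary of $B^n$ and straight line segments through the origin; any two points are joined by a unique geodesic segment. A body is a compact set with non-empty interior. A body $K\subset B^n$ is convex in $\mathbb{H}^n$ if for every pair of points of $K$ the hyperbolic geodesic segment joining them lies in $K$. It is origin-symmetric if $K=-K$. The $m$-dimensional totally geodesic planes through the origin are exactly the intersections with $B^n$ of $m$-dimensional linear subspaces of $\mathbb{R}^n$. Volumes are hyperbolic: $\mathrm{vol}_n(K)=2^n\int_K\frac{dx}{(1-|x|^2)^n}$, and for an $m$-dimensional totally geodesic plane $H$ through the origin, $\mathrm{vol}_m(K\cap H)=2^m\int_{K\cap H}\frac{dx}{(1-|x|^2)^m}$, where $dx$ is $m$-dimensional Lebesgue measure on $H$. *)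

theory Defs
  imports "HOL-Analysis.Analysis"
begin

text \<open>
  Poincare ball model: hyperbolic space is the open unit ball \<open>ball 0 1\<close> of a Euclidean
  space. Its topology is the Euclidean one, so compactness and interior are the library notions.
\<close>

definition planar_circle :: "'a::euclidean_space set \<Rightarrow> 'a \<Rightarrow> real \<Rightarrow> 'a set" where
  "planar_circle P c r = {c + v | v. v \<in> P \<and> norm v = r}"

text \<open>
  \<open>P\<close> is the plane of directions of the circle. The circle meets the unit sphere, and at each
  common point \<open>p\<close> every tangent vector of the circle is normal to the sphere, i.e. parallel to
  the radius vector \<open>p\<close>. (The circle has to meet the sphere: otherwise every circle
  inside the ball would qualify vacuously.)
\<close>

definition orthogonal_circle :: "'a::euclidean_space set \<Rightarrow> bool" where
  "orthogonal_circle C \<longleftrightarrow>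
     (\<exists>P c r. subspace P \<and> dim P = 2 \<and> r > 0 \<and> C = planar_circle P c r \<and>
        C \<inter> sphere 0 1 \<noteq> {} \<and>
        (\<forall>p \<in> C \<inter> sphere 0 1. \<forall>t \<in> P. orthogonal t (p - c) \<longrightarrow> t \<in> span {p}))"

definition hyp_geodesic :: "'a::euclidean_space set \<Rightarrow> bool" where
  "hyp_geodesic G \<longleftrightarrow>
     (\<exists>D. subspace D \<and> dim D = 1 \<and> G = D \<inter> ball 0 1) \<or>
     (\<exists>C. orthogonal_circle C \<and> G = C \<inter> ball 0 1)"

text \<open>
  The geodesic segment joining two distinct points \<open>x\<close>, \<open>y\<close> of the ball. A complete geodesic is
  homeomorphic to an open interval, so the arc in it from \<open>x\<close> to \<open>y\<close> is unique as a set.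
  Since \<open>arc\<close> requires injectivity there is no segment for \<open>x = y\<close>; the degenerate
  segment \<open>{x}\<close> plays no role for convexity.
\<close>

definition hyp_segment :: "'a::euclidean_space \<Rightarrow> 'a \<Rightarrow> 'a set \<Rightarrow> bool" where
  "hyp_segment x y S \<longleftrightarrow>
     (\<exists>G g. hyp_geodesic G \<and> arc g \<and> pathstart g = x \<and> pathfinish g = y \<and>
            path_image g \<subseteq> G \<and> S = path_image g)"

definition hyp_convex :: "'a::euclidean_space set \<Rightarrow> bool" where
  "hyp_convex K \<longleftrightarrow>
     K \<subseteq> ball 0 1 \<and> (\<forall>x\<in>K. \<forall>y\<in>K. \<forall>S. hyp_segment x y S \<longrightarrow> S \<subseteq> K)"

definition body :: "'a::euclidean_space set \<Rightarrow> bool" where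
  "body K \<longleftrightarrow> compact K \<and> interior K \<noteq> {}"

definition origin_symmetric :: "'a::euclidean_space set \<Rightarrow> bool" where
  "origin_symmetric K \<longleftrightarrow> K = uminus ` K"

definition central_plane :: "nat \<Rightarrow> 'a::euclidean_space set \<Rightarrow> bool" where
  "central_plane m H \<longleftrightarrow> (\<exists>V. subspace V \<and> dim V = m \<and> H = V \<inter> ball 0 1)"

definition orthonormal_basis_of :: "'a::euclidean_space set \<Rightarrow> 'a set \<Rightarrow> bool" where
  "orthonormal_basis_of V B \<longleftrightarrow>
     pairwise orthogonal B \<and> (\<forall>b\<in>B. norm b = 1) \<and> span B = V"

text \<open>
  Lebesgue measure of dimension \<open>dim V\<close> on a linear subspace \<open>V\<close>, as a measure on the
  ambient Borel sets. It is built exactly as \<open>lborel\<close> is from \<open>Basis\<close>, using an orthonormal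
  basis of \<open>V\<close>; by rotation invariance the choice of basis is immaterial.
\<close>

definition subspace_lborel :: "'a::euclidean_space set \<Rightarrow> 'a measure" where
  "subspace_lborel V =
     (let B = (SOME B. orthonormal_basis_of V B)
      in distr (\<Pi>\<^sub>M b\<in>B. (lborel :: real measure)) borel (\<lambda>f. \<Sum>b\<in>B. f b *\<^sub>R b))"

definition hyp_vol :: "'a::euclidean_space set \<Rightarrow> real" where
  "hyp_vol K =
     2 ^ DIM('a) * (LINT x:K|lborel. 1 / (1 - (norm x)\<^sup>2) ^ DIM('a))"

text \<open>
  The volume of dimension \<open>m\<close> of \<open>K \<inter> H\<close>, for \<open>H\<close> with \<open>central_plane m H\<close>; the
  linear subspace cutting out \<open>H\<close> is recovered as \<open>span H\<close>.
\<close>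

definition hyp_section_vol :: "nat \<Rightarrow> 'a::euclidean_space set \<Rightarrow> 'a set \<Rightarrow> real" where
  "hyp_section_vol m K H =
     2 ^ m * (LINT x:(K \<inter> H)|subspace_lborel (span H). 1 / (1 - (norm x)\<^sup>2) ^ m)"

end

(*
  The ball L is compared with a body of revolution K that carries many small ridges, on a common
  scale beta. Near the boundary of the ball model the volume element makes the m-dimensional volume
  of a star-shaped body comparable to the mean of h^-(m-1), where h is the Euclidean distance of its
  boundary from the unit sphere. For K this distance is of the form beta * sqrt (d + v), v being the
  distance to the next ridge in units of beta. Along every central section the ridges
  equidistribute as beta -> 0, so all m-dimensional section volumes are at most of order
  beta^-(m-1) * I (m-1) with I p = integral of (d + v)^(-p/2) over v in [0,1], while the total volume
  is at least of order beta^-(n-1) * I (n-1). A ball with the same bound on its sections has volume of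
  order beta^-(n-1) * I (m-1)^((n-1)/(m-1)), which is much smaller once d is small, since m < n.

  K is convex because in the Klein model, where geodesics are straight, it is an intersection of
  convex sets: it has a supporting plane at every angle 2 * j * beta from the axis.
*)
theory Submission
  imports Defs
begin

section \<open>The Klein model\<close>

text \<open>Every estimate loses a constant that depends only on the dimensions, so the comparison
  needs a gap that outgrows all constants. Write \<open>p + 1\<close> and \<open>N + 1\<close> for
  the dimensions of the sections and of the space. The mean of \<open>1 / sqrt (d + v)\<close> is at
  most 2 for all \<open>d\<close>, while the mean of its \<open>N\<close>-th power is unbounded as
  \<open>d\<close> tends to 0; interpolation between the two exponents keeps the \<open>p\<close>-th
  mean a definite power below what Hoelder's inequality allows.

  The obstacle is uniformity over all central planes. A plane sees the ridges through the angle
  \<open>arccos (a / sqrt (1 + t ^ 2))\<close>, where \<open>a\<close> is the length of the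
  projection of the axis. For \<open>a < 1\<close> this angle is stationary at \<open>t = 0\<close>,
  and nothing equidistributes there. An initial stretch of length of order
  \<open>sqrt \<beta>\<close> is therefore estimated by the supremum, which costs a power of
  \<open>1 / d\<close>; this is harmless because \<beta> is chosen after \<open>d\<close>. Planes
  with small \<open>a\<close> are dealt with by confining the ridges to within 45 degrees of the
  axis: such planes miss them and meet the body only at depth of order \<beta>.\<close>

definition klein :: "'a::euclidean_space \<Rightarrow> 'a" where
  "klein x = (2 / (1 + (norm x)\<^sup>2)) *\<^sub>R x"

text \<open>The map acts on norms by \<open>2 * r / (1 + r ^ 2)\<close>. Equality of two values
  factors as \<open>(r - s) * (1 - r * s) = 0\<close>, and the second factor is positive in the open
  ball.\<close>

lemma inj_on_klein: "inj_on klein (ball 0 1)"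
proof (rule inj_onI)
  fix x y :: 'a
  assume xy: "x \<in> ball 0 1" "y \<in> ball 0 1" and eq: "klein x = klein y"
  have pos: "0 < 1 + (norm z)\<^sup>2" for z :: 'a by (simp add: add_pos_nonneg)
  have "norm (klein x) = norm (klein y)" using eq by simp
  then have "2 * norm x / (1 + (norm x)\<^sup>2) = 2 * norm y / (1 + (norm y)\<^sup>2)"
    by (simp add: klein_def)
  then have "norm x * (1 + (norm y)\<^sup>2) = norm y * (1 + (norm x)\<^sup>2)"
    using pos[of x] pos[of y] by (simp add: field_simps)
  then have "(norm x - norm y) * (1 - norm x * norm y) = 0" by (simp add: algebra_simps power2_eq_square)
  moreover have "norm x * norm y < 1 * 1" using xy by (intro mult_strict_mono') auto
  ultimately have "norm x = norm y" by simp
  then show "x = y" using eq pos[of y] unfolding klein_def by simp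
qed

lemma continuous_on_klein: "continuous_on S klein"
proof -
  have "1 + (norm z)\<^sup>2 \<noteq> 0" for z :: 'a
    by (metis add_nonneg_eq_0_iff zero_le_one zero_le_power2 zero_neq_one)
  then show ?thesis unfolding klein_def by (intro continuous_intros) auto
qed

section \<open>Geodesics become chords\<close>

lemma dim_2_orthonormal_basis:
  fixes P :: "'a::euclidean_space set"
  assumes "subspace P" "dim P = 2"
  obtains b1 b2 where "b1 \<in> P" "b2 \<in> P" "b1 \<bullet> b1 = 1" "b2 \<bullet> b2 = 1" "b1 \<bullet> b2 = 0"
    "\<And>x. x \<in> P \<Longrightarrow> x = (x \<bullet> b1) *\<^sub>R b1 + (x \<bullet> b2) *\<^sub>R b2"
proof -
  obtain B where B: "B \<subseteq> P" "pairwise orthogonal B" "\<And>x. x \<in> B \<Longrightarrow> norm x = 1"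
      "independent B" "card B = dim P" "span B = P"
    using orthonormal_basis_subspace[OF assms(1)] by metis
  obtain b1 b2 where b: "B = {b1, b2}" "b1 \<noteq> b2" using B(5) assms(2) by (auto simp: card_2_iff)
  have orth: "b1 \<bullet> b2 = 0" using B(2) b by (auto simp: pairwise_def orthogonal_def)
  have n: "b1 \<bullet> b1 = 1" "b2 \<bullet> b2 = 1" using B(3) b by (auto simp: norm_eq_1)
  have "x = (x \<bullet> b1) *\<^sub>R b1 + (x \<bullet> b2) *\<^sub>R b2" if "x \<in> P" for x
  proof -
    from that B(6) b obtain u v where x: "x = u *\<^sub>R b1 + v *\<^sub>R b2"
      by (auto simp: span_insert algebra_simps span_breakdown_eq)
    show ?thesis using n orth by (simp add: x inner_add_left inner_commute[of b2 b1])
  qed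
  with that[of b1 b2] B(1) b n orth show ?thesis by auto
qed

text \<open>A radial tangent at a point \<open>p\<close> of the sphere forces the plane of the
  circle through the origin and gives \<open>p \<bullet> c = 1\<close>, hence
  \<open>c \<bullet> c = 1 + r ^ 2\<close>. The equation of the circle then reads
  \<open>2 * (z \<bullet> c) = 1 + (norm z) ^ 2\<close>, which in Klein coordinates is the linear
  equation \<open>klein z \<bullet> c = 1\<close>.\<close>

lemma klein_orthogonal_circle:
  fixes C :: "'a::euclidean_space set"
  assumes "orthogonal_circle C"
  obtains p u where "\<And>z. z \<in> C \<Longrightarrow> \<exists>s. klein z = p + s *\<^sub>R u"
proof -
  obtain P c r where P: "subspace P" "dim P = 2" and r: "r > 0" and C: "C = planar_circle P c r"
    and ne: "C \<inter> sphere 0 1 \<noteq> {}"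
    and perp: "\<And>p t. p \<in> C \<inter> sphere 0 1 \<Longrightarrow> t \<in> P \<Longrightarrow> orthogonal t (p - c) \<Longrightarrow> t \<in> span {p}"
    using assms unfolding orthogonal_circle_def by blast
  obtain b1 b2 where b: "b1 \<in> P" "b2 \<in> P" "b1 \<bullet> b1 = 1" "b2 \<bullet> b2 = 1" "b1 \<bullet> b2 = 0"
    and ex: "\<And>x. x \<in> P \<Longrightarrow> x = (x \<bullet> b1) *\<^sub>R b1 + (x \<bullet> b2) *\<^sub>R b2"
    using dim_2_orthonormal_basis[OF P] by metis
  obtain p where p: "p \<in> C" "norm p = 1" using ne by auto
  have pc: "p - c \<in> P" "norm (p - c) = r" using p C by (auto simp: planar_circle_def)
  define w where "w = p - c"
  \<comment> \<open>The quarter turn of \<open>w\<close> inside \<open>P\<close>: a tangent vector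
    of the circle at \<open>p\<close>.\<close>
  define t where "t = (w \<bullet> b2) *\<^sub>R b1 - (w \<bullet> b1) *\<^sub>R b2"
  have tP: "t \<in> P" unfolding t_def using b P(1) by (simp add: subspace_diff subspace_scale)
  have tw: "t \<bullet> w = 0"
    unfolding t_def by (simp add: inner_diff_left inner_commute[of b1 w] inner_commute[of b2 w])
  have tb: "t \<bullet> b1 = w \<bullet> b2" "t \<bullet> b2 = - (w \<bullet> b1)"
    unfolding t_def using b by (auto simp: inner_diff_left inner_commute[of b2 b1])
  have "t \<noteq> 0"
  proof
    assume "t = 0"
    then have "w \<bullet> b2 = 0" "w \<bullet> b1 = 0" using tb by auto
    then have "w = 0" using ex[of w] pc w_def by simp
    then show False using pc r w_def by simp
  qed
  moreover have "t \<in> span {p}" using perp[of p t] p tP tw by (simp add: orthogonal_def w_def)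
  ultimately obtain l where l: "t = l *\<^sub>R p" "l \<noteq> 0" by (auto simp: span_singleton)
  then have "p = (1 / l) *\<^sub>R t" by simp
  \<comment> \<open>A nonzero tangent parallel to \<open>p\<close> puts \<open>p\<close> itself into
    \<open>P\<close>, so the centre and the whole circle lie in the linear plane
    \<open>P\<close>.\<close>
  then have pP: "p \<in> P" using tP P(1) by (simp add: subspace_scale)
  then have cP: "c \<in> P" using pc(1) P(1) by (metis diff_diff_eq2 add_diff_cancel_left' subspace_diff)
  have "p \<bullet> (p - c) = 0" using tw l by (simp add: w_def)
  then have pc1: "p \<bullet> c = 1" using p by (simp add: inner_diff_right norm_eq_1)
  have "r\<^sup>2 = (p - c) \<bullet> (p - c)" using pc(2) by (simp add: dot_square_norm)
  then have r2: "c \<bullet> c = 1 + r\<^sup>2"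
    using pc1 p by (simp add: inner_diff inner_commute norm_eq_1)
  define d where "d = c \<bullet> c"
  have d: "d > 0" unfolding d_def r2 by (simp add: add_pos_nonneg)
  define c1 c2 where "c1 = c \<bullet> b1" and "c2 = c \<bullet> b2"
  have c: "c = c1 *\<^sub>R b1 + c2 *\<^sub>R b2" using ex[OF cP] by (simp add: c1_def c2_def)
  have dc: "d = c1\<^sup>2 + c2\<^sup>2" unfolding d_def by (subst (1 2) c)
      (simp add: inner_add_left inner_add_right b inner_commute[of b2 b1] power2_eq_square)
  define u where "u = c1 *\<^sub>R b2 - c2 *\<^sub>R b1"
  have "\<exists>s. klein z = (1 / d) *\<^sub>R c + s *\<^sub>R u" if "z \<in> C" for z proof -
    have zP: "z \<in> P" and zr: "norm (z - c) = r"
      using that cP P(1) by (auto simp: C planar_circle_def subspace_add)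
    have "r\<^sup>2 = (z - c) \<bullet> (z - c)" using zr by (simp add: dot_square_norm)
    then have "2 * (z \<bullet> c) = 1 + (norm z)\<^sup>2"
      using r2 by (simp add: inner_diff inner_commute dot_square_norm[symmetric])
    moreover have "1 + (norm z)\<^sup>2 > 0" by (simp add: add_pos_nonneg)
    ultimately have k1: "klein z \<bullet> c = 1" by (simp add: klein_def)
    define k1 k2 where "k1 = klein z \<bullet> b1" and "k2 = klein z \<bullet> b2"
    have "klein z \<in> P" unfolding klein_def using zP P(1) by (simp add: subspace_scale)
    then have k: "klein z = k1 *\<^sub>R b1 + k2 *\<^sub>R b2" using ex by (simp add: k1_def k2_def)
    have e: "k1 * c1 + k2 * c2 = 1"
      using k1 unfolding k1_def k2_def by (subst (asm) c) (simp add: inner_add_right mult.commute)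
    have "k1 * d = c1 - (k2 * c1 - k1 * c2) * c2" "k2 * d = c2 + (k2 * c1 - k1 * c2) * c1"
      using e unfolding dc by algebra+
    then have "k1 = c1 / d - ((k2 * c1 - k1 * c2) / d) * c2" "k2 = c2 / d + ((k2 * c1 - k1 * c2) / d) * c1"
      using d by (simp_all add: field_simps)
    then have "k1 *\<^sub>R b1 + k2 *\<^sub>R b2 = (c1 / d - ((k2 * c1 - k1 * c2) / d) * c2) *\<^sub>R b1
        + (c2 / d + ((k2 * c1 - k1 * c2) / d) * c1) *\<^sub>R b2" by simp
    also have "\<dots> = (1 / d) *\<^sub>R c + ((k2 * c1 - k1 * c2) / d) *\<^sub>R u"
      unfolding u_def c by (simp add: algebra_simps)
    finally show ?thesis using k by auto
  qed
  then show ?thesis using that by blast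
qed

lemma klein_hyp_geodesic:
  assumes "hyp_geodesic G"
  obtains p u where "\<And>z. z \<in> G \<Longrightarrow> \<exists>s. klein z = p + s *\<^sub>R u"
proof -
  consider D where "subspace D" "dim D = 1" "G = D \<inter> ball 0 1"
    | C where "orthogonal_circle C" "G = C \<inter> ball 0 1"
    using assms unfolding hyp_geodesic_def by blast
  then show ?thesis
  proof cases
    case 1
    obtain B where B: "independent B" "card B = dim D" "span B = D"
      using orthonormal_basis_subspace[OF 1(1)] by metis
    then obtain b where "B = {b}" using 1(2) by (auto simp: card_1_singleton_iff)
    then have "\<exists>s. klein z = 0 + s *\<^sub>R b" if "z \<in> G" for z
      using that B(3) 1(3) by (auto simp: span_singleton klein_def)
    then show ?thesis using that by blast
  next
    case 2
    then show ?thesis using klein_orthogonal_circle[OF 2(1)] that by (metis IntD1)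
  qed
qed

text \<open>An arc inside a geodesic is mapped to an injective continuous path on a line. Such a
  path is monotone along the line, so each of its points lies between the images of the
  endpoints.\<close>

lemma hyp_convex_klein_vimage:
  fixes C :: "'a::euclidean_space set"
  assumes "convex C"
  shows "hyp_convex {x \<in> ball 0 1. klein x \<in> C}"
  unfolding hyp_convex_def
proof (intro conjI ballI allI impI subsetI)
  fix x y z :: 'a and S
  assume x: "x \<in> {x \<in> ball 0 1. klein x \<in> C}" and y: "y \<in> {x \<in> ball 0 1. klein x \<in> C}"
    and S: "hyp_segment x y S" and z: "z \<in> S"
  obtain G g where G: "hyp_geodesic G" and g: "arc g" "pathstart g = x" "pathfinish g = y"
      "path_image g \<subseteq> G" "S = path_image g"
    using S unfolding hyp_segment_def by blast
  obtain p u where pu: "\<And>z. z \<in> G \<Longrightarrow> \<exists>s. klein z = p + s *\<^sub>R u"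
    using klein_hyp_geodesic[OF G] by metis
  have ball: "G \<subseteq> ball 0 1" using G unfolding hyp_geodesic_def by auto
  obtain t where t: "t \<in> {0..1}" "z = g t" using z g(5) by (auto simp: path_image_def)
  have gG: "g ` {0..1} \<subseteq> G" using g(4) by (simp add: path_image_def)
  have g01: "g 0 = x" "g 1 = y" using g by (auto simp: pathstart_def pathfinish_def)
  have "klein z \<in> C"
  proof (cases "u = 0 \<or> t = 0 \<or> t = 1")
    case True
    then show ?thesis
    proof (elim disjE)
      assume "u = 0"
      moreover have "z \<in> G" "x \<in> G" using gG t g01 by auto
      ultimately have "klein z = p" "klein x = p" using pu[of z] pu[of x] by auto
      then show ?thesis using x by simp
    qed (use t g01 x y in auto)
  next
    case False
    \<comment> \<open>The coordinate along the line; it inherits injectivity from the arc and from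
      \<open>klein\<close>.\<close>
    define h where "h s = ((klein (g s) - p) \<bullet> u) / (u \<bullet> u)" for s
    have hk: "klein (g s) = p + h s *\<^sub>R u" if "s \<in> {0..1}" for s proof -
      obtain w where "klein (g s) = p + w *\<^sub>R u"
        using pu[of "g s"] gG \<open>s \<in> {0..1}\<close> by blast
      then show ?thesis using False by (simp add: h_def)
    qed
    have cg: "continuous_on {0..1} g" "inj_on g {0..1}" using g(1) by (auto simp: arc_def path_def)
    have ck: "continuous_on {0..1} (\<lambda>s. klein (g s))"
      by (rule continuous_on_compose2[OF continuous_on_klein cg(1), of UNIV]) simp
    have "continuous_on {0..1} h" unfolding h_def using False by (intro continuous_intros ck) auto
    moreover have "inj_on h {0..1}"
    proof (rule inj_onI)
      fix a b :: real
      assume ab: "a \<in> {0..1}" "b \<in> {0..1}" "h a = h b"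
      then have "klein (g a) = klein (g b)" using hk by simp
      moreover have "g a \<in> ball 0 1" "g b \<in> ball 0 1" using ball gG ab by blast+
      ultimately have "g a = g b" by (rule inj_onD[OF inj_on_klein])
      then show "a = b" using cg(2) ab by (auto simp: inj_on_def)
    qed
    ultimately have "h 0 < h t \<and> h t < h 1 \<or> h 1 < h t \<and> h t < h 0"
      using False t by (intro continuous_inj_imp_mono) auto
    then have "h t \<in> closed_segment (h 0) (h 1)" by (auto simp: closed_segment_eq_real_ivl)
    then obtain l where l: "0 \<le> l" "l \<le> 1" "h t = (1 - l) * h 0 + l * h 1"
      by (auto simp: in_segment)
    have "klein z = (1 - l) *\<^sub>R klein x + l *\<^sub>R klein y"
      using hk[of t] hk[of 0] hk[of 1] t g01 l(3) by (simp add: algebra_simps)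
    then show ?thesis using assms x y l unfolding convex_alt by auto
  qed
  moreover have "z \<in> ball 0 1" using gG t ball by blast
  ultimately show "z \<in> {x \<in> ball 0 1. klein x \<in> C}" by simp
qed auto

section \<open>Lebesgue measure on subspaces\<close>

definition orthonormal :: "'a::euclidean_space set \<Rightarrow> bool" where
  "orthonormal B \<longleftrightarrow> pairwise orthogonal B \<and> (\<forall>b\<in>B. norm b = 1)"

definition frame_lborel :: "'a::euclidean_space set \<Rightarrow> 'a measure" where
  "frame_lborel B = distr (\<Pi>\<^sub>M b\<in>B. (lborel :: real measure)) borel (\<lambda>f. \<Sum>b\<in>B. f b *\<^sub>R b)"

abbreviation unit_ball_vol :: "'a::euclidean_space set \<Rightarrow> ennreal" where
  "unit_ball_vol B \<equiv> emeasure (frame_lborel B) (cball 0 1)"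

lemma orthonormal_finite: "orthonormal B \<Longrightarrow> finite B"
  using pairwise_orthogonal_imp_finite[of B] by (simp add: orthonormal_def)

lemma orthonormal_inner:
  "orthonormal B \<Longrightarrow> b \<in> B \<Longrightarrow> c \<in> B \<Longrightarrow> b \<bullet> c = (if b = c then 1 else 0)"
  by (auto simp: orthonormal_def pairwise_def orthogonal_def norm_eq_1)

lemma orthonormal_subset: "orthonormal B \<Longrightarrow> C \<subseteq> B \<Longrightarrow> orthonormal C"
  by (auto simp: orthonormal_def intro: pairwise_subset)

lemma orthonormal_independent: "orthonormal B \<Longrightarrow> independent B"
  using pairwise_orthogonal_independent[of B] by (force simp: orthonormal_def)

lemma orthonormal_sum_inner:
  assumes "orthonormal B" "c \<in> B"
  shows "(\<Sum>b\<in>B. f b *\<^sub>R b) \<bullet> c = f c"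
proof -
  have "(\<Sum>b\<in>B. f b *\<^sub>R b) \<bullet> c = (\<Sum>b\<in>B. if b = c then f b else 0)"
    unfolding inner_sum_left using orthonormal_inner[OF assms(1) _ assms(2)] by (intro sum.cong) auto
  then show ?thesis using assms orthonormal_finite[OF assms(1)] by simp
qed

lemma orthonormal_norm_sum:
  assumes "orthonormal B"
  shows "(norm (\<Sum>b\<in>B. f b *\<^sub>R b))\<^sup>2 = (\<Sum>b\<in>B. (f b)\<^sup>2)"
proof -
  have "(norm (\<Sum>b\<in>B. f b *\<^sub>R b))\<^sup>2 = (\<Sum>c\<in>B. f c * ((\<Sum>b\<in>B. f b *\<^sub>R b) \<bullet> c))"
    unfolding power2_norm_eq_inner by (subst inner_sum_right) simp
  also have "\<dots> = (\<Sum>c\<in>B. (f c)\<^sup>2)"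
    using orthonormal_sum_inner[OF assms] by (intro sum.cong) (auto simp: power2_eq_square)
  finally show ?thesis .
qed

lemma orthonormal_expansion:
  assumes "orthonormal B" "x \<in> span B"
  shows "(\<Sum>b\<in>B. (x \<bullet> b) *\<^sub>R b) = x"
proof -
  obtain f where "x = (\<Sum>b\<in>B. f b *\<^sub>R b)"
    using assms(2) orthonormal_finite[OF assms(1)] by (auto simp: span_finite)
  then show ?thesis using orthonormal_sum_inner[OF assms(1)] by (auto intro!: sum.cong)
qed

lemma sets_frame_lborel [simp, measurable_cong]: "sets (frame_lborel B) = sets borel"
  by (simp add: frame_lborel_def)

lemma space_frame_lborel [simp]: "space (frame_lborel B) = UNIV"
  by (simp add: frame_lborel_def)

section \<open>Lebesgue measure in orthonormal coordinates: affine changes and balls\<close>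

lemma product_sigma_finite_lborel: "product_sigma_finite (\<lambda>_. lborel :: real measure)"
  by unfold_locales

text \<open>One statement for three symmetries: \<open>h\<close> relabels the coordinates,
  \<open>a\<close> translates, and \<open>t\<close> dilates with factor \<open>t ^ card B\<close>.
  The preimage of a box is again a box, and boxes determine the product measure.\<close>

lemma PiM_lborel_affine:
  fixes B :: "'a set" and C :: "'b set" and t :: real
  assumes fin: "finite B" and h: "bij_betw h B C" and t: "0 < t"
  shows "scale_measure (ennreal (t ^ card B)) (distr (\<Pi>\<^sub>M c\<in>C. lborel) (\<Pi>\<^sub>M b\<in>B. lborel)
    (\<lambda>f. \<lambda>b\<in>B. a b + t * f (h b))) = (\<Pi>\<^sub>M b\<in>B. lborel)"
    (is "scale_measure _ (distr ?Q ?P ?r) = ?P")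
proof -
  interpret B: product_sigma_finite "\<lambda>_ :: 'a. lborel :: real measure"
    by (rule product_sigma_finite_lborel)
  interpret C: product_sigma_finite "\<lambda>_ :: 'b. lborel :: real measure"
    by (rule product_sigma_finite_lborel)
  have C: "C = h ` B" "inj_on h B" using h by (auto simp: bij_betw_def)
  have [measurable]: "?r \<in> ?Q \<rightarrow>\<^sub>M ?P"
    using C by (intro measurable_restrict borel_measurable_add borel_measurable_times measurable_const)
      (auto intro!: measurable_component_singleton)
  show ?thesis
  proof (rule B.PiM_eqI[OF fin])
    fix A :: "'a \<Rightarrow> real set" assume A: "\<And>i. i \<in> B \<Longrightarrow> A i \<in> sets lborel"
    let ?g = "\<lambda>b y. a b + t * y"
    let ?A = "\<lambda>c. ?g (the_inv_into B h c) -` A (the_inv_into B h c)"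
    have inv: "the_inv_into B h (h b) = b" if "b \<in> B" for b
      using C that by (simp add: the_inv_into_f_f)
    have mA: "?g b -` A b \<in> sets borel" if "b \<in> B" for b
      using A[OF that] by (intro measurable_sets_borel[of _ borel]) auto
    have "?r -` (Pi\<^sub>E B A) \<inter> space ?Q = Pi\<^sub>E C ?A" by (auto simp: space_PiM PiE_iff C(1) inv)
    then have "emeasure (distr ?Q ?P ?r) (Pi\<^sub>E B A) = emeasure ?Q (Pi\<^sub>E C ?A)"
      using A fin by (subst emeasure_distr) (auto intro!: sets_PiM_I_finite)
    also have "\<dots> = (\<Prod>c\<in>C. emeasure lborel (?A c))"
      using mA fin by (intro C.emeasure_PiM) (auto simp: C(1) inv)
    also have "\<dots> = (\<Prod>b\<in>B. emeasure lborel (?A (h b)))" by (rule prod.reindex_bij_betw[OF h, symmetric])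
    finally have "ennreal (t ^ card B) * emeasure (distr ?Q ?P ?r) (Pi\<^sub>E B A)
        = (\<Prod>b\<in>B. ennreal t * emeasure lborel (?g b -` A b))"
      using t by (simp add: inv prod.distrib ennreal_power)
    also have "\<dots> = (\<Prod>b\<in>B. emeasure lborel (A b))"
    proof (rule prod.cong[OF refl])
      fix b assume "b \<in> B"
      then have "A b \<in> sets borel" using A by simp
      then show "ennreal t * emeasure lborel (?g b -` A b) = emeasure lborel (A b)"
        using t by (subst (2) lborel_real_affine[of t "a b"]) (simp_all add: emeasure_density_const emeasure_distr)
    qed
    finally show "emeasure (scale_measure (ennreal (t ^ card B)) (distr ?Q ?P ?r)) (Pi\<^sub>E B A)
        = (\<Prod>i\<in>B. emeasure lborel (A i))" by simp
  qed simp
qed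

lemma nn_integral_frame_lborel:
  assumes [measurable]: "G \<in> borel_measurable borel"
  shows "(\<integral>\<^sup>+x. G x \<partial>frame_lborel B) = (\<integral>\<^sup>+f. G (\<Sum>b\<in>B. f b *\<^sub>R b) \<partial>(\<Pi>\<^sub>M b\<in>B. lborel))"
  unfolding frame_lborel_def by (rule nn_integral_distr) measurable

lemma nn_integral_frame_lborel_translate:
  fixes v :: "'a::euclidean_space"
  assumes B: "orthonormal B" and v: "v \<in> span B" and [measurable]: "G \<in> borel_measurable borel"
  shows "(\<integral>\<^sup>+x. G (v + x) \<partial>frame_lborel B) = (\<integral>\<^sup>+x. G x \<partial>frame_lborel B)"
proof -
  let ?P = "\<Pi>\<^sub>M b\<in>B. (lborel :: real measure)"
  let ?r = "\<lambda>f. \<lambda>b\<in>B. v \<bullet> b + f b :: real"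
  have fin: "finite B" using B by (rule orthonormal_finite)
  have P: "distr ?P ?P ?r = ?P"
    using PiM_lborel_affine[OF fin bij_betw_id, of 1 "\<lambda>b. v \<bullet> b"] by simp
  have "(\<integral>\<^sup>+x. G x \<partial>frame_lborel B) = (\<integral>\<^sup>+f. G (\<Sum>b\<in>B. f b *\<^sub>R b) \<partial>distr ?P ?P ?r)"
    unfolding P by (rule nn_integral_frame_lborel) measurable
  also have "\<dots> = (\<integral>\<^sup>+f. G (\<Sum>b\<in>B. ?r f b *\<^sub>R b) \<partial>?P)"
    by (rule nn_integral_distr) measurable
  also have "\<dots> = (\<integral>\<^sup>+f. G (v + (\<Sum>b\<in>B. f b *\<^sub>R b)) \<partial>?P)"
    using orthonormal_expansion[OF B v] by (simp add: scaleR_add_left sum.distrib)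
  also have "\<dots> = (\<integral>\<^sup>+x. G (v + x) \<partial>frame_lborel B)"
    by (rule nn_integral_frame_lborel[symmetric]) measurable
  finally show ?thesis ..
qed

lemma AE_frame_lborel_span: "orthonormal B \<Longrightarrow> AE x in frame_lborel B. x \<in> span B"
  unfolding frame_lborel_def
  by (subst AE_distr_iff) (auto intro!: AE_I2 span_sum span_scale borel_closed intro: span_base)

text \<open>In coordinates the basis vectors disappear, so the measure of a ball depends only on
  their number.\<close>

lemma emeasure_frame_lborel_cball:
  assumes B: "orthonormal B"
  shows "emeasure (frame_lborel B) (cball 0 t) =
    emeasure (\<Pi>\<^sub>M b\<in>B. lborel) {f \<in> space (\<Pi>\<^sub>M b\<in>B. lborel). sqrt (\<Sum>b\<in>B. (f b)\<^sup>2) \<le> t}"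
proof -
  have "norm (\<Sum>b\<in>B. f b *\<^sub>R b) = sqrt (\<Sum>b\<in>B. (f b)\<^sup>2)" for f
    using orthonormal_norm_sum[OF B, of f] by (metis norm_ge_zero real_sqrt_unique)
  then show ?thesis unfolding frame_lborel_def
    by (subst emeasure_distr) (auto intro!: arg_cong2[where f = emeasure])
qed

lemma emeasure_frame_lborel_cball_cong:
  fixes B C :: "'a::euclidean_space set"
  assumes B: "orthonormal B" and C: "orthonormal C" and "card B = card C"
  shows "emeasure (frame_lborel B) (cball 0 t) = emeasure (frame_lborel C) (cball 0 t)"
proof -
  obtain h where h: "bij_betw h B C" using assms orthonormal_finite by (metis finite_same_card_bij)
  let ?P = "\<lambda>B :: 'a set. \<Pi>\<^sub>M b\<in>B. (lborel :: real measure)"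
  let ?r = "\<lambda>f. \<lambda>b\<in>B. f (h b) :: real"
  let ?X = "\<lambda>B. {f \<in> space (?P B). sqrt (\<Sum>b\<in>B. (f b)\<^sup>2) \<le> t}"
  have [measurable]: "?r \<in> ?P C \<rightarrow>\<^sub>M ?P B"
    using h by (intro measurable_restrict measurable_component_singleton) (auto simp: bij_betw_def)
  have "emeasure (?P B) (?X B) = emeasure (distr (?P C) (?P B) ?r) (?X B)"
    using PiM_lborel_affine[OF orthonormal_finite[OF B] h, of 1 "\<lambda>_. 0"] by simp
  also have "\<dots> = emeasure (?P C) (?r -` ?X B \<inter> space (?P C))"
    by (rule emeasure_distr) measurable
  also have "?r -` ?X B \<inter> space (?P C) = ?X C" proof -
    have "(\<Sum>b\<in>B. (?r f b)\<^sup>2) = (\<Sum>c\<in>C. (f c)\<^sup>2)" for f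
      using sum.reindex_bij_betw[OF h, of "\<lambda>c. (f c)\<^sup>2"] by simp
    then show ?thesis by (auto simp: space_PiM)
  qed
  finally show ?thesis by (simp add: emeasure_frame_lborel_cball B C)
qed

lemma emeasure_frame_lborel_cball_scale:
  assumes B: "orthonormal B" and t: "t \<ge> 0" and ne: "B \<noteq> {}"
  shows "emeasure (frame_lborel B) (cball 0 t) = ennreal (t ^ card B) * unit_ball_vol B"
proof -
  interpret product_sigma_finite "\<lambda>_ :: 'a. lborel :: real measure"
    by (rule product_sigma_finite_lborel)
  let ?P = "\<Pi>\<^sub>M b\<in>B. (lborel :: real measure)"
  let ?r = "\<lambda>f. \<lambda>b\<in>B. t * f b :: real"
  let ?X = "\<lambda>t. {f \<in> space ?P. sqrt (\<Sum>b\<in>B. (f b)\<^sup>2) \<le> t}"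
  have fin: "finite B" using B by (rule orthonormal_finite)
  show ?thesis
  proof (cases "t = 0")
    case True
    have "(\<Sum>b\<in>B. (f b)\<^sup>2) \<le> 0 \<longleftrightarrow> (\<forall>b\<in>B. f b = 0)" for f :: "'a \<Rightarrow> real"
      using sum_nonneg_eq_0_iff[OF fin, of "\<lambda>b. (f b)\<^sup>2"] sum_nonneg[of B "\<lambda>b. (f b)\<^sup>2"]
      by (auto simp: order_antisym_conv)
    then have "emeasure (frame_lborel B) (cball 0 0) = emeasure ?P (Pi\<^sub>E B (\<lambda>_. {0}))"
      unfolding emeasure_frame_lborel_cball[OF B] using fin by (intro arg_cong2[where f = emeasure])
        (auto simp: space_PiM PiE_iff fun_eq_iff extensional_def)
    also have "\<dots> = 0" using fin ne by (subst emeasure_PiM) auto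
    finally show ?thesis using True fin ne by (simp add: card_gt_0_iff)
  next
    case False
    with t have t: "t > 0" by simp
    have P: "scale_measure (ennreal (t ^ card B)) (distr ?P ?P ?r) = ?P"
      using PiM_lborel_affine[OF fin bij_betw_id t, of "\<lambda>_. 0"] by simp
    have "emeasure ?P (?X t) = ennreal (t ^ card B) * emeasure (distr ?P ?P ?r) (?X t)"
      by (subst P[symmetric]) simp
    also have "emeasure (distr ?P ?P ?r) (?X t) = emeasure ?P (?r -` ?X t \<inter> space ?P)"
      by (rule emeasure_distr) measurable
    also have "?r -` ?X t \<inter> space ?P = ?X 1" proof -
      have "sqrt (\<Sum>b\<in>B. (?r f b)\<^sup>2) = t * sqrt (\<Sum>b\<in>B. (f b)\<^sup>2)" for f
        using t by (simp add: power_mult_distrib sum_distrib_left[symmetric] real_sqrt_mult)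
      then show ?thesis using t by (auto simp: space_PiM)
    qed
    finally show ?thesis by (simp add: emeasure_frame_lborel_cball B)
  qed
qed

text \<open>The ball lies between two cubes, whose measures are products of side lengths.\<close>

lemma emeasure_frame_lborel_cball_pos_finite:
  assumes B: "orthonormal B" and t: "t > 0"
  shows "emeasure (frame_lborel B) (cball 0 t) > 0" "emeasure (frame_lborel B) (cball 0 t) < \<infinity>"
proof -
  interpret product_sigma_finite "\<lambda>_ :: 'a. lborel :: real measure"
    by (rule product_sigma_finite_lborel)
  let ?P = "\<Pi>\<^sub>M b\<in>B. (lborel :: real measure)"
  let ?X = "{f \<in> space ?P. sqrt (\<Sum>b\<in>B. (f b)\<^sup>2) \<le> t}"
  have fin: "finite B" using B by (rule orthonormal_finite)
  have X: "?X \<in> sets ?P" by measurable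
  \<comment> \<open>Coordinates bounded by \<open>u\<close> give a norm of at most
    \<open>card B * u\<close>; the summand 1 in the denominator covers the empty basis.\<close>
  define u where "u = t / (card B + 1)"
  have u: "u > 0" using t by (simp add: u_def)
  have "Pi\<^sub>E B (\<lambda>_. {-u..u}) \<subseteq> ?X"
  proof (safe)
    fix f assume f: "f \<in> Pi\<^sub>E B (\<lambda>_. {-u..u})"
    then show "f \<in> space ?P" by (auto simp: space_PiM)
    have "sqrt (\<Sum>b\<in>B. (f b)\<^sup>2) = L2_set f B" by (simp add: L2_set_def)
    also have "\<dots> \<le> (\<Sum>b\<in>B. \<bar>f b\<bar>)" by (rule L2_set_le_sum_abs)
    also have "\<dots> \<le> (\<Sum>b\<in>B. u)" using f by (intro sum_mono) (auto simp: PiE_iff abs_le_iff)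
    also have "\<dots> \<le> t" using t by (simp add: u_def field_simps)
    finally show "sqrt (\<Sum>b\<in>B. (f b)\<^sup>2) \<le> t" .
  qed
  then have "emeasure ?P (Pi\<^sub>E B (\<lambda>_. {-u..u})) \<le> emeasure ?P ?X"
    using X by (rule emeasure_mono)
  moreover have "emeasure ?P (Pi\<^sub>E B (\<lambda>_. {-u..u})) > 0"
    using fin u by (subst emeasure_PiM) (auto simp: ennreal_power)
  ultimately show "emeasure (frame_lborel B) (cball 0 t) > 0"
    by (simp add: emeasure_frame_lborel_cball[OF B])
  have "?X \<subseteq> Pi\<^sub>E B (\<lambda>_. {-t..t})"
  proof (rule subsetI)
    fix f assume "f \<in> ?X"
    then have f: "f \<in> space ?P" "sqrt (\<Sum>b\<in>B. (f b)\<^sup>2) \<le> t" by auto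
    have "f b \<in> {-t..t}" if "b \<in> B" for b proof -
      have "\<bar>f b\<bar> \<le> L2_set f B"
        using member_le_L2_set[OF fin that, of "\<lambda>b. \<bar>f b\<bar>"] by (simp add: L2_set_def)
      then have "\<bar>f b\<bar> \<le> t" using f(2) by (simp add: L2_set_def)
      then show ?thesis unfolding atLeastAtMost_iff by linarith
    qed
    then show "f \<in> Pi\<^sub>E B (\<lambda>_. {-t..t})" using f(1) unfolding space_PiM PiE_iff by blast
  qed
  then have "emeasure ?P ?X \<le> emeasure ?P (Pi\<^sub>E B (\<lambda>_. {-t..t}))"
    using fin by (intro emeasure_mono) (auto intro!: sets_PiM_I_finite)
  also have "\<dots> < \<infinity>" using fin t by (subst emeasure_PiM) (auto simp: ennreal_power)
  finally show "emeasure (frame_lborel B) (cball 0 t) < \<infinity>"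
    by (simp add: emeasure_frame_lborel_cball[OF B])
qed

lemma sigma_finite_frame_lborel:
  assumes "orthonormal B"
  shows "sigma_finite_measure (frame_lborel B)"
proof
  show "\<exists>A. countable A \<and> A \<subseteq> sets (frame_lborel B) \<and> \<Union> A = space (frame_lborel B)
      \<and> (\<forall>a\<in>A. emeasure (frame_lborel B) a \<noteq> \<infinity>)"
  proof (intro exI[of _ "range (\<lambda>n. cball 0 (real (Suc n)))"] conjI ballI)
    show "(\<Union>n. cball 0 (real (Suc n))) = space (frame_lborel B)"
      by (auto simp: real_arch_simple) (metis le_SucI of_nat_le_iff order_trans real_arch_simple of_nat_Suc)
    fix a assume "a \<in> range (\<lambda>n. cball (0 :: 'a) (real (Suc n)))"
    then show "emeasure (frame_lborel B) a \<noteq> \<infinity>"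
      using emeasure_frame_lborel_cball_pos_finite(2)[OF assms] by (auto simp: less_top)
  qed auto
qed

text \<open>
  Uniqueness of Haar measure on \<open>span B\<close>: both double integrals of
  \<open>indicator A x * indicator U y\<close>, \<open>U\<close> the unit ball, are compared by shearing the two variables.
\<close>

lemma frame_lborel_cong_span:
  fixes B C :: "'a::euclidean_space set"
  assumes B: "orthonormal B" and C: "orthonormal C" and sp: "span B = span C"
  shows "frame_lborel B = frame_lborel C"
proof (rule measure_eqI)
  fix A assume "A \<in> sets (frame_lborel B)"
  then have A[measurable]: "A \<in> sets borel" by simp
  let ?M = "frame_lborel B" and ?N = "frame_lborel C"
  let ?U = "cball 0 1 :: 'a set"
  let ?a = "indicator A :: 'a \<Rightarrow> ennreal" and ?u = "indicator ?U :: 'a \<Rightarrow> ennreal"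
  interpret M: sigma_finite_measure ?M
    by (rule sigma_finite_frame_lborel[OF B])
  interpret N: sigma_finite_measure ?N
    by (rule sigma_finite_frame_lborel[OF C])
  interpret pair_sigma_finite ?M ?N ..
  have [measurable]: "?U \<in> sets borel" by simp
  have [measurable]: "?u \<in> borel_measurable borel" "?a \<in> borel_measurable borel" by measurable
  have swap: "(\<integral>\<^sup>+x. \<integral>\<^sup>+y. g x y \<partial>?N \<partial>?M) = (\<integral>\<^sup>+y. \<integral>\<^sup>+x. g x y \<partial>?M \<partial>?N)"
    if [measurable]: "case_prod g \<in> borel_measurable (borel \<Otimes>\<^sub>M borel)" for g :: "'a \<Rightarrow> 'a \<Rightarrow> ennreal"
  proof -
    have "case_prod g \<in> borel_measurable (?M \<Otimes>\<^sub>M ?N)" by measurable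
    then show ?thesis by (rule Fubini'[symmetric])
  qed
  have "emeasure ?M A * emeasure ?N ?U = (\<integral>\<^sup>+x. \<integral>\<^sup>+y. ?a x * ?u y \<partial>?N \<partial>?M)"
    by (simp add: nn_integral_cmult nn_integral_multc)
  also have "\<dots> = (\<integral>\<^sup>+y. \<integral>\<^sup>+x. ?a x * ?u y \<partial>?M \<partial>?N)"
    by (rule swap) measurable
  also have "\<dots> = (\<integral>\<^sup>+y. \<integral>\<^sup>+x. ?a (y + x) * ?u y \<partial>?M \<partial>?N)"
  proof (rule nn_integral_cong_AE)
    show "AE y in ?N. (\<integral>\<^sup>+x. ?a x * ?u y \<partial>?M) = (\<integral>\<^sup>+x. ?a (y + x) * ?u y \<partial>?M)"
      using AE_frame_lborel_span[OF C]
    proof eventually_elim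
      case (elim y)
      then have "y \<in> span B" using sp by simp
      from nn_integral_frame_lborel_translate[OF B this, of "\<lambda>x. ?a x * ?u y"]
      show ?case by simp
    qed
  qed
  also have "\<dots> = (\<integral>\<^sup>+x. \<integral>\<^sup>+y. ?a (y + x) * ?u y \<partial>?N \<partial>?M)"
    by (rule swap[symmetric]) measurable
  also have "\<dots> = (\<integral>\<^sup>+x. \<integral>\<^sup>+y. ?a y * ?u (y - x) \<partial>?N \<partial>?M)"
  proof (rule nn_integral_cong_AE)
    show "AE x in ?M. (\<integral>\<^sup>+y. ?a (y + x) * ?u y \<partial>?N) = (\<integral>\<^sup>+y. ?a y * ?u (y - x) \<partial>?N)"
      using AE_frame_lborel_span[OF B]
    proof eventually_elim
      case (elim x)
      then have "x \<in> span C" using sp by simp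
      from nn_integral_frame_lborel_translate[OF C this, of "\<lambda>y. ?a y * ?u (y - x)"]
      show ?case by (simp add: add.commute)
    qed
  qed
  also have "\<dots> = (\<integral>\<^sup>+y. \<integral>\<^sup>+x. ?a y * ?u (y - x) \<partial>?M \<partial>?N)"
    by (rule swap) measurable
  also have "\<dots> = (\<integral>\<^sup>+y. ?a y * emeasure ?M ?U \<partial>?N)"
  proof (rule nn_integral_cong_AE)
    show "AE y in ?N. (\<integral>\<^sup>+x. ?a y * ?u (y - x) \<partial>?M) = ?a y * emeasure ?M ?U"
      using AE_frame_lborel_span[OF C]
    proof eventually_elim
      case (elim y)
      then have "y \<in> span B" using sp by simp
      from nn_integral_frame_lborel_translate[OF B this, of "\<lambda>x. ?u (y - x)"]
      have "(\<integral>\<^sup>+x. ?u (y - x) \<partial>?M) = (\<integral>\<^sup>+x. ?u (- x) \<partial>?M)"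
        by simp
      also have "\<dots> = (\<integral>\<^sup>+x. ?u x \<partial>?M)"
        by (intro nn_integral_cong) (simp add: indicator_def)
      finally show ?case by (simp add: nn_integral_cmult)
    qed
  qed
  also have "\<dots> = emeasure ?N A * emeasure ?M ?U" by (simp add: nn_integral_multc)
  \<comment> \<open>Both bases have as many elements as the dimension of the common span, so the two
    unit balls have equal measure; this value is positive and finite, so it cancels.\<close>
  also have "emeasure ?M ?U = emeasure ?N ?U"
  proof (rule emeasure_frame_lborel_cball_cong[OF B C])
    have "card D = dim D" if "orthonormal D" for D :: "'a set"
      using orthonormal_independent[OF that] by (simp add: dim_eq_card_independent)
    then show "card B = card C" using B C sp by (metis dim_span)
  qed
  finally show "emeasure ?M A = emeasure ?N A" using emeasure_frame_lborel_cball_pos_finite[OF C, of 1]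
    using ennreal_mult_cancel_left[of "emeasure ?N ?U" "emeasure ?M A" "emeasure ?N A"]
    by (auto simp: mult.commute)
qed simp

lemma frame_lborel_Basis: "frame_lborel Basis = (lborel :: 'a::euclidean_space measure)"
  unfolding frame_lborel_def by (rule lborel_eq[symmetric])

lemma orthonormal_Basis: "orthonormal Basis"
  by (auto simp: orthonormal_def pairwise_def orthogonal_def inner_Basis)

text \<open>Uniqueness makes the basis picked by \<open>SOME\<close> immaterial. Each section can
  therefore be measured in a basis containing the direction of the projected axis.\<close>

lemma subspace_lborel_eq_frame:
  assumes "orthonormal B"
  shows "subspace_lborel (span B) = frame_lborel B"
proof -
  define D where "D = (SOME D. orthonormal_basis_of (span B) D)"
  have "orthonormal_basis_of (span B) B" using assms by (simp add: orthonormal_basis_of_def orthonormal_def)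
  then have "orthonormal_basis_of (span B) D" unfolding D_def by (rule someI)
  then have "orthonormal D" "span D = span B" by (auto simp: orthonormal_basis_of_def orthonormal_def)
  then show ?thesis using frame_lborel_cong_span[of D B] assms unfolding D_def
    by (simp add: subspace_lborel_def frame_lborel_def Let_def)
qed

section \<open>Integration along one axis and over concentric spheres\<close>

lemma nn_integral_frame_lborel_insert:
  assumes B: "orthonormal (insert e B)" "e \<notin> B" and G [measurable]: "G \<in> borel_measurable borel"
  shows "(\<integral>\<^sup>+x. G x \<partial>frame_lborel (insert e B)) = (\<integral>\<^sup>+s. (\<integral>\<^sup>+y. G (s *\<^sub>R e + y) \<partial>frame_lborel B) \<partial>lborel)"
proof -
  interpret product_sigma_finite "\<lambda>_ :: 'a. lborel :: real measure"
    by (rule product_sigma_finite_lborel)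
  let ?P = "\<lambda>B :: 'a set. \<Pi>\<^sub>M b\<in>B. (lborel :: real measure)"
  have fin: "finite B" using orthonormal_finite[OF B(1)] by simp
  have "(\<integral>\<^sup>+x. G x \<partial>frame_lborel (insert e B)) = (\<integral>\<^sup>+f. G (\<Sum>b\<in>insert e B. f b *\<^sub>R b) \<partial>?P (insert e B))"
    unfolding frame_lborel_def by (subst nn_integral_distr) auto
  also have "\<dots> = (\<integral>\<^sup>+s. (\<integral>\<^sup>+f. G (\<Sum>b\<in>insert e B. (f(e := s)) b *\<^sub>R b) \<partial>?P B) \<partial>lborel)"
    using fin B(2) by (subst product_nn_integral_insert_rev) auto
  also have "\<dots> = (\<integral>\<^sup>+s. (\<integral>\<^sup>+f. G (s *\<^sub>R e + (\<Sum>b\<in>B. f b *\<^sub>R b)) \<partial>?P B) \<partial>lborel)"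
    using fin B(2) by (intro nn_integral_cong arg_cong[of _ _ G])
      (auto intro!: sum.cong)
  also have "\<dots> = (\<integral>\<^sup>+s. (\<integral>\<^sup>+y. G (s *\<^sub>R e + y) \<partial>frame_lborel B) \<partial>lborel)"
    unfolding frame_lborel_def by (subst nn_integral_distr) auto
  finally show ?thesis .
qed

text \<open>Polar coordinates without a surface measure: the push-forward of the measure under the
  norm and the measure with density \<open>\<omega> * m * t ^ (m - 1)\<close> on
  \<open>{0..1}\<close> agree on all half-lines, since the measure of a ball is homogeneous of
  degree \<open>m\<close> in the radius.\<close>

lemma nn_integral_radial:
  fixes M :: "'a::euclidean_space measure"
  assumes sets [measurable_cong]: "sets M = sets borel" and m: "m \<ge> 1"
    and hom: "\<And>t. t \<ge> 0 \<Longrightarrow> emeasure M (cball 0 t) = ennreal (t ^ m) * emeasure M (cball 0 1)"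
    and fin: "emeasure M (cball 0 1) < \<infinity>"
    and f [measurable]: "f \<in> borel_measurable borel"
  shows "(\<integral>\<^sup>+x. f (norm x) * indicator (cball 0 1) x \<partial>M) =
    emeasure M (cball 0 1) * (\<integral>\<^sup>+t\<in>{0..1}. ennreal (m * t ^ (m - 1)) * f t \<partial>lborel)"
proof -
  define \<omega> where "\<omega> = emeasure M (cball 0 1)"
  define N1 where "N1 = distr (density M (indicator (cball 0 1))) borel (norm :: 'a \<Rightarrow> real)"
  define N2 where "N2 = density lborel (\<lambda>t. \<omega> * (ennreal (m * t ^ (m - 1)) * indicator {0..1} t))"
  have cb [measurable]: "cball (0 :: 'a) t \<in> sets borel" for t by simp
  have [measurable]: "(indicator (cball 0 1) :: 'a \<Rightarrow> ennreal) \<in> borel_measurable M"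
    by (subst borel_measurable_indicator_iff) (simp add: sets cong: sets_eq_imp_space_eq)
  have e1: "emeasure N1 {x <..} = emeasure M (cball 0 1 - cball 0 x)" for x proof -
    have "emeasure N1 {x <..} = emeasure (density M (indicator (cball 0 1))) (norm -` {x<..} \<inter> space M)"
      unfolding N1_def by (subst emeasure_distr) auto
    also have "\<dots> = (\<integral>\<^sup>+y. indicator (cball 0 1) y * indicator (norm -` {x<..} \<inter> space M) y \<partial>M)"
      by (rule emeasure_density) measurable
    also have "\<dots> = (\<integral>\<^sup>+y. indicator (cball 0 1 - cball 0 x) y \<partial>M)"
      by (intro nn_integral_cong) (auto simp: indicator_def)
    also have "\<dots> = emeasure M (cball 0 1 - cball 0 x)"
      by (rule nn_integral_indicator) (simp add: sets)
    finally show ?thesis .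
  qed
  have ftc: "(\<integral>\<^sup>+t\<in>{a..1}. ennreal (m * t ^ (m - 1)) \<partial>lborel) = ennreal (1 - a ^ m)"
    if "0 \<le> a" "a \<le> 1" for a :: real
  proof -
    have "(\<integral>\<^sup>+t\<in>{a..1}. ennreal (m * t ^ (m - 1)) \<partial>lborel) = ennreal (1 ^ m - a ^ m)"
      using that m by (intro nn_integral_FTC_Icc) (auto intro!: derivative_eq_intros)
    then show ?thesis by simp
  qed
  have e2: "emeasure N2 {x <..} = \<omega> * (\<integral>\<^sup>+t. ennreal (m * t ^ (m - 1)) * indicator ({0..1} \<inter> {x<..}) t \<partial>lborel)" for x
  proof -
    have "emeasure N2 {x <..} = (\<integral>\<^sup>+t\<in>{x<..}. \<omega> * (ennreal (m * t ^ (m - 1)) * indicator {0..1} t) \<partial>lborel)"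
      unfolding N2_def by (rule emeasure_density) auto
    also have "\<dots> = (\<integral>\<^sup>+t. \<omega> * (ennreal (m * t ^ (m - 1)) * indicator ({0..1} \<inter> {x<..}) t) \<partial>lborel)"
      by (intro nn_integral_cong) (auto simp: indicator_def)
    finally show ?thesis by (simp add: nn_integral_cmult)
  qed
  have "N1 = N2"
  proof (rule measure_eqI_lessThan)
    fix x :: real
    show "emeasure N1 {x <..} < \<infinity>"
      unfolding e1 by (rule le_less_trans[OF emeasure_mono fin]) (auto simp: sets)
    consider "x < 0" | "0 \<le> x" "x \<le> 1" | "x > 1" by linarith
    then show "emeasure N1 {x <..} = emeasure N2 {x <..}"
    proof cases
      case 1
      then have "cball 0 1 - cball (0 :: 'a) x = cball 0 1" "{0..1} \<inter> {x<..} = {0..1}" by auto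
      then show ?thesis unfolding e1 e2 using ftc[of 0] m by (simp add: \<omega>_def zero_power)
    next
      case 2
      have "(\<integral>\<^sup>+t. ennreal (m * t ^ (m - 1)) * indicator ({0..1} \<inter> {x<..}) t \<partial>lborel)
          = (\<integral>\<^sup>+t\<in>{x..1}. ennreal (m * t ^ (m - 1)) \<partial>lborel)"
        using AE_lborel_singleton[of x] 2
        by (intro nn_integral_cong_AE) (auto elim!: eventually_mono simp: indicator_def)
      also have "\<dots> = ennreal (1 - x ^ m)" using 2 by (rule ftc)
      finally have "emeasure N2 {x <..} = \<omega> * ennreal (1 - x ^ m)" by (simp add: e2)
      also have "\<dots> = \<omega> - ennreal (x ^ m) * \<omega>" using 2 fin power_le_one[of x m]
        by (subst ennreal_minus[symmetric]) (auto simp: \<omega>_def ennreal_right_diff_distrib mult.commute)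
      also have "\<dots> = emeasure M (cball 0 1) - emeasure M (cball 0 x)"
        using 2 by (simp add: hom[of x] \<omega>_def)
      also have "\<dots> = emeasure M (cball 0 1 - cball 0 x)"
      proof (rule emeasure_Diff[symmetric])
        show "emeasure M (cball 0 x) \<noteq> \<infinity>"
          using fin 2 by (subst hom) (auto simp: ennreal_mult_eq_top_iff)
      qed (use 2 in \<open>auto simp: sets\<close>)
      finally show ?thesis by (simp add: e1)
    next
      case 3
      then have *: "cball 0 1 - cball (0 :: 'a) x = {}" "{0..1} \<inter> {x<..} = {}" by auto
      show ?thesis unfolding e1 e2 * by simp
    qed
  qed (auto simp: N1_def N2_def)
  have "(\<integral>\<^sup>+x. f (norm x) * indicator (cball 0 1) x \<partial>M) = (\<integral>\<^sup>+t. f t \<partial>N1)"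
  proof -
    have "(\<integral>\<^sup>+t. f t \<partial>N1) = (\<integral>\<^sup>+x. f (norm x) \<partial>density M (indicator (cball 0 1)))"
      unfolding N1_def by (rule nn_integral_distr) measurable
    also have "\<dots> = (\<integral>\<^sup>+x. indicator (cball 0 1) x * f (norm x) \<partial>M)"
      by (rule nn_integral_density) measurable
    finally show ?thesis by (simp only: mult.commute)
  qed
  also have "\<dots> = (\<integral>\<^sup>+t. f t \<partial>N2)" using \<open>N1 = N2\<close> by simp
  also have "\<dots> = (\<integral>\<^sup>+t. \<omega> * (ennreal (m * t ^ (m - 1)) * f t * indicator {0..1} t) \<partial>lborel)"
  proof -
    have "(\<integral>\<^sup>+t. f t \<partial>N2) = (\<integral>\<^sup>+t. \<omega> * (ennreal (m * t ^ (m - 1)) * indicator {0..1} t) * f t \<partial>lborel)"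
      unfolding N2_def by (rule nn_integral_density) measurable
    then show ?thesis by (simp only: ac_simps)
  qed
  finally show ?thesis by (simp add: nn_integral_cmult \<omega>_def)
qed

lemma nn_integral_frame_radial:
  fixes B :: "'a::euclidean_space set"
  assumes B: "orthonormal B" "B \<noteq> {}" and f: "f \<in> borel_measurable borel"
  shows "(\<integral>\<^sup>+x\<in>(cball 0 1). f (norm x) \<partial>frame_lborel B) =
    unit_ball_vol B
      * (\<integral>\<^sup>+t\<in>{0..1}. ennreal (card B * t ^ (card B - 1)) * f t \<partial>lborel)"
proof (rule nn_integral_radial)
  show "card B \<ge> 1" using B orthonormal_finite[OF B(1)] by (simp add: Suc_le_eq card_gt_0_iff)
  show "unit_ball_vol B < \<infinity>" by (rule emeasure_frame_lborel_cball_pos_finite[OF B(1)]) simp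
  show "emeasure (frame_lborel B) (cball 0 t) = ennreal (t ^ card B) * unit_ball_vol B"
    if "t \<ge> 0" for t by (rule emeasure_frame_lborel_cball_scale[OF B(1) that B(2)])
qed (simp_all add: f)

section \<open>Equidistribution of ridges\<close>

text \<open>
  Equidistribution: \<open>p\<close> has small averages over windows of length \<open>2\<close>, and \<open>\<Phi>\<close> is, up to the
  factor \<open>2\<close>, convex. So at every \<open>t \<ge> \<eta>\<close> the point \<open>t\<close> carries at most the mass
  that Lebesgue measure gives to the preceding window of \<open>\<Phi>\<close>-values; Fubini does the rest.
\<close>

lemma nn_integral_compose_le_window:
  fixes p \<Phi> \<Phi>' :: "real \<Rightarrow> real"
  assumes [measurable]: "p \<in> borel_measurable borel" "\<Phi> \<in> borel_measurable borel" "\<Phi>' \<in> borel_measurable borel"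
    and p0: "\<And>u. p u \<ge> 0" and pS: "\<And>u. p u \<le> S"
    and window: "\<And>x. (\<integral>\<^sup>+u\<in>{x..x + 2}. ennreal (p u) \<partial>lborel) \<le> W"
    and \<eta>: "0 < \<eta>" "\<eta> \<le> 1"
    and cont: "continuous_on {0..1} \<Phi>"
    and deriv: "\<And>t. 0 < t \<Longrightarrow> t \<le> 1 \<Longrightarrow> (\<Phi> has_real_derivative \<Phi>' t) (at t)"
    and cont': "continuous_on {\<eta>..1} \<Phi>'"
    and nonneg: "\<And>t. 0 < t \<Longrightarrow> t \<le> 1 \<Longrightarrow> 0 \<le> \<Phi>' t"
    and quasi: "\<And>s t. 0 < s \<Longrightarrow> s \<le> t \<Longrightarrow> t \<le> 1 \<Longrightarrow> \<Phi>' s \<le> 2 * \<Phi>' t"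
    and grow: "\<Phi> 0 + 2 \<le> \<Phi> \<eta>"
  shows "(\<integral>\<^sup>+t\<in>{0..1}. ennreal (p (\<Phi> t)) \<partial>lborel) \<le> ennreal (\<eta> * S) + W"
proof -
  have mvt: "\<exists>z. s < z \<and> z < t \<and> \<Phi> t - \<Phi> s = (t - s) * \<Phi>' z" if st: "0 \<le> s" "s < t" "t \<le> 1" for s t
  proof -
    have "\<exists>l z. s < z \<and> z < t \<and> DERIV \<Phi> z :> l \<and> \<Phi> t - \<Phi> s = (t - s) * l"
    proof (rule MVT[OF st(2)])
      show "continuous_on {s..t} \<Phi>" by (rule continuous_on_subset[OF cont]) (use st in auto)
      show "\<Phi> differentiable (at x)" if "s < x" "x < t" for x
        using deriv[of x] that st by (auto simp: real_differentiable_def)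
    qed
    then obtain l z where z: "s < z" "z < t" "DERIV \<Phi> z :> l" "\<Phi> t - \<Phi> s = (t - s) * l"
      by blast
    moreover have "l = \<Phi>' z" using DERIV_unique[OF z(3) deriv[of z]] z st by simp
    ultimately show ?thesis by blast
  qed
  have mono: "\<Phi> s \<le> \<Phi> t" if st: "0 \<le> s" "s \<le> t" "t \<le> 1" for s t
  proof (cases "s = t")
    case False
    then obtain z where z: "s < z" "z < t" "\<Phi> t - \<Phi> s = (t - s) * \<Phi>' z"
      using mvt[of s t] st by auto
    then have "0 \<le> (t - s) * \<Phi>' z" using nonneg[of z] st by simp
    then show ?thesis using z by simp
  qed simp
  \<comment> \<open>The pairs with \<open>\<Phi> s \<le> \<Phi> t \<le> \<Phi> s + 2\<close>. For
    fixed \<open>t \<ge> \<eta>\<close> they fill a set of \<open>s\<close> of measure at least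
    \<open>1 / \<Phi>' t\<close>; for fixed \<open>s\<close> the substitution by \<Phi> turns them
    into part of one window of length 2.\<close>
  let ?J = "\<lambda>s t. indicator {0..1} s * indicator {\<eta>..1} t * indicator {\<Phi> s..\<Phi> s + 2} (\<Phi> t) :: ennreal"
  have key: "ennreal (p (\<Phi> t)) * indicator {\<eta>..1} t
      \<le> (\<integral>\<^sup>+s. ennreal (p (\<Phi> t) * \<Phi>' t) * ?J s t \<partial>lborel)" for t
  proof (cases "t \<in> {\<eta>..1}")
    case True
    have le: "\<Phi> 0 \<le> \<Phi> t - 2" using grow mono[of \<eta> t] True \<eta> by auto
    \<comment> \<open>The parameter at which \<Phi> lies exactly one window behind; the growth on
      \<open>{0..\<eta>}\<close> ensures that it exists.\<close>
    obtain r where r: "0 \<le> r" "r \<le> t" "\<Phi> r = \<Phi> t - 2"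
      using IVT'[of \<Phi> 0 "\<Phi> t - 2" t] le True \<eta> continuous_on_subset[OF cont, of "{0..t}"] by auto
    then have "r < t" by (cases "r = t") auto
    then obtain z where z: "r < z" "z < t" "\<Phi> t - \<Phi> r = (t - r) * \<Phi>' z"
      using r True mvt[of r t] by auto
    then have "2 = (t - r) * \<Phi>' z" using r by simp
    \<comment> \<open>The mean slope is attained at some \<open>z < t\<close> and is at most twice
      the slope at \<open>t\<close>; this doubling is why windows of length 2 are used.\<close>
    also have "\<dots> \<le> (t - r) * (2 * \<Phi>' t)"
      using quasi[of z t] z r True by (intro mult_left_mono) auto
    finally have one: "1 \<le> \<Phi>' t * (t - r)" by (simp add: mult.commute)
    have "ennreal (p (\<Phi> t)) \<le> ennreal (p (\<Phi> t) * (\<Phi>' t * (t - r)))"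
      using mult_left_mono[OF one p0[of "\<Phi> t"]] by (intro ennreal_leI) simp
    also have "\<dots> = ennreal (p (\<Phi> t) * \<Phi>' t) * emeasure lborel {r..t}"
      using p0[of "\<Phi> t"] nonneg[of t] True r \<eta> by (simp add: ennreal_mult[symmetric] mult.assoc)
    also have "\<dots> = (\<integral>\<^sup>+s\<in>{r..t}. ennreal (p (\<Phi> t) * \<Phi>' t) \<partial>lborel)"
      by (simp add: nn_integral_cmult)
    also have "\<dots> \<le> (\<integral>\<^sup>+s. ennreal (p (\<Phi> t) * \<Phi>' t) * ?J s t \<partial>lborel)"
    proof (intro nn_integral_mono mult_left_mono)
      fix s
      show "indicator {r..t} s \<le> ?J s t"
        using r True mono[of r s] mono[of s t] by (auto simp: indicator_def)
    qed simp
    finally show ?thesis using True by simp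
  qed simp
  have inner: "(\<integral>\<^sup>+t. ennreal (p (\<Phi> t) * \<Phi>' t) * ?J s t \<partial>lborel) \<le> W * indicator {0..1} s" for s
  proof -
    let ?f = "\<lambda>u. p u * indicator {\<Phi> s..\<Phi> s + 2} u :: real"
    have "(\<integral>\<^sup>+t. ennreal (p (\<Phi> t) * \<Phi>' t) * ?J s t \<partial>lborel)
        = (\<integral>\<^sup>+t. indicator {0..1} s * ennreal (?f (\<Phi> t) * \<Phi>' t * indicator {\<eta>..1} t) \<partial>lborel)"
      by (intro nn_integral_cong) (auto simp: indicator_def)
    also have "\<dots> = indicator {0..1} s * (\<integral>\<^sup>+t. ennreal (?f (\<Phi> t) * \<Phi>' t * indicator {\<eta>..1} t) \<partial>lborel)"
      by (rule nn_integral_cmult) measurable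
    also have "(\<integral>\<^sup>+t. ennreal (?f (\<Phi> t) * \<Phi>' t * indicator {\<eta>..1} t) \<partial>lborel)
        = (\<integral>\<^sup>+u. ennreal (?f u * indicator {\<Phi> \<eta>..\<Phi> 1} u) \<partial>lborel)"
    proof (rule nn_integral_substitution[symmetric])
      show "set_borel_measurable borel {\<Phi> \<eta>..\<Phi> 1} ?f"
        unfolding set_borel_measurable_def by measurable
    qed (use deriv cont' nonneg \<eta> in auto)
    also have "\<dots> \<le> (\<integral>\<^sup>+u\<in>{\<Phi> s..\<Phi> s + 2}. ennreal (p u) \<partial>lborel)"
      by (intro nn_integral_mono) (auto simp: indicator_def p0)
    also have "\<dots> \<le> W" by (rule window)
    finally show ?thesis by (auto simp: indicator_def mult_left_mono)
  qed
  \<comment> \<open>The initial stretch is estimated by the supremum \<open>S\<close> alone.\<close>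
  have "(\<integral>\<^sup>+t\<in>{0..1}. ennreal (p (\<Phi> t)) \<partial>lborel)
      \<le> (\<integral>\<^sup>+t. ennreal S * indicator {0..\<eta>} t + ennreal (p (\<Phi> t)) * indicator {\<eta>..1} t \<partial>lborel)"
    using \<eta> pS by (intro nn_integral_mono) (auto simp: indicator_def intro: ennreal_leI)
  also have "\<dots> = ennreal S * ennreal \<eta> + (\<integral>\<^sup>+t\<in>{\<eta>..1}. ennreal (p (\<Phi> t)) \<partial>lborel)"
    using \<eta> by (subst nn_integral_add) (auto simp: nn_integral_cmult)
  also have "ennreal S * ennreal \<eta> = ennreal (\<eta> * S)"
    using \<eta> p0[of 0] pS[of 0] by (subst ennreal_mult[symmetric]) (auto simp: mult.commute)
  also have "(\<integral>\<^sup>+t\<in>{\<eta>..1}. ennreal (p (\<Phi> t)) \<partial>lborel)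
      \<le> (\<integral>\<^sup>+t. \<integral>\<^sup>+s. ennreal (p (\<Phi> t) * \<Phi>' t) * ?J s t \<partial>lborel \<partial>lborel)"
    by (intro nn_integral_mono key)
  also have "\<dots> = (\<integral>\<^sup>+s. \<integral>\<^sup>+t. ennreal (p (\<Phi> t) * \<Phi>' t) * ?J s t \<partial>lborel \<partial>lborel)"
  proof (rule lborel_pair.Fubini')
    have "(\<lambda>(s, t). ennreal (p (\<Phi> t) * \<Phi>' t) * ?J s t) \<in> borel_measurable (lborel \<Otimes>\<^sub>M lborel)"
      unfolding indicator_def atLeastAtMost_iff by measurable
    then show "(\<lambda>(x, y). ennreal (p (\<Phi> y) * \<Phi>' y) * ?J x y) \<in> borel_measurable (lborel \<Otimes>\<^sub>M lborel)" .
  qed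
  also have "\<dots> \<le> (\<integral>\<^sup>+s\<in>{0..1 :: real}. W \<partial>lborel)"
    by (rule nn_integral_mono, rule inner)
  also have "\<dots> = W" by (simp add: nn_integral_cmult)
  finally show ?thesis by (simp add: add_left_mono)
qed

text \<open>Integrate the window bound over all starting points \<open>y\<close> in
  \<open>{a..b - 4}\<close>. These windows stay inside \<open>{a..b}\<close>, and a point
  \<open>u\<close> belongs only to windows starting in \<open>{u - 4..u}\<close>, so it is counted
  with weight at most 4.\<close>

lemma nn_integral_ge_window:
  fixes p :: "real \<Rightarrow> real"
  assumes [measurable]: "p \<in> borel_measurable borel"
    and window: "\<And>y. W \<le> (\<integral>\<^sup>+u\<in>{y..y + 4}. ennreal (p u) \<partial>lborel)"
    and ab: "a \<le> b - 4"
  shows "ennreal ((b - 4 - a) / 4) * W \<le> (\<integral>\<^sup>+u\<in>{a..b}. ennreal (p u) \<partial>lborel)"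
proof -
  let ?J = "\<lambda>y u. indicator {a..b - 4} y * indicator {y..y + 4} u :: ennreal"
  have "ennreal (b - 4 - a) * W = (\<integral>\<^sup>+y\<in>{a..b - 4}. W \<partial>lborel)"
    using ab by (simp add: nn_integral_cmult mult.commute)
  also have "\<dots> \<le> (\<integral>\<^sup>+y. (\<integral>\<^sup>+u. ennreal (p u) * ?J y u \<partial>lborel) \<partial>lborel)"
  proof (rule nn_integral_mono)
    fix y
    show "W * indicator {a..b - 4} y \<le> (\<integral>\<^sup>+u. ennreal (p u) * ?J y u \<partial>lborel)"
      using window[of y] by (cases "y \<in> {a..b - 4}") (auto simp: indicator_def cong: if_cong)
  qed
  also have "\<dots> = (\<integral>\<^sup>+u. (\<integral>\<^sup>+y. ennreal (p u) * ?J y u \<partial>lborel) \<partial>lborel)"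
  proof (rule lborel_pair.Fubini'[symmetric])
    have "(\<lambda>(y, u). ennreal (p u) * ?J y u) \<in> borel_measurable (lborel \<Otimes>\<^sub>M lborel)"
      unfolding indicator_def atLeastAtMost_iff by measurable
    then show "(\<lambda>(x, y). ennreal (p y) * ?J x y) \<in> borel_measurable (lborel \<Otimes>\<^sub>M lborel)" .
  qed
  also have "\<dots> \<le> (\<integral>\<^sup>+u. ennreal 4 * (ennreal (p u) * indicator {a..b} u) \<partial>lborel)"
  proof (rule nn_integral_mono)
    fix u
    have "(\<integral>\<^sup>+y. ennreal (p u) * ?J y u \<partial>lborel)
        \<le> (\<integral>\<^sup>+y\<in>{u - 4..u}. (ennreal (p u) * indicator {a..b} u) \<partial>lborel)"
      by (intro nn_integral_mono) (auto simp: indicator_def)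
    also have "\<dots> = ennreal 4 * (ennreal (p u) * indicator {a..b} u)"
      by (simp add: nn_integral_cmult mult.commute)
    finally show "(\<integral>\<^sup>+y. ennreal (p u) * ?J y u \<partial>lborel) \<le> ennreal 4 * (ennreal (p u) * indicator {a..b} u)" .
  qed
  also have "\<dots> = ennreal 4 * (\<integral>\<^sup>+u\<in>{a..b}. ennreal (p u) \<partial>lborel)"
    by (rule nn_integral_cmult) measurable
  finally have le: "ennreal (b - 4 - a) * W \<le> ennreal 4 * (\<integral>\<^sup>+u\<in>{a..b}. ennreal (p u) \<partial>lborel)" .
  have "ennreal ((b - 4 - a) / 4) * W = ennreal (1 / 4) * (ennreal (b - 4 - a) * W)"
    using ab by (simp add: mult.assoc[symmetric] ennreal_mult[symmetric])
  also have "\<dots> \<le> ennreal (1 / 4) * (ennreal 4 * (\<integral>\<^sup>+u\<in>{a..b}. ennreal (p u) \<partial>lborel))"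
    by (intro mult_left_mono le) simp
  also have "\<dots> = (\<integral>\<^sup>+u\<in>{a..b}. ennreal (p u) \<partial>lborel)" proof -
    have "ennreal (1 / 4) * ennreal 4 = 1" by (subst ennreal_mult[symmetric]) auto
    then show ?thesis unfolding mult.assoc[symmetric] by simp
  qed
  finally show ?thesis .
qed

text \<open>With \<open>\<beta>\<close> as unit of angle the ridges sit at the odd integers; \<open>tri\<close> is the distance to them.\<close>

definition tri :: "real \<Rightarrow> real" where
  "tri u = \<bar>u - (2 * of_int \<lfloor>u / 2\<rfloor> + 1)\<bar>"

lemma tri_borel [measurable]: "tri \<in> borel_measurable borel"
  unfolding tri_def by measurable

lemma tri_bounds: "0 \<le> tri u" "tri u \<le> 1"
  unfolding tri_def by linarith+

lemma tri_eq: "2 * of_int j \<le> u \<Longrightarrow> u \<le> 2 * of_int j + 2 \<Longrightarrow> tri u = \<bar>u - (2 * of_int j + 1)\<bar>"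
proof (cases "u = 2 * of_int j + 2")
  case True
  \<comment> \<open>At the right end the floor already belongs to the next period, but the distance
    to both neighbouring odd integers is 1.\<close>
  then have "u / 2 = of_int (j + 1)" by simp
  then have "\<lfloor>u / 2\<rfloor> = j + 1" by (metis floor_of_int)
  then show ?thesis using True by (simp add: tri_def)
next
  case False
  assume "2 * of_int j \<le> u" "u \<le> 2 * of_int j + 2"
  with False have "\<lfloor>u / 2\<rfloor> = j" by (intro floor_unique) auto
  then show ?thesis by (simp add: tri_def)
qed

text \<open>The \<open>p\<close>-th power of an inverse depth in units of \<beta>; the cut-off
  \<open>d\<close> keeps the powers \<open>p \<ge> 2\<close> integrable at
  \<open>v = 0\<close>.\<close>

definition ridge :: "nat \<Rightarrow> real \<Rightarrow> real \<Rightarrow> real" where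
  "ridge p d v = (1 / sqrt (d + v)) ^ p"

definition ridge_integral :: "nat \<Rightarrow> real \<Rightarrow> ennreal" where
  "ridge_integral p d = (\<integral>\<^sup>+v\<in>{0..1}. ennreal (ridge p d v) \<partial>lborel)"

lemma ridge_borel [measurable]: "ridge p d \<in> borel_measurable borel"
  unfolding ridge_def by measurable

lemma ridge_nonneg: "0 \<le> d + v \<Longrightarrow> 0 \<le> ridge p d v"
  by (simp add: ridge_def)

lemma ridge_le: "0 < d \<Longrightarrow> 0 \<le> v \<Longrightarrow> ridge p d v \<le> (1 / sqrt d) ^ p"
  unfolding ridge_def by (intro power_mono divide_left_mono) auto

text \<open>The integrand is symmetric about the ridge at \<open>c = 2 * j + 1\<close>, and each
  half of the period contributes one \<open>ridge_integral\<close>.\<close>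

lemma nn_integral_ridge_period:
  "(\<integral>\<^sup>+u\<in>{2 * of_int j..2 * of_int j + 2}. ennreal (ridge p d (tri u)) \<partial>lborel) = 2 * ridge_integral p d"
proof -
  define c :: real where "c = 2 * of_int j + 1"
  have "(\<integral>\<^sup>+u\<in>{2 * of_int j..2 * of_int j + 2}. ennreal (ridge p d (tri u)) \<partial>lborel)
      = (\<integral>\<^sup>+u. ennreal (ridge p d \<bar>u - c\<bar>) * indicator {c..c + 1} u + ennreal (ridge p d \<bar>u - c\<bar>) * indicator {c - 1..c} u \<partial>lborel)"
    using AE_lborel_singleton[of c]
    by (intro nn_integral_cong_AE) (auto elim!: eventually_mono simp: indicator_def tri_eq[of j] c_def)
  also have "\<dots> = (\<integral>\<^sup>+u\<in>{c..c + 1}. ennreal (ridge p d \<bar>u - c\<bar>) \<partial>lborel)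
      + (\<integral>\<^sup>+u\<in>{c - 1..c}. ennreal (ridge p d \<bar>u - c\<bar>) \<partial>lborel)"
    by (rule nn_integral_add) measurable
  also have "(\<integral>\<^sup>+u\<in>{c..c + 1}. ennreal (ridge p d \<bar>u - c\<bar>) \<partial>lborel) = ridge_integral p d"
    unfolding ridge_integral_def
    by (subst nn_integral_real_affine[where c = 1 and t = c]) (auto intro!: nn_integral_cong simp: indicator_def)
  also have "(\<integral>\<^sup>+u\<in>{c - 1..c}. ennreal (ridge p d \<bar>u - c\<bar>) \<partial>lborel) = ridge_integral p d"
  proof -
    have "(\<integral>\<^sup>+u\<in>{c - 1..c}. ennreal (ridge p d \<bar>u - c\<bar>) \<partial>lborel)
        = ennreal \<bar>- 1\<bar> * (\<integral>\<^sup>+v. ennreal (ridge p d \<bar>(c + - 1 * v) - c\<bar>) * indicator {c - 1..c} (c + - 1 * v) \<partial>lborel)"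
      by (rule nn_integral_real_affine) auto
    also have "\<dots> = (\<integral>\<^sup>+v. ennreal (ridge p d \<bar>(c + - 1 * v) - c\<bar>) * indicator {c - 1..c} (c + - 1 * v) \<partial>lborel)"
      by simp
    also have "\<dots> = ridge_integral p d" unfolding ridge_integral_def
    proof (rule nn_integral_cong)
      fix v :: real
      show "ennreal (ridge p d \<bar>(c + - 1 * v) - c\<bar>) * indicator {c - 1..c} (c + - 1 * v)
          = ennreal (ridge p d v) * indicator {0..1} v" by (cases "v \<in> {0..1}") auto
    qed
    finally show ?thesis .
  qed
  finally show ?thesis unfolding mult_2 .
qed

text \<open>Any window of length 2 is covered by two consecutive periods.\<close>

lemma nn_integral_ridge_window_le:
  "(\<integral>\<^sup>+u\<in>{x..x + 2}. ennreal (ridge p d (tri u)) \<partial>lborel) \<le> 4 * ridge_integral p d"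
proof -
  define j where "j = \<lfloor>x / 2\<rfloor>"
  have j: "2 * of_int j \<le> x" "x < 2 * of_int j + 2" unfolding j_def by linarith+
  let ?I = "\<lambda>j u. ennreal (ridge p d (tri u)) * indicator {2 * of_int j..2 * of_int j + 2} u"
  have "(\<integral>\<^sup>+u\<in>{x..x + 2}. ennreal (ridge p d (tri u)) \<partial>lborel)
      \<le> (\<integral>\<^sup>+u. ?I j u + ?I (j + 1) u \<partial>lborel)"
    using j by (intro nn_integral_mono) (auto simp: indicator_def)
  also have "\<dots> = (\<integral>\<^sup>+u. ?I j u \<partial>lborel) + (\<integral>\<^sup>+u. ?I (j + 1) u \<partial>lborel)"
    by (rule nn_integral_add) measurable
  also have "\<dots> = (2 + 2) * ridge_integral p d"
    unfolding nn_integral_ridge_period by (rule distrib_right[symmetric])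
  also have "(2 + 2 :: ennreal) = 4" by simp
  finally show ?thesis .
qed

text \<open>Any window of length 4 contains a complete period.\<close>

lemma nn_integral_ridge_window_ge:
  "2 * ridge_integral p d \<le> (\<integral>\<^sup>+u\<in>{y..y + 4}. ennreal (ridge p d (tri u)) \<partial>lborel)"
proof -
  define j where "j = \<lceil>y / 2\<rceil>"
  have j: "y \<le> 2 * of_int j" "2 * of_int j < y + 2" unfolding j_def by linarith+
  have "2 * ridge_integral p d = (\<integral>\<^sup>+u\<in>{2 * of_int j..2 * of_int j + 2}. ennreal (ridge p d (tri u)) \<partial>lborel)"
    by (rule nn_integral_ridge_period[symmetric])
  also have "\<dots> \<le> (\<integral>\<^sup>+u\<in>{y..y + 4}. ennreal (ridge p d (tri u)) \<partial>lborel)"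
    using j by (intro nn_integral_mono) (auto simp: indicator_def)
  finally show ?thesis .
qed

section \<open>Choice of the parameters\<close>

lemma ridge_integral_finite: "0 < d \<Longrightarrow> ridge_integral p d < \<infinity>"
proof -
  assume d: "0 < d"
  have "ridge_integral p d \<le> (\<integral>\<^sup>+v\<in>{0..1 :: real}. ennreal ((1 / sqrt d) ^ p) \<partial>lborel)"
    unfolding ridge_integral_def using ridge_le[OF d]
    by (intro nn_integral_mono) (auto simp: indicator_def intro!: ennreal_leI)
  also have "\<dots> = ennreal ((1 / sqrt d) ^ p)" by (simp add: nn_integral_cmult)
  also have "\<dots> < \<infinity>" by simp
  finally show ?thesis .
qed

text \<open>At exponent 1 the antiderivative \<open>2 * sqrt (d + v)\<close> gives a bound that does
  not depend on \<open>d\<close>.\<close>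

lemma ridge_integral_1_le: "0 < d \<Longrightarrow> ridge_integral 1 d \<le> ennreal 2"
proof -
  assume d: "0 < d"
  have "ridge_integral 1 d = ennreal (2 * sqrt (d + 1) - 2 * sqrt (d + 0))"
    unfolding ridge_integral_def ridge_def power_one_right
  proof (rule nn_integral_FTC_Icc[where F = "\<lambda>v. 2 * sqrt (d + v)"])
    fix v :: real assume "v \<in> {0..1}"
    then have "0 < d + v" using d by simp
    then show "((\<lambda>v. 2 * sqrt (d + v)) has_real_derivative 1 / sqrt (d + v)) (at v)"
      by (auto intro!: derivative_eq_intros simp: field_simps)
    show "0 \<le> 1 / sqrt (d + v)" using \<open>0 < d + v\<close> by simp
  qed auto
  also have "\<dots> \<le> ennreal 2" using sqrt_add_le_add_sqrt[of d 1] d by (intro ennreal_leI) simp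
  finally show ?thesis .
qed

text \<open>On \<open>{0..1 - d}\<close> the base \<open>1 / sqrt (d + v)\<close> is at least 1, so
  its \<open>p\<close>-th power dominates the square \<open>1 / (d + v)\<close>, whose integral
  there is \<open>ln (1 / d)\<close>.\<close>

lemma ridge_integral_ge_ln:
  assumes d: "0 < d" "d \<le> 1" and p: "2 \<le> p"
  shows "ennreal (ln (1 / d)) \<le> ridge_integral p d"
proof -
  have "(\<integral>\<^sup>+v\<in>{0..1 - d}. ennreal (1 / (d + v)) \<partial>lborel) = ennreal (ln (d + (1 - d)) - ln (d + 0))"
  proof (rule nn_integral_FTC_Icc[where F = "\<lambda>v. ln (d + v)"])
    fix v :: real assume "v \<in> {0..1 - d}"
    then have "0 < d + v" using d by simp
    then show "((\<lambda>v. ln (d + v)) has_real_derivative 1 / (d + v)) (at v)"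
      by (auto intro!: derivative_eq_intros)
    show "0 \<le> 1 / (d + v)" using \<open>0 < d + v\<close> by simp
  qed (use d in auto)
  then have "ennreal (ln (1 / d)) = (\<integral>\<^sup>+v\<in>{0..1 - d}. ennreal (1 / (d + v)) \<partial>lborel)"
    using d by (simp add: ln_div)
  also have "\<dots> \<le> ridge_integral p d" unfolding ridge_integral_def
  proof (rule nn_integral_mono)
    fix v :: real
    show "ennreal (1 / (d + v)) * indicator {0..1 - d} v \<le> ennreal (ridge p d v) * indicator {0..1} v"
    proof (cases "v \<in> {0..1 - d}")
      case True
      then have v: "0 < d + v" "d + v \<le> 1" using d by auto
      then have "1 \<le> 1 / sqrt (d + v)" by simp
      then have "(1 / sqrt (d + v)) ^ 2 \<le> (1 / sqrt (d + v)) ^ p"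
        using p by (intro power_increasing) auto
      then have "1 / (d + v) \<le> ridge p d v" using v by (simp add: ridge_def power_divide)
      then show ?thesis using True d by (auto simp: indicator_def intro!: ennreal_leI)
    qed simp
  qed
  finally show ?thesis .
qed

text \<open>The threshold \<open>c\<close> separates two cases: for \<open>f \<le> c\<close> all
  factors but one are replaced by \<open>c\<close>, otherwise \<open>N - p\<close> factors
  \<open>c\<close> are replaced by \<open>f\<close>.\<close>

lemma power_interpolation:
  fixes f c :: real
  assumes f: "0 \<le> f" and c: "0 < c" and p: "1 \<le> p" "p < N"
  shows "f ^ p \<le> c ^ (p - 1) * f + 1 / c ^ (N - p) * f ^ N"
proof (cases "f \<le> c")
  case True
  have "f ^ p = f ^ (p - 1) * f" using p by (cases p) auto
  also have "\<dots> \<le> c ^ (p - 1) * f" using True f by (intro mult_right_mono power_mono) auto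
  finally show ?thesis using f c by (simp add: add_increasing2)
next
  case False
  have "f ^ p * c ^ (N - p) \<le> f ^ p * f ^ (N - p)"
    using False f c by (intro mult_left_mono power_mono) auto
  also have "\<dots> = f ^ N" using p by (simp flip: power_add)
  finally have "f ^ p \<le> 1 / c ^ (N - p) * f ^ N" using c by (simp add: field_simps)
  then show ?thesis using f c by (simp add: add_increasing)
qed

lemma ennreal_lincomb:
  "0 \<le> a \<Longrightarrow> 0 \<le> x \<Longrightarrow> 0 \<le> b \<Longrightarrow> 0 \<le> y \<Longrightarrow>
    ennreal (a * x + b * y) = ennreal a * ennreal x + ennreal b * ennreal y"
  by (simp add: ennreal_plus ennreal_mult)

lemma ridge_integral_interpolation:
  assumes d: "0 < d" and c: "0 < c" and p: "1 \<le> p" "p < N"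
  shows "ridge_integral p d \<le> ennreal (c ^ (p - 1) * 2) + ennreal (1 / c ^ (N - p)) * ridge_integral N d"
proof -
  have "ridge_integral p d \<le> (\<integral>\<^sup>+v. ennreal (c ^ (p - 1)) * (ennreal (ridge 1 d v) * indicator {0..1} v)
      + ennreal (1 / c ^ (N - p)) * (ennreal (ridge N d v) * indicator {0..1} v) \<partial>lborel)"
    unfolding ridge_integral_def
  proof (rule nn_integral_mono)
    fix v :: real
    show "ennreal (ridge p d v) * indicator {0..1} v \<le> ennreal (c ^ (p - 1)) * (ennreal (ridge 1 d v) * indicator {0..1} v)
        + ennreal (1 / c ^ (N - p)) * (ennreal (ridge N d v) * indicator {0..1} v)"
    proof (cases "v \<in> {0..1}")
      case True
      then have f: "0 \<le> 1 / sqrt (d + v)" using d by simp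
      have "ennreal (ridge p d v) \<le> ennreal (c ^ (p - 1) * ridge 1 d v + 1 / c ^ (N - p) * ridge N d v)"
        unfolding ridge_def using power_interpolation[OF f c p] by (intro ennreal_leI) simp
      also have "\<dots> = ennreal (c ^ (p - 1)) * ennreal (ridge 1 d v) + ennreal (1 / c ^ (N - p)) * ennreal (ridge N d v)"
        using c d True by (intro ennreal_lincomb) (auto intro!: ridge_nonneg)
      finally show ?thesis using True by simp
    qed simp
  qed
  also have "\<dots> = ennreal (c ^ (p - 1)) * ridge_integral 1 d + ennreal (1 / c ^ (N - p)) * ridge_integral N d"
    unfolding ridge_integral_def by (subst nn_integral_add) (auto simp: nn_integral_cmult)
  also have "ennreal (c ^ (p - 1)) * ridge_integral 1 d \<le> ennreal (c ^ (p - 1)) * ennreal 2"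
    using ridge_integral_1_le[OF d] by (rule mult_left_mono) simp
  also have "ennreal (c ^ (p - 1)) * ennreal 2 = ennreal (c ^ (p - 1) * 2)"
    using c by (intro ennreal_mult[symmetric]) auto
  finally show ?thesis by (simp add: add_right_mono)
qed

text \<open>
  With \<open>f = 1 / sqrt (d + v)\<close> the mean of \<open>f\<close> stays bounded and that of \<open>f ^ N\<close> is unbounded as
  \<open>d\<close> tends to \<open>0\<close>; by interpolation \<open>f ^ p\<close> grows too slowly for a ball to compensate.
\<close>

lemma exists_ridge_parameters:
  fixes C :: real
  assumes C: "0 < C" and p: "1 \<le> p" "p < N"
  obtains d X where "0 < d" "d \<le> 1" "1 \<le> X"
    "C * (1 + enn2real (ridge_integral p d)) \<le> X ^ p" "C * X ^ N < enn2real (ridge_integral N d)"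
proof -
  define C' where "C' = max 1 (4 * C)"
  have C': "1 \<le> C'" "4 * C \<le> C'" by (auto simp: C'_def)
  \<comment> \<open>\<open>Z\<close> exceeds the constant that is lost when \<open>N\<close>-th
    powers are compared at the end.\<close>
  define Z where "Z = C * C' ^ N + 1"
  have Z: "1 < Z" "C * C' ^ N < Z" using C C' by (auto simp: Z_def)
  \<comment> \<open>With \<open>JN = Y ^ q\<close> the threshold \<open>c = Y ^ p\<close> satisfies
    \<open>c ^ (N - 1) = JN\<close>, which balances the two terms of the interpolation. Then
    \<open>Jp\<close> has order at most \<open>c ^ (p - 1)\<close>, whose \<open>p\<close>-th root
    \<open>Y ^ (p - 1)\<close> gives \<open>X\<close> up to a constant.\<close>
  define q where "q = p * (N - 1)"
  have q: "0 < q" using p by (simp add: q_def)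
  \<comment> \<open>Chosen so that \<open>ln (1 / d) = Z ^ q\<close>, a lower bound for
    \<open>JN\<close>.\<close>
  define d where "d = exp (- (Z ^ q))"
  have d: "0 < d" "d \<le> 1" using Z by (auto simp: d_def)
  define JN where "JN = enn2real (ridge_integral N d)"
  define Jp where "Jp = enn2real (ridge_integral p d)"
  have fin: "ridge_integral N d = ennreal JN" "ridge_integral p d = ennreal Jp" "0 \<le> JN" "0 \<le> Jp"
    using ridge_integral_finite[OF d(1)] by (auto simp: JN_def Jp_def)
  have "ennreal (Z ^ q) \<le> ennreal JN"
    using ridge_integral_ge_ln[OF d, of N] p unfolding fin(1) by (simp add: d_def ln_div)
  then have ZJ: "Z ^ q \<le> JN" using fin by simp
  define Y where "Y = root q JN"
  have Yq: "Y ^ q = JN" unfolding Y_def using q fin by simp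
  have "Z = root q (Z ^ q)" using q Z by (simp add: real_root_power_cancel)
  also have "\<dots> \<le> Y" unfolding Y_def using q ZJ by simp
  finally have ZY: "Z \<le> Y" .
  then have Y: "1 \<le> Y" using Z by simp
  define c where "c = Y ^ p"
  have c: "1 \<le> c" using Y by (simp add: c_def)
  have cN: "c ^ (N - 1) = JN" using Yq by (simp add: c_def q_def power_mult)
  define X where "X = C' * Y ^ (p - 1)"
  have "ennreal Jp \<le> ennreal (c ^ (p - 1) * 2) + ennreal (1 / c ^ (N - p)) * ennreal JN"
    using ridge_integral_interpolation[OF d(1) _ p, of c] c unfolding fin by simp
  also have "\<dots> = ennreal (c ^ (p - 1) * 2 + 1 / c ^ (N - p) * JN)"
    using ennreal_lincomb[of 1 "c ^ (p - 1) * 2" "1 / c ^ (N - p)" JN] c fin(3)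
    by (simp only: mult_1 ennreal_1) simp
  finally have le: "ennreal Jp \<le> ennreal (c ^ (p - 1) * 2 + 1 / c ^ (N - p) * JN)" .
  have "0 \<le> c ^ (p - 1) * 2 + 1 / c ^ (N - p) * JN"
    using c fin(3) by (intro add_nonneg_nonneg mult_nonneg_nonneg) auto
  with le have "Jp \<le> c ^ (p - 1) * 2 + 1 / c ^ (N - p) * JN" by (simp only: ennreal_le_iff)
  also have "1 / c ^ (N - p) * JN = c ^ (p - 1)" proof -
    have "c ^ (N - 1) = c ^ (p - 1) * c ^ (N - p)" using p by (simp flip: power_add)
    then show ?thesis using c by (simp flip: cN)
  qed
  finally have "1 + Jp \<le> 4 * c ^ (p - 1)" using one_le_power[OF c, of "p - 1"] by simp
  then have "C * (1 + Jp) \<le> C * (4 * c ^ (p - 1))" using C by (intro mult_left_mono) auto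
  also have "\<dots> = 4 * C * (Y ^ (p - 1)) ^ p" by (simp add: c_def mult.commute flip: power_mult)
  also have "\<dots> \<le> C' ^ p * (Y ^ (p - 1)) ^ p"
  proof (rule mult_right_mono)
    have "C' ^ 1 \<le> C' ^ p" using C' p by (intro power_increasing) auto
    then show "4 * C \<le> C' ^ p" using C' by simp
  qed (use Y in simp)
  also have "\<dots> = X ^ p" by (simp add: X_def power_mult_distrib)
  finally have 1: "C * (1 + Jp) \<le> X ^ p" .
  have "C * X ^ N = (C * C' ^ N) * Y ^ ((p - 1) * N)" by (simp add: X_def power_mult_distrib power_mult)
  also have "\<dots> < Y * Y ^ ((p - 1) * N)" using Z ZY Y by (intro mult_strict_right_mono) auto
  also have "\<dots> = Y ^ (Suc ((p - 1) * N))" by simp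
  \<comment> \<open>The inequality of exponents \<open>(p - 1) * N + 1 \<le> p * (N - 1)\<close> is
    equivalent to \<open>p < N\<close>; it leaves the one spare factor \<open>Y\<close> that has
    absorbed the constants.\<close>
  also have "\<dots> \<le> Y ^ q"
  proof (rule power_increasing)
    obtain p' l where "p = Suc p'" "N = Suc p + l"
      using p by (metis Suc_le_D One_nat_def less_iff_Suc_add add_Suc)
    then show "Suc ((p - 1) * N) \<le> q" by (simp add: q_def algebra_simps)
  qed (rule Y)
  finally have 2: "C * X ^ N < JN" by (simp add: Yq)
  have "1 \<le> X" unfolding X_def using C' Y mult_mono[of 1 C' 1 "Y ^ (p - 1)"] by simp
  with that[of d X] d 1 2 show ?thesis
    by (simp add: Jp_def JN_def)
qed

section \<open>Ridged bodies\<close>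

lemma cos_ge_half: "0 \<le> x \<Longrightarrow> x \<le> 1 \<Longrightarrow> 1 / 2 \<le> cos (x :: real)"
  using cos_monotone_0_pi_le[of x "pi / 3"] pi_gt3 by (simp add: cos_60)

lemma sin_ge_half: "0 \<le> x \<Longrightarrow> x \<le> 1 \<Longrightarrow> x / 2 \<le> sin (x :: real)"
proof (cases "x = 0")
  case False
  assume x: "0 \<le> x" "x \<le> 1"
  with False obtain z where "0 < z" "z < x" "sin x - sin 0 = (x - 0) * cos z"
    using MVT2[of 0 x sin cos] by (auto intro: DERIV_sin)
  then show ?thesis using mult_left_mono[OF cos_ge_half[of z], of x] x by simp
qed simp

text \<open>The product formula turns the difference into two sines, each between half its argument
  and its argument. So \<open>cos D - cos \<beta>\<close> is comparable with
  \<open>\<beta> ^ 2 - D ^ 2\<close>.\<close>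

lemma cos_diff_bounds:
  fixes D \<beta> :: real
  assumes "0 \<le> D" "D \<le> \<beta>" "\<beta> \<le> 1"
  shows "(\<beta>\<^sup>2 - D\<^sup>2) / 8 \<le> cos D - cos \<beta>" "cos D - cos \<beta> \<le> (\<beta>\<^sup>2 - D\<^sup>2) / 2"
proof -
  have e: "cos D - cos \<beta> = 2 * (sin ((D + \<beta>) / 2) * sin ((\<beta> - D) / 2))"
    using cos_diff_cos[of D \<beta>] by simp
  have s: "(D + \<beta>) / 4 \<le> sin ((D + \<beta>) / 2)" "(\<beta> - D) / 4 \<le> sin ((\<beta> - D) / 2)"
    using sin_ge_half[of "(D + \<beta>) / 2"] sin_ge_half[of "(\<beta> - D) / 2"] assms by auto
  have t: "sin ((D + \<beta>) / 2) \<le> (D + \<beta>) / 2" "sin ((\<beta> - D) / 2) \<le> (\<beta> - D) / 2"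
    using sin_x_le_x[of "(D + \<beta>) / 2"] sin_x_le_x[of "(\<beta> - D) / 2"] assms by auto
  have "(D + \<beta>) / 4 * ((\<beta> - D) / 4) \<le> sin ((D + \<beta>) / 2) * sin ((\<beta> - D) / 2)"
    using s assms by (intro mult_mono) auto
  then show "(\<beta>\<^sup>2 - D\<^sup>2) / 8 \<le> cos D - cos \<beta>"
    unfolding e by (simp add: power2_eq_square algebra_simps)
  have "sin ((D + \<beta>) / 2) * sin ((\<beta> - D) / 2) \<le> (D + \<beta>) / 2 * ((\<beta> - D) / 2)"
    using s t assms by (intro mult_mono) auto
  then show "cos D - cos \<beta> \<le> (\<beta>\<^sup>2 - D\<^sup>2) / 2"
    unfolding e by (simp add: power2_eq_square algebra_simps)
qed

text \<open>The level for which the ridges reach exactly Klein radius \<open>1 - d * \<beta>\<^sup>2\<close>.\<close>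

definition support_level :: "real \<Rightarrow> real \<Rightarrow> real" where
  "support_level \<beta> d = (1 - d * \<beta>\<^sup>2) * cos \<beta>"

text \<open>Angles of the outer normals to the axis in the Klein model. Supporting planes at
  multiples of \<open>2 * \<beta>\<close> meet in ridges at the odd multiples of \<beta>. From
  \<open>pi / 4\<close> on every angle is a normal angle, so there the Klein radius is at most the
  support level and no ridges occur.\<close>

definition normal_angles :: "real \<Rightarrow> real set" where
  "normal_angles \<beta> = {\<alpha>. 0 \<le> \<alpha> \<and> \<alpha> \<le> pi / 2 \<and> (pi / 4 \<le> \<alpha> \<or> (\<exists>j::nat. \<alpha> = 2 * \<beta> * j))}"

text \<open>With \<open>q\<close> the support level, the constraint at angular distance
  \<open>D\<close> from a normal rearranges to
  \<open>(cos D - q) * (1 + t ^ 2) \<le> cos D * (1 - t) ^ 2\<close>. The left side is at least of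
  order \<open>\<beta> ^ 2 * (d + (1 - D / \<beta>))\<close>, and the square on the right produces
  the square root in the depth. Here \<open>1 - D / \<beta>\<close> is the distance to the ridge in
  units of \<beta>.\<close>

lemma depth_lower_bound:
  fixes D \<beta> d t :: real
  assumes D: "0 \<le> D" "D \<le> \<beta>" and \<beta>: "0 < \<beta>" "\<beta> \<le> 1" and d: "0 < d" and t: "0 \<le> t" "t \<le> 1"
    and le: "t * cos D \<le> support_level \<beta> d * (1 + t\<^sup>2) / 2"
  shows "\<beta> / 3 * sqrt (d + (1 - D / \<beta>)) \<le> 1 - t"
proof -
  define q where "q = support_level \<beta> d"
  have c: "1 / 2 \<le> cos \<beta>" "1 / 2 \<le> cos D" "cos D \<le> 1"
    using cos_ge_half[of \<beta>] cos_ge_half[of D] D \<beta> by auto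
  have "\<beta> * D \<ge> D\<^sup>2" using D by (simp add: power2_eq_square mult_right_mono)
  moreover define X where "X = \<beta>\<^sup>2 * (1 - D / \<beta>)"
  have "X = \<beta>\<^sup>2 - \<beta> * D"
    unfolding X_def using \<beta> by (simp add: field_simps power2_eq_square)
  ultimately have "X \<le> \<beta>\<^sup>2 - D\<^sup>2" by simp
  moreover have "d * \<beta>\<^sup>2 * (1 / 2) \<le> d * \<beta>\<^sup>2 * cos \<beta>"
    using c d by (intro mult_left_mono) auto
  moreover have p: "0 \<le> d * \<beta>\<^sup>2" "0 \<le> X" unfolding X_def using d D \<beta> by auto
  have e: "\<beta>\<^sup>2 * (d + (1 - D / \<beta>)) = d * \<beta>\<^sup>2 + X"
    by (simp add: X_def algebra_simps)
  moreover have "cos D - q = (cos D - cos \<beta>) + d * \<beta>\<^sup>2 * cos \<beta>"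
    by (simp add: q_def support_level_def algebra_simps)
  \<comment> \<open>The factor 1/9 lies below both 1/8, from the difference of cosines, and 1/2,
    from \<open>cos \<beta>\<close>; its root is the 1/3 of the claim.\<close>
  ultimately have low: "\<beta>\<^sup>2 * (d + (1 - D / \<beta>)) / 9 \<le> cos D - q"
    unfolding e using p cos_diff_bounds(1)[OF D \<beta>(2)] by argo
  have nn: "0 \<le> d + (1 - D / \<beta>)" using d D \<beta> by simp
  then have "0 \<le> \<beta>\<^sup>2 * (d + (1 - D / \<beta>)) / 9" by simp
  then have qD: "q \<le> cos D" using low by linarith
  have "2 * t * cos D \<le> q * (1 + t\<^sup>2)" using le by (simp add: q_def)
  then have le': "(cos D - q) * (1 + t\<^sup>2) \<le> cos D * (1 - t)\<^sup>2"
    by (simp add: power2_eq_square algebra_simps)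
  note low
  also have "cos D - q \<le> (cos D - q) * (1 + t\<^sup>2)"
    using qD by (simp add: mult_left_le mult_le_cancel_left1)
  also note le'
  also have "cos D * (1 - t)\<^sup>2 \<le> (1 - t)\<^sup>2" using c by (simp add: mult_left_le_one_le)
  finally have "\<beta>\<^sup>2 * (d + (1 - D / \<beta>)) / 9 \<le> (1 - t)\<^sup>2" .
  then have "sqrt (\<beta>\<^sup>2 * (d + (1 - D / \<beta>)) / 9) \<le> sqrt ((1 - t)\<^sup>2)"
    by (rule real_sqrt_le_mono)
  then show ?thesis using \<beta> t by (simp add: real_sqrt_divide real_sqrt_mult)
qed

text \<open>A converse of \<open>depth_lower_bound\<close> up to constants, by the same
  rearrangement: \<open>g\<close> overestimates the gap \<open>cos D - q\<close>, and the factor 3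
  makes the squared depth at least \<open>9 / 2 * g\<close>, more than the required
  \<open>2 * g\<close>.\<close>

lemma depth_sufficient:
  fixes D \<beta> d t :: real
  assumes D: "0 \<le> D" "D \<le> \<beta>" and \<beta>: "0 < \<beta>" "\<beta> \<le> 1" and d: "0 < d" and t: "0 \<le> t"
    and le: "t \<le> 1 - 3 * \<beta> * sqrt (d + (1 - D / \<beta>))"
  shows "t * cos D \<le> support_level \<beta> d * (1 + t\<^sup>2) / 2"
proof -
  define q where "q = support_level \<beta> d"
  define g where "g = 2 * \<beta>\<^sup>2 * (d + (1 - D / \<beta>))"
  have c: "1 / 2 \<le> cos \<beta>" "1 / 2 \<le> cos D" "cos D \<le> 1" "cos \<beta> \<le> 1"
    using cos_ge_half[of \<beta>] cos_ge_half[of D] D \<beta> by auto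
  have nn: "0 \<le> d + (1 - D / \<beta>)" using d D \<beta> by simp
  then have g0: "0 \<le> g" by (simp add: g_def)
  have "0 \<le> (\<beta> - D)\<^sup>2" by simp
  moreover define X where "X = \<beta>\<^sup>2 * (1 - D / \<beta>)"
  have "X = \<beta>\<^sup>2 - \<beta> * D"
    unfolding X_def using \<beta> by (simp add: field_simps power2_eq_square)
  ultimately have "\<beta>\<^sup>2 - D\<^sup>2 \<le> 2 * X" by (simp add: power2_diff)
  moreover have "d * \<beta>\<^sup>2 * cos \<beta> \<le> d * \<beta>\<^sup>2 * 1"
    using c d by (intro mult_left_mono) auto
  moreover have "g = 2 * (d * \<beta>\<^sup>2) + 2 * X" by (simp add: X_def g_def algebra_simps)
  moreover have "cos D - q = (cos D - cos \<beta>) + d * \<beta>\<^sup>2 * cos \<beta>"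
    by (simp add: q_def support_level_def algebra_simps)
  ultimately have "cos D - q \<le> g / 2" using cos_diff_bounds(2)[OF D \<beta>(2)] by argo
  also have "\<dots> \<le> g * cos D" using mult_left_mono[OF c(2) g0] by simp
  finally have q: "cos D - q \<le> g * cos D" .
  have "3 * \<beta> * sqrt (d + (1 - D / \<beta>)) \<le> 1 - t" using le by simp
  then have "(3 * \<beta> * sqrt (d + (1 - D / \<beta>)))\<^sup>2 \<le> (1 - t)\<^sup>2"
    using \<beta> nn by (intro power_mono) auto
  moreover have "(3 * \<beta> * sqrt (d + (1 - D / \<beta>)))\<^sup>2 = 9 / 2 * g"
    unfolding g_def power_mult_distrib real_sqrt_pow2[OF nn] by simp
  ultimately have "9 / 2 * g \<le> (1 - t)\<^sup>2" by simp
  moreover have "0 \<le> 3 * \<beta> * sqrt (d + (1 - D / \<beta>))" using \<beta> nn by simp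
  then have "t \<le> 1" using le by linarith
  then have "g * (1 + t\<^sup>2) \<le> g * 2" using g0 t power_le_one[of t 2] by (intro mult_left_mono) auto
  ultimately have "g * (1 + t\<^sup>2) \<le> (1 - t)\<^sup>2" using g0 by linarith
  then have "cos D * (g * (1 + t\<^sup>2)) \<le> cos D * (1 - t)\<^sup>2"
    using c by (intro mult_left_mono) auto
  moreover have "(cos D - q) * (1 + t\<^sup>2) \<le> (g * cos D) * (1 + t\<^sup>2)"
    using q by (intro mult_right_mono) auto
  ultimately have "(cos D - q) * (1 + t\<^sup>2) \<le> cos D * (1 - t)\<^sup>2"
    by (simp add: mult.commute mult.left_commute)
  then show ?thesis unfolding q_def by (simp add: power2_eq_square algebra_simps)
qed

text \<open>Normals sit at the even multiples of \<beta>, while \<open>tri\<close> measures the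
  distance to the odd ones. The bound on \<beta> keeps the next multiple beyond \<phi> below
  \<open>pi / 2\<close>.\<close>

lemma normal_angles_near:
  assumes \<beta>: "0 < \<beta>" "\<beta> \<le> 1 / 4" and \<phi>: "0 \<le> \<phi>" "\<phi> \<le> pi / 4"
  obtains \<alpha> where "\<alpha> \<in> normal_angles \<beta>" "\<bar>\<phi> - \<alpha>\<bar> = \<beta> * (1 - tri (\<phi> / \<beta>))"
proof -
  have "0 \<le> \<phi> / \<beta> / 2" using \<beta> \<phi> by simp
  then obtain i :: nat where i: "\<lfloor>\<phi> / \<beta> / 2\<rfloor> = int i"
    by (metis nonneg_int_cases zero_le_floor)
  then have "real i \<le> \<phi> / \<beta> / 2" "\<phi> / \<beta> / 2 < real i + 1" by linarith+
  then have i2: "2 * \<beta> * real i \<le> \<phi>" "\<phi> < 2 * \<beta> * real (i + 1)"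
    using \<beta> by (auto simp: field_simps)
  have tri: "tri (\<phi> / \<beta>) = \<bar>\<phi> / \<beta> - (2 * real i + 1)\<bar>"
    unfolding tri_def i by simp
  have mem: "2 * \<beta> * real l \<in> normal_angles \<beta>" if "2 * \<beta> * real l \<le> pi / 2" for l
    using that \<beta> unfolding normal_angles_def by auto
  have "2 * \<beta> * real (i + 1) \<le> pi / 4 + 2 * \<beta>" using i2 \<phi> by (simp add: algebra_simps)
  also have "\<dots> \<le> pi / 2" using \<beta> pi_gt3 by simp
  finally have b: "2 * \<beta> * real (i + 1) \<in> normal_angles \<beta>" by (rule mem)
  have "2 * \<beta> * real i \<le> pi / 2" using i2 \<phi> by simp
  then have a: "2 * \<beta> * real i \<in> normal_angles \<beta>" by (rule mem)
  show ?thesis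
  proof (cases "\<phi> / \<beta> \<le> 2 * real i + 1")
    case True
    have "\<bar>\<phi> - 2 * \<beta> * real i\<bar> = \<beta> * (1 - tri (\<phi> / \<beta>))"
      using True \<beta> i2 unfolding tri by (simp add: field_simps)
    with a that show ?thesis by blast
  next
    case False
    have "\<bar>\<phi> - 2 * \<beta> * real (i + 1)\<bar> = \<beta> * (1 - tri (\<phi> / \<beta>))"
      using False \<beta> i2 unfolding tri by (simp add: field_simps)
    with b that show ?thesis by blast
  qed
qed

text \<open>The margin \<beta> below \<open>pi / 4\<close> keeps the continuum of normal angles at
  distance at least \<beta>; all other normal angles are multiples of
  \<open>2 * \<beta>\<close>.\<close>

lemma normal_angles_far:
  assumes \<beta>: "0 < \<beta>" and \<phi>: "\<phi> \<le> pi / 4 - \<beta>" and \<alpha>: "\<alpha> \<in> normal_angles \<beta>"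
  shows "\<beta> * (1 - tri (\<phi> / \<beta>)) \<le> \<bar>\<phi> - \<alpha>\<bar>"
proof (cases "pi / 4 \<le> \<alpha>")
  case True
  have "\<beta> * (1 - tri (\<phi> / \<beta>)) \<le> \<beta> * 1"
    using tri_bounds \<beta> by (intro mult_left_mono) auto
  then show ?thesis using True \<phi> by simp
next
  case False
  then obtain i :: nat where i: "\<alpha> = 2 * \<beta> * i"
    using \<alpha> unfolding normal_angles_def by auto
  define u where "u = \<phi> / \<beta>"
  define j where "j = \<lfloor>u / 2\<rfloor>"
  have j: "2 * of_int j \<le> u" "u < 2 * of_int j + 2" unfolding j_def by linarith+
  have "of_int (int i) \<le> (of_int j :: real) \<or> of_int (j + 1) \<le> (of_int (int i) :: real)"
    unfolding of_int_le_iff by linarith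
  then have "1 - tri u \<le> \<bar>u - 2 * real i\<bar>" using j unfolding tri_def j_def[symmetric] by auto
  then have "\<beta> * (1 - tri u) \<le> \<beta> * \<bar>u - 2 * real i\<bar>"
    using \<beta> by (intro mult_left_mono) auto
  also have "\<dots> = \<bar>\<beta> * (u - 2 * real i)\<bar>" using \<beta> by (simp add: abs_mult)
  also have "\<beta> * (u - 2 * real i) = \<phi> - \<alpha>"
    using \<beta> by (simp add: u_def i algebra_simps)
  finally show ?thesis by (simp add: u_def)
qed

lemma inverse_sqrt_le: "0 \<le> y \<Longrightarrow> y \<le> 1 \<Longrightarrow> 1 / sqrt (1 + y) \<le> 1 - y / (4 :: real)"
proof -
  assume y: "0 \<le> y" "y \<le> 1"
  have "0 \<le> y * (8 - 7 * y + y\<^sup>2) / 16"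
    using y by (intro divide_nonneg_nonneg mult_nonneg_nonneg) (auto simp: add_nonneg_nonneg)
  then have "1 \<le> (1 - y / 4)\<^sup>2 * (1 + y)" by (simp add: power2_eq_square field_simps)
  then have "sqrt 1 \<le> sqrt ((1 - y / 4)\<^sup>2 * (1 + y))" by (rule real_sqrt_le_mono)
  then have "1 \<le> (1 - y / 4) * sqrt (1 + y)" using y by (simp add: real_sqrt_mult)
  then show ?thesis using y by (simp add: pos_divide_le_eq)
qed

section \<open>The angle to the axis along a central section\<close>

lemma cos_diff_le: "x \<le> y \<Longrightarrow> cos x - cos y \<le> y - (x :: real)"
proof (cases "x = y")
  case False
  assume "x \<le> y"
  with False have "x < y" by simp
  from MVT2[OF this, of cos "\<lambda>x. - sin x"] obtain z where "cos y - cos x = (y - x) * (- sin z)"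
    by (auto intro: DERIV_cos)
  moreover have "(y - x) * sin z \<le> (y - x) * 1"
    using \<open>x < y\<close> by (intro mult_left_mono) auto
  ultimately show ?thesis by simp
qed simp

text \<open>
  The angle to the axis at slope \<open>t\<close>, measured in a subspace, becomes \<open>cone_angle a t\<close> in the
  ambient space when \<open>a\<close> is the norm of the projection of the axis to the subspace.
\<close>

abbreviation cone_angle :: "real \<Rightarrow> real \<Rightarrow> real" where
  "cone_angle a t \<equiv> arccos (a / sqrt (1 + t\<^sup>2))"

text \<open>The derivative of the angle is a constant times the product of
  \<open>t / sqrt (1 + t ^ 2 - a ^ 2)\<close>, which does not decrease, and
  \<open>1 / (1 + t ^ 2)\<close>, which varies by a factor of at most 2 on \<open>{0..1}\<close>;
  this is the convexity up to a factor 2 that equidistribution needs. The first term of the bound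
  pays for the initial stretch, and the bound is uniform in \<open>a\<close>.\<close>

lemma nn_integral_ridge_angle_le:
  fixes a \<beta> d :: real
  assumes a: "7 / 10 \<le> a" "a \<le> 1" and \<beta>: "0 < \<beta>" "\<beta> \<le> 1 / 12" and d: "0 < d"
  shows "(\<integral>\<^sup>+t\<in>{0..1}. ennreal (ridge p d (tri (cone_angle a t / \<beta>))) \<partial>lborel)
    \<le> ennreal (sqrt (12 * \<beta>) * (1 / sqrt d) ^ p) + 4 * ridge_integral p d"
proof -
  define v where "v t = a / sqrt (1 + t\<^sup>2)" for t :: real
  define w where "w t = a * t / ((1 + t\<^sup>2) * sqrt (1 + t\<^sup>2 - a\<^sup>2)) / \<beta>" for t :: real
  have pos: "1 + t\<^sup>2 > 0" for t :: real by (simp add: add_pos_nonneg)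
  have v: "0 < v t" "v t \<le> 1" for t proof -
    show "0 < v t" unfolding v_def using a pos[of t] by simp
    have "a \<le> sqrt (1 + t\<^sup>2)" using a by (simp add: order_trans[of a 1])
    then show "v t \<le> 1" unfolding v_def using pos[of t] by simp
  qed
  have a2: "a\<^sup>2 \<le> 1" using a by (simp add: power_le_one)
  have cv: "continuous_on S v" for S
    unfolding v_def using pos by (intro continuous_intros) (auto simp: less_imp_neq[symmetric])
  have c\<Phi>: "continuous_on S (\<lambda>t. arccos (v t) / \<beta>)" for S proof -
    have "- 1 \<le> v t" for t using v(1)[of t] by simp
    then have "continuous_on S (\<lambda>t. arccos (v t))"
      using v(2) by (intro continuous_on_arccos cv) auto
    then show ?thesis using \<beta> by (intro continuous_on_divide continuous_on_const) auto
  qed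
  have [measurable]: "(\<lambda>t. arccos (v t) / \<beta>) \<in> borel_measurable borel"
    by (rule borel_measurable_continuous_onI[OF c\<Phi>])
  have [measurable]: "w \<in> borel_measurable borel" unfolding w_def by measurable
  have "(\<integral>\<^sup>+t\<in>{0..1}. ennreal (ridge p d (tri (arccos (v t) / \<beta>))) \<partial>lborel)
      \<le> ennreal (sqrt (12 * \<beta>) * (1 / sqrt d) ^ p) + 4 * ridge_integral p d"
  proof (rule nn_integral_compose_le_window[where p = "\<lambda>u. ridge p d (tri u)" and \<Phi> = "\<lambda>t. arccos (v t) / \<beta>"
        and \<Phi>' = w and \<eta> = "sqrt (12 * \<beta>)"])
    show "(\<lambda>u. ridge p d (tri u)) \<in> borel_measurable borel" by measurable
    show "0 \<le> ridge p d (tri u)" "ridge p d (tri u) \<le> (1 / sqrt d) ^ p" for u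
      using tri_bounds[of u] d by (auto intro!: ridge_nonneg ridge_le)
    show "(\<integral>\<^sup>+u\<in>{x..x + 2}. ennreal (ridge p d (tri u)) \<partial>lborel) \<le> 4 * ridge_integral p d" for x
      by (rule nn_integral_ridge_window_le)
    show \<eta>: "0 < sqrt (12 * \<beta>)" "sqrt (12 * \<beta>) \<le> 1" using \<beta> by auto
    have pos': "1 + t\<^sup>2 - a\<^sup>2 > 0" if "t > 0" for t :: real
      using a2 zero_less_power[OF that, of 2] by linarith
    show "((\<lambda>t. arccos (v t) / \<beta>) has_real_derivative w t) (at t)" if t: "0 < t" "t \<le> 1" for t
    proof -
      have s: "0 < sqrt (1 + t\<^sup>2)" "(sqrt (1 + t\<^sup>2))\<^sup>2 = 1 + t\<^sup>2"
        using pos[of t] by auto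
      have dv: "(v has_real_derivative - (a * t) / ((1 + t\<^sup>2) * sqrt (1 + t\<^sup>2))) (at t)"
        unfolding v_def using s pos[of t]
        by (auto intro!: derivative_eq_intros simp: power2_eq_square field_simps)
      have "1 - (v t)\<^sup>2 = (1 + t\<^sup>2 - a\<^sup>2) / (1 + t\<^sup>2)"
        unfolding v_def using s pos[of t] by (simp add: power_divide field_simps)
      then have r: "sqrt (1 - (v t)\<^sup>2) = sqrt (1 + t\<^sup>2 - a\<^sup>2) / sqrt (1 + t\<^sup>2)"
        by (simp add: real_sqrt_divide)
      have r0: "0 < sqrt (1 + t\<^sup>2 - a\<^sup>2)" using pos'[OF t(1)] by simp
      then have "sqrt (1 - (v t)\<^sup>2) > 0" unfolding r using s by simp
      then have v1: "v t < 1" using v[of t] by (cases "v t = 1") auto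
      have "((\<lambda>t. arccos (v t)) has_real_derivative
          inverse (- sqrt (1 - (v t)\<^sup>2)) * (- (a * t) / ((1 + t\<^sup>2) * sqrt (1 + t\<^sup>2)))) (at t)"
        using v[of t] v1 by (intro DERIV_chain2[OF DERIV_arccos dv]) auto
      then have "((\<lambda>t. arccos (v t) / \<beta>) has_real_derivative
          inverse (- sqrt (1 - (v t)\<^sup>2)) * (- (a * t) / ((1 + t\<^sup>2) * sqrt (1 + t\<^sup>2))) / \<beta>) (at t)"
        by (rule DERIV_cdivide)
      moreover have "inverse (- sqrt (1 - (v t)\<^sup>2)) * (- (a * t) / ((1 + t\<^sup>2) * sqrt (1 + t\<^sup>2))) / \<beta> = w t"
      proof -
        have "inverse (- (Q / R)) * (- (a * t) / (P * R)) / \<beta> = a * t / (P * Q) / \<beta>"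
          if "0 < R" "0 < Q" "0 < P" for P Q R :: real using that \<beta> by (simp add: divide_simps)
        from this[OF s(1) r0 pos[of t]] show ?thesis unfolding w_def r .
      qed
      ultimately show ?thesis by simp
    qed
    show "continuous_on {sqrt (12 * \<beta>)..1} w" proof -
      have "sqrt (1 + t\<^sup>2 - a\<^sup>2) \<noteq> 0" if "t \<in> {sqrt (12 * \<beta>)..1}" for t
      proof -
        have "0 < t" using that \<eta>(1) by (meson atLeastAtMost_iff less_le_trans)
        from pos'[OF this] show ?thesis by simp
      qed
      then show ?thesis
        unfolding w_def using pos \<beta> by (intro continuous_intros) (auto simp: less_imp_neq[symmetric])
    qed
    show "0 \<le> w t" if "0 < t" "t \<le> 1" for t
      unfolding w_def using that a \<beta> pos[of t] pos'[of t] by auto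
    show "w s \<le> 2 * w t" if st: "0 < s" "s \<le> t" "t \<le> 1" for s t proof -
      have t0: "0 < t" using st by simp
      have ps: "0 < 1 + s\<^sup>2 - a\<^sup>2" "0 < 1 + t\<^sup>2 - a\<^sup>2" using pos' st t0 by auto
      have "s\<^sup>2 \<le> t\<^sup>2" using st by (intro power_mono) auto
      then have "s\<^sup>2 * (1 - a\<^sup>2) \<le> t\<^sup>2 * (1 - a\<^sup>2)"
        using a2 by (intro mult_right_mono) auto
      then have "s\<^sup>2 * (1 + t\<^sup>2 - a\<^sup>2) \<le> t\<^sup>2 * (1 + s\<^sup>2 - a\<^sup>2)"
        by (simp add: algebra_simps)
      then have "sqrt (s\<^sup>2 * (1 + t\<^sup>2 - a\<^sup>2)) \<le> sqrt (t\<^sup>2 * (1 + s\<^sup>2 - a\<^sup>2))"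
        by (rule real_sqrt_le_mono)
      then have "s * sqrt (1 + t\<^sup>2 - a\<^sup>2) \<le> t * sqrt (1 + s\<^sup>2 - a\<^sup>2)"
        using st by (simp add: real_sqrt_mult)
      then have 1: "s / sqrt (1 + s\<^sup>2 - a\<^sup>2) \<le> t / sqrt (1 + t\<^sup>2 - a\<^sup>2)"
        using ps by (simp add: divide_simps mult.commute)
      have "t\<^sup>2 \<le> 1" using st t0 by (simp add: power_le_one)
      then have "t\<^sup>2 \<le> 1 + 2 * s\<^sup>2" using zero_le_power2[of s] by linarith
      then have 2: "1 / (1 + s\<^sup>2) \<le> 2 / (1 + t\<^sup>2)"
        using pos[of s] pos[of t] by (simp add: divide_simps)
      have "1 / (1 + s\<^sup>2) * (s / sqrt (1 + s\<^sup>2 - a\<^sup>2)) \<le> 2 / (1 + t\<^sup>2) * (t / sqrt (1 + t\<^sup>2 - a\<^sup>2))"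
        using 1 2 st ps pos[of t] by (intro mult_mono) auto
      then have "a / \<beta> * (1 / (1 + s\<^sup>2) * (s / sqrt (1 + s\<^sup>2 - a\<^sup>2)))
          \<le> a / \<beta> * (2 / (1 + t\<^sup>2) * (t / sqrt (1 + t\<^sup>2 - a\<^sup>2)))"
        using a \<beta> by (intro mult_left_mono) auto
      then show ?thesis unfolding w_def by (simp add: ac_simps)
    qed
    \<comment> \<open>On \<open>{0..sqrt (12 * \<beta>)}\<close> the cosine of the angle drops by at
      least \<open>3 * a * \<beta>\<close>, which exceeds \<open>2 * \<beta>\<close> because
      \<open>a \<ge> 7 / 10\<close>. As cosine is 1-Lipschitz, the angle gains at least one
      window.\<close>
    show "arccos (v 0) / \<beta> + 2 \<le> arccos (v (sqrt (12 * \<beta>))) / \<beta>" proof -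
      let ?\<eta> = "sqrt (12 * \<beta>)"
      have e2: "?\<eta>\<^sup>2 = 12 * \<beta>" using \<beta> by simp
      have "v ?\<eta> \<le> a * (1 - 12 * \<beta> / 4)"
        using mult_left_mono[OF inverse_sqrt_le[of "12 * \<beta>"], of a] \<beta> a unfolding v_def e2 by simp
      have "7 / 10 * (3 * \<beta>) \<le> a * (3 * \<beta>)" using a \<beta> by (intro mult_right_mono) auto
      have *: "v 0 - v ?\<eta> \<ge> 2 * \<beta>" proof -
        have "a * (1 - 12 * \<beta> / 4) = a - a * (3 * \<beta>)" "v 0 = a"
          by (simp_all add: v_def algebra_simps)
        then show "2 * \<beta> \<le> v 0 - v ?\<eta>"
          using \<open>v ?\<eta> \<le> a * (1 - 12 * \<beta> / 4)\<close> \<open>7 / 10 * (3 * \<beta>) \<le> a * (3 * \<beta>)\<close> \<beta>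
          by linarith
      qed
      then have "arccos (v 0) \<le> arccos (v ?\<eta>)"
        using v[of 0] v[of ?\<eta>] \<beta> by (intro arccos_le_arccos) auto
      from cos_diff_le[OF this] have "v 0 - v ?\<eta> \<le> arccos (v ?\<eta>) - arccos (v 0)"
        using v[of 0] v[of ?\<eta>] by (simp add: cos_arccos)
      then have "arccos (v 0) + 2 * \<beta> \<le> arccos (v ?\<eta>)" using * by simp
      from divide_right_mono[OF this, of \<beta>] show ?thesis
        using \<beta> by (simp add: add_divide_distrib)
    qed
  qed (use c\<Phi> in auto)
  then show ?thesis by (simp add: v_def)
qed

lemma arctan_diff_ge:
  assumes "0 \<le> x" "x \<le> y"
  shows "(y - x) / (1 + y\<^sup>2) \<le> arctan y - arctan x"
proof (cases "x = y")
  case False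
  with assms have "x < y" by simp
  from MVT2[OF this, of arctan "\<lambda>x. inverse (1 + x\<^sup>2)"] obtain z where
    z: "x < z" "z < y" "arctan y - arctan x = (y - x) * inverse (1 + z\<^sup>2)"
    by (auto intro: DERIV_arctan)
  have "z\<^sup>2 \<le> y\<^sup>2" using z assms by (intro power_mono) auto
  then have "inverse (1 + y\<^sup>2) \<le> inverse (1 + z\<^sup>2)"
    by (intro le_imp_inverse_le) (auto simp: add_pos_nonneg)
  then have "(y - x) * inverse (1 + y\<^sup>2) \<le> (y - x) * inverse (1 + z\<^sup>2)"
    using assms by (intro mult_left_mono) auto
  then show ?thesis using z by (simp add: divide_inverse)
qed simp

text \<open>The case \<open>a = 1\<close> of the whole space, where the angle is
  \<open>arctan t\<close>. The slopes between 1/2 and 3/4 span an angle of at least 4/25; since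
  \<beta> is at most 1/50, at least half of it remains after the loss of one window of length
  \<open>4 * \<beta>\<close>.\<close>

lemma nn_integral_ridge_angle_ge:
  fixes \<beta> d :: real
  assumes \<beta>: "0 < \<beta>" "\<beta> \<le> 1 / 50" and d: "0 < d"
  shows "ennreal (1 / 25) * ridge_integral p d
    \<le> (\<integral>\<^sup>+t\<in>{1 / 2..3 / 4}. ennreal (ridge p d (tri (arctan t / \<beta>))) \<partial>lborel)"
proof -
  let ?\<Phi> = "\<lambda>t. arctan t / \<beta>"
  let ?p = "\<lambda>u. ridge p d (tri u)"
  have pos: "1 + t\<^sup>2 > 0" for t :: real by (simp add: add_pos_nonneg)
  have p0: "0 \<le> ?p u" for u using tri_bounds[of u] d by (auto intro!: ridge_nonneg)
  have "4 / 25 \<le> arctan (3 / 4) - arctan (1 / 2)"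
    using arctan_diff_ge[of "1 / 2" "3 / 4"] by (simp add: power2_eq_square)
  then have gap: "4 / 25 / \<beta> \<le> ?\<Phi> (3 / 4) - ?\<Phi> (1 / 2)"
    using \<beta> by (simp add: divide_simps)
  moreover have "4 \<le> 2 / 25 / \<beta>" using \<beta> by (simp add: field_simps)
  ultimately have gap': "4 \<le> ?\<Phi> (3 / 4) - ?\<Phi> (1 / 2)" "2 / 25 / \<beta> \<le> ?\<Phi> (3 / 4) - ?\<Phi> (1 / 2) - 4"
    by (auto simp: field_simps)
  have "ennreal (1 / 25) * ridge_integral p d = ennreal \<beta> * (ennreal (2 / 25 / \<beta> / 4) * (2 * ridge_integral p d))"
  proof -
    have "ennreal \<beta> * (ennreal (2 / 25 / \<beta> / 4) * ennreal 2) = ennreal (1 / 25)"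
      using \<beta> by (simp add: ennreal_mult[symmetric] del: ennreal_numeral)
    then show ?thesis by (simp add: mult.assoc[symmetric])
  qed
  also have "\<dots> \<le> ennreal \<beta> * (ennreal ((?\<Phi> (3 / 4) - 4 - ?\<Phi> (1 / 2)) / 4) * (2 * ridge_integral p d))"
    using gap' by (intro mult_left_mono mult_right_mono ennreal_leI) auto
  also have "\<dots> \<le> ennreal \<beta> * (\<integral>\<^sup>+u\<in>{?\<Phi> (1 / 2)..?\<Phi> (3 / 4)}. ennreal (?p u) \<partial>lborel)"
    using gap' by (intro mult_left_mono nn_integral_ge_window nn_integral_ridge_window_ge) auto
  also have "(\<integral>\<^sup>+u\<in>{?\<Phi> (1 / 2)..?\<Phi> (3 / 4)}. ennreal (?p u) \<partial>lborel)
      = (\<integral>\<^sup>+u. ennreal (?p u * indicator {?\<Phi> (1 / 2)..?\<Phi> (3 / 4)} u) \<partial>lborel)"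
    by (intro nn_integral_cong) (auto simp: indicator_def)
  also have "\<dots> = (\<integral>\<^sup>+t. ennreal (?p (?\<Phi> t) * (inverse (1 + t\<^sup>2) / \<beta>) * indicator {1 / 2..3 / 4} t) \<partial>lborel)"
  proof (rule nn_integral_substitution)
    show "set_borel_measurable borel {?\<Phi> (1 / 2)..?\<Phi> (3 / 4)} ?p"
      unfolding set_borel_measurable_def by measurable
    show "continuous_on {1 / 2..3 / 4} (\<lambda>t. inverse (1 + t\<^sup>2) / \<beta>)"
      using pos \<beta> by (intro continuous_intros) (auto simp: less_imp_neq[symmetric])
    show "(?\<Phi> has_real_derivative inverse (1 + t\<^sup>2) / \<beta>) (at t)" for t
      by (intro DERIV_cdivide DERIV_arctan)
  qed (use \<beta> pos in \<open>auto simp: less_imp_le\<close>)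
  also have "ennreal \<beta> * \<dots> = (\<integral>\<^sup>+t. ennreal \<beta> * ennreal (?p (?\<Phi> t) * (inverse (1 + t\<^sup>2) / \<beta>) * indicator {1 / 2..3 / 4} t) \<partial>lborel)"
    by (rule nn_integral_cmult[symmetric]) measurable
  also have "\<dots> \<le> (\<integral>\<^sup>+t\<in>{1 / 2..3 / 4}. ennreal (?p (?\<Phi> t)) \<partial>lborel)"
  proof (rule nn_integral_mono)
    fix t :: real
    have "ennreal \<beta> * ennreal (?p (?\<Phi> t) * (inverse (1 + t\<^sup>2) / \<beta>)) = ennreal (?p (?\<Phi> t) * inverse (1 + t\<^sup>2))"
      using \<beta> p0[of "?\<Phi> t"] pos[of t] by (subst ennreal_mult[symmetric]) auto
    also have "\<dots> \<le> ennreal (?p (?\<Phi> t) * 1)"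
      using p0[of "?\<Phi> t"] pos[of t] by (intro ennreal_leI mult_left_mono) (auto simp: inverse_le_1_iff)
    finally show "ennreal \<beta> * ennreal (?p (?\<Phi> t) * (inverse (1 + t\<^sup>2) / \<beta>) * indicator {1 / 2..3 / 4} t)
        \<le> ennreal (?p (?\<Phi> t)) * indicator {1 / 2..3 / 4} t" by (auto simp: indicator_def)
  qed
  finally show ?thesis .
qed

section \<open>The ridged body and its depth below the unit sphere\<close>

abbreviation axis_dist :: "'a::euclidean_space \<Rightarrow> 'a \<Rightarrow> real" where
  "axis_dist e x \<equiv> norm (x - (x \<bullet> e) *\<^sub>R e)"

text \<open>In dimension at least 2 the left side is the largest inner product of \<open>x\<close>
  with a unit vector at angle \<alpha> to \<open>e\<close> or \<open>- e\<close>, so the constraints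
  are supporting half-spaces. The factor \<open>(1 + (norm x) ^ 2) / 2\<close> is the denominator of
  \<open>klein\<close> moved to the other side. The closed ball in the definition makes the set
  closed; that it lies in the open ball follows from the depth estimate.\<close>

definition ridged_body :: "'a::euclidean_space \<Rightarrow> real \<Rightarrow> real \<Rightarrow> 'a set" where
  "ridged_body e \<beta> d = {x \<in> cball 0 1. \<forall>\<alpha>\<in>normal_angles \<beta>.
     \<bar>x \<bullet> e\<bar> * cos \<alpha> + axis_dist e x * sin \<alpha> \<le> support_level \<beta> d * (1 + (norm x)\<^sup>2) / 2}"

lemma norm_diff_projection:
  fixes e x :: "'a::euclidean_space"
  assumes "norm e = 1"
  shows "(axis_dist e x)\<^sup>2 = (norm x)\<^sup>2 - (x \<bullet> e)\<^sup>2"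
proof -
  have "e \<bullet> e = 1" using assms by (simp add: norm_eq_1)
  then show ?thesis unfolding power2_norm_eq_inner by (simp add: inner_diff inner_commute power2_eq_square)
qed

lemma exists_colatitude:
  fixes e x :: "'a::euclidean_space"
  assumes "norm e = 1"
  obtains \<phi> where "0 \<le> \<phi>" "\<phi> \<le> pi / 2" "\<bar>x \<bullet> e\<bar> = norm x * cos \<phi>"
proof (cases "x = 0")
  case True
  then show ?thesis using that[of 0] by simp
next
  case False
  have "\<bar>x \<bullet> e\<bar> \<le> norm x" using Cauchy_Schwarz_ineq2[of x e] assms by simp
  then have "0 \<le> \<bar>x \<bullet> e\<bar> / norm x" "\<bar>x \<bullet> e\<bar> / norm x \<le> 1"
    using False by auto
  note b = this
  have b': "- 1 \<le> \<bar>x \<bullet> e\<bar> / norm x" by (rule order_trans[OF _ b(1)]) simp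
  show ?thesis
  proof (rule that)
    show "0 \<le> arccos (\<bar>x \<bullet> e\<bar> / norm x)" using b b' by (intro arccos_lbound)
    show "arccos (\<bar>x \<bullet> e\<bar> / norm x) \<le> pi / 2" using b by (intro arccos_le_pi2) auto
    have "cos (arccos (\<bar>x \<bullet> e\<bar> / norm x)) = \<bar>x \<bullet> e\<bar> / norm x"
      using b b' by (intro cos_arccos)
    then show "\<bar>x \<bullet> e\<bar> = norm x * cos (arccos (\<bar>x \<bullet> e\<bar> / norm x))"
      using False by simp
  qed
qed

text \<open>The addition theorem in the half-plane through the axis and \<open>x\<close>; it reduces
  membership in the body to the norm and the colatitude.\<close>

lemma colatitude_level:
  fixes e x :: "'a::euclidean_space"
  assumes e: "norm e = 1" and \<phi>: "0 \<le> \<phi>" "\<phi> \<le> pi / 2" "\<bar>x \<bullet> e\<bar> = norm x * cos \<phi>"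
  shows "\<bar>x \<bullet> e\<bar> * cos \<alpha> + axis_dist e x * sin \<alpha> = norm x * cos (\<phi> - \<alpha>)"
proof -
  have "(x \<bullet> e)\<^sup>2 = (norm x * cos \<phi>)\<^sup>2" unfolding \<phi>(3)[symmetric] by simp
  moreover have "(norm x * sin \<phi>)\<^sup>2 = (norm x)\<^sup>2 - (norm x * cos \<phi>)\<^sup>2"
    unfolding power_mult_distrib sin_squared_eq by (simp add: right_diff_distrib)
  ultimately have "(axis_dist e x)\<^sup>2 = (norm x * sin \<phi>)\<^sup>2"
    using norm_diff_projection[OF e, of x] by simp
  moreover have "0 \<le> sin \<phi>" using \<phi>(1,2) pi_gt_zero by (intro sin_ge_zero) linarith+
  ultimately have "axis_dist e x = norm x * sin \<phi>" by (auto intro: power2_eq_imp_eq)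
  then show ?thesis unfolding \<phi>(3) cos_diff by (simp add: distrib_left)
qed

lemma ridged_body_iff:
  fixes e x :: "'a::euclidean_space"
  assumes "norm e = 1" "0 \<le> \<phi>" "\<phi> \<le> pi / 2" "\<bar>x \<bullet> e\<bar> = norm x * cos \<phi>"
  shows "x \<in> ridged_body e \<beta> d \<longleftrightarrow> norm x \<le> 1 \<and>
    (\<forall>\<alpha>\<in>normal_angles \<beta>. norm x * cos (\<phi> - \<alpha>) \<le> support_level \<beta> d * (1 + (norm x)\<^sup>2) / 2)"
  unfolding ridged_body_def mem_Collect_eq colatitude_level[OF assms] by simp

text \<open>One normal suffices for each bound: the nearest multiple of \<open>2 * \<beta>\<close>
  up to \<open>pi / 4\<close>, and from there on \<phi> itself, at angular distance 0.\<close>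

lemma ridged_body_depth:
  fixes e x :: "'a::euclidean_space"
  assumes e: "norm e = 1" and \<phi>: "0 \<le> \<phi>" "\<phi> \<le> pi / 2" "\<bar>x \<bullet> e\<bar> = norm x * cos \<phi>"
    and \<beta>: "0 < \<beta>" "\<beta> \<le> 1 / 4" and d: "0 < d" and x: "x \<in> ridged_body e \<beta> d"
  shows "\<phi> \<le> pi / 4 \<Longrightarrow> \<beta> / 3 * sqrt (d + tri (\<phi> / \<beta>)) \<le> 1 - norm x"
    and "pi / 4 \<le> \<phi> \<Longrightarrow> \<beta> / 3 \<le> 1 - norm x"
    and "\<beta> / 3 * sqrt d \<le> 1 - norm x \<or> \<beta> / 3 \<le> 1 - norm x"
proof -
  have le: "norm x * cos (\<phi> - \<alpha>) \<le> support_level \<beta> d * (1 + (norm x)\<^sup>2) / 2" if "\<alpha> \<in> normal_angles \<beta>" for \<alpha>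
    using x that unfolding ridged_body_iff[OF e \<phi>] by blast
  have x1: "norm x \<le> 1" using x unfolding ridged_body_iff[OF e \<phi>] by blast
  show 1: "\<beta> / 3 * sqrt (d + tri (\<phi> / \<beta>)) \<le> 1 - norm x" if "\<phi> \<le> pi / 4"
  proof -
    obtain \<alpha> where \<alpha>: "\<alpha> \<in> normal_angles \<beta>" "\<bar>\<phi> - \<alpha>\<bar> = \<beta> * (1 - tri (\<phi> / \<beta>))"
      using normal_angles_near[OF \<beta> \<phi>(1) \<open>\<phi> \<le> pi / 4\<close>] by metis
    have "norm x * cos \<bar>\<phi> - \<alpha>\<bar> \<le> support_level \<beta> d * (1 + (norm x)\<^sup>2) / 2"
      using le[OF \<alpha>(1)] by simp
    moreover have "\<bar>\<phi> - \<alpha>\<bar> \<le> \<beta>"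
      using \<beta> tri_bounds[of "\<phi> / \<beta>"] unfolding \<alpha>(2) by simp
    ultimately have "\<beta> / 3 * sqrt (d + (1 - \<bar>\<phi> - \<alpha>\<bar> / \<beta>)) \<le> 1 - norm x"
      using \<beta> d x1 by (intro depth_lower_bound) auto
    then show ?thesis using \<beta> unfolding \<alpha>(2) by simp
  qed
  show 2: "\<beta> / 3 \<le> 1 - norm x" if "pi / 4 \<le> \<phi>" proof -
    have "\<phi> \<in> normal_angles \<beta>" using that \<phi> by (simp add: normal_angles_def)
    from le[OF this] have "\<beta> / 3 * sqrt (d + (1 - 0 / \<beta>)) \<le> 1 - norm x"
      using \<beta> d x1 by (intro depth_lower_bound) auto
    moreover have "\<beta> / 3 * 1 \<le> \<beta> / 3 * sqrt (d + 1)"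
      using \<beta> d by (intro mult_left_mono) auto
    ultimately show ?thesis by simp
  qed
  have "\<beta> / 3 * sqrt d \<le> \<beta> / 3 * sqrt (d + tri (\<phi> / \<beta>))"
    using \<beta> tri_bounds[of "\<phi> / \<beta>"] by (intro mult_left_mono) auto
  then show "\<beta> / 3 * sqrt d \<le> 1 - norm x \<or> \<beta> / 3 \<le> 1 - norm x"
    using 1 2 by (cases "\<phi> \<le> pi / 4") auto
qed

lemma ridged_body_norm_less:
  fixes e x :: "'a::euclidean_space"
  assumes "norm e = 1" and \<beta>: "0 < \<beta>" "\<beta> \<le> 1 / 4" and d: "0 < d" and x: "x \<in> ridged_body e \<beta> d"
  shows "norm x < 1"
proof -
  obtain \<phi> where \<phi>: "0 \<le> \<phi>" "\<phi> \<le> pi / 2" "\<bar>x \<bullet> e\<bar> = norm x * cos \<phi>"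
    using exists_colatitude[OF assms(1)] by metis
  have "0 < \<beta> / 3 * sqrt d" "0 < \<beta> / 3" using \<beta> d by auto
  with ridged_body_depth(3)[OF assms(1) \<phi> \<beta> d x] show ?thesis
    by linarith
qed

text \<open>All normals have to be respected, but since cosine decreases on \<open>{0..pi}\<close>
  the one at the smallest possible distance \<open>D\<close> decides.\<close>

lemma ridged_body_memI:
  fixes e x :: "'a::euclidean_space"
  assumes e: "norm e = 1" and \<phi>: "0 \<le> \<phi>" "\<phi> \<le> pi / 4 - \<beta>" "\<bar>x \<bullet> e\<bar> = norm x * cos \<phi>"
    and \<beta>: "0 < \<beta>" "\<beta> \<le> 1 / 4" and d: "0 < d"
    and le: "norm x \<le> 1 - 3 * \<beta> * sqrt (d + tri (\<phi> / \<beta>))"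
  shows "x \<in> ridged_body e \<beta> d"
proof -
  have \<phi>2: "\<phi> \<le> pi / 2" using \<phi> \<beta> pi_gt_zero by linarith
  define D where "D = \<beta> * (1 - tri (\<phi> / \<beta>))"
  have D: "0 \<le> D" "D \<le> \<beta>" "1 - D / \<beta> = tri (\<phi> / \<beta>)"
    using \<beta> tri_bounds[of "\<phi> / \<beta>"] by (auto simp: D_def)
  have lev: "norm x * cos D \<le> support_level \<beta> d * (1 + (norm x)\<^sup>2) / 2"
    using D \<beta> d le by (intro depth_sufficient) auto
  have "norm x * cos (\<phi> - \<alpha>) \<le> norm x * cos D" if \<alpha>: "\<alpha> \<in> normal_angles \<beta>" for \<alpha>
  proof (rule mult_left_mono)
    have "D \<le> \<bar>\<phi> - \<alpha>\<bar>"
      unfolding D_def using normal_angles_far[OF \<beta>(1) \<phi>(2) \<alpha>] .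
    moreover have "\<bar>\<phi> - \<alpha>\<bar> \<le> pi"
      using \<phi> \<phi>2 \<alpha> pi_gt_zero unfolding normal_angles_def by auto
    ultimately have "cos \<bar>\<phi> - \<alpha>\<bar> \<le> cos D"
      using D by (intro cos_monotone_0_pi_le) auto
    then show "cos (\<phi> - \<alpha>) \<le> cos D" by simp
  qed simp
  moreover have "0 \<le> 3 * \<beta> * sqrt (d + tri (\<phi> / \<beta>))"
    using \<beta> d tri_bounds[of "\<phi> / \<beta>"] by simp
  then have "norm x \<le> 1" using le by linarith
  ultimately show ?thesis
    unfolding ridged_body_iff[OF e \<phi>(1) \<phi>2 \<phi>(3)] using order_trans[OF _ lev] by blast
qed

lemma closed_ridged_body: "closed (ridged_body e \<beta> d)"
proof -
  have "ridged_body e \<beta> d = cball 0 1 \<inter> (\<Inter>\<alpha>\<in>normal_angles \<beta>.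
      {x. \<bar>x \<bullet> e\<bar> * cos \<alpha> + axis_dist e x * sin \<alpha> \<le> support_level \<beta> d * (1 + (norm x)\<^sup>2) / 2})"
    by (auto simp: ridged_body_def)
  also have "closed \<dots>"
    by (intro closed_Int closed_INT closed_cball ballI closed_Collect_le continuous_intros) auto
  finally show ?thesis .
qed

lemma support_level_pos: "0 < \<beta> \<Longrightarrow> \<beta> \<le> 1 / 4 \<Longrightarrow> d \<le> 1 \<Longrightarrow> 0 < support_level \<beta> d"
proof -
  assume \<beta>: "0 < \<beta>" "\<beta> \<le> 1 / 4" and d: "d \<le> 1"
  have "d * \<beta>\<^sup>2 \<le> 1 * \<beta>\<^sup>2" using d by (intro mult_right_mono) auto
  also have "\<dots> < 1" using \<beta> by (simp add: power_less_one_iff)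
  finally show ?thesis unfolding support_level_def using cos_ge_half[of \<beta>] \<beta> by simp
qed

lemma body_ridged_body:
  fixes e :: "'a::euclidean_space"
  assumes e: "norm e = 1" and \<beta>: "0 < \<beta>" "\<beta> \<le> 1 / 4" and d: "0 < d" "d \<le> 1"
  shows "body (ridged_body e \<beta> d)"
  unfolding body_def
proof
  have "bounded (ridged_body e \<beta> d)"
    by (rule bounded_subset[OF bounded_cball[of 0 1]]) (auto simp: ridged_body_def)
  with closed_ridged_body show "compact (ridged_body e \<beta> d)" by (simp add: compact_eq_bounded_closed)
  define q where "q = support_level \<beta> d"
  have q: "0 < q" "q \<le> 1" proof -
    show "0 < q" unfolding q_def using support_level_pos \<beta> d by simp
    have "(1 - d * \<beta>\<^sup>2) * cos \<beta> \<le> 1 * 1"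
      using d cos_ge_half[of \<beta>] \<beta> by (intro mult_mono) auto
    then show "q \<le> 1" by (simp add: q_def support_level_def)
  qed
  \<comment> \<open>Up to radius \<open>q / 2\<close> the constraints hold even with all cosines
    replaced by 1.\<close>
  have "ball 0 (q / 2) \<subseteq> ridged_body e \<beta> d"
  proof
    fix x :: 'a assume x: "x \<in> ball 0 (q / 2)"
    obtain \<phi> where \<phi>: "0 \<le> \<phi>" "\<phi> \<le> pi / 2" "\<bar>x \<bullet> e\<bar> = norm x * cos \<phi>"
      using exists_colatitude[OF e] by metis
    have "norm x * cos (\<phi> - \<alpha>) \<le> q * (1 + (norm x)\<^sup>2) / 2" for \<alpha>
    proof -
      have "norm x * cos (\<phi> - \<alpha>) \<le> norm x * 1" by (intro mult_left_mono) auto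
      moreover have "norm x \<le> q * 1 / 2" using x by simp
      moreover have "q * 1 \<le> q * (1 + (norm x)\<^sup>2)" using q by (intro mult_left_mono) auto
      ultimately show ?thesis by linarith
    qed
    then show "x \<in> ridged_body e \<beta> d"
      unfolding ridged_body_iff[OF e \<phi>] q_def using x q by auto
  qed
  then have "ball 0 (q / 2) \<subseteq> interior (ridged_body e \<beta> d)" by (rule interior_maximal) simp
  then show "interior (ridged_body e \<beta> d) \<noteq> {}" proof -
    have "0 \<in> ball (0 :: 'a) (q / 2)" using q by simp
    then show ?thesis
      using \<open>ball 0 (q / 2) \<subseteq> interior (ridged_body e \<beta> d)\<close> by (metis empty_iff subsetD)
  qed
qed

section \<open>Symmetry and hyperbolic convexity\<close>

lemma origin_symmetricI:
  assumes "\<And>x. x \<in> K \<Longrightarrow> - x \<in> K"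
  shows "origin_symmetric K"
  unfolding origin_symmetric_def
proof (intro equalityI subsetI)
  fix x assume "x \<in> K"
  then show "x \<in> uminus ` K" using assms[of x] by (intro image_eqI[of x uminus "- x"]) simp_all
next
  fix x assume "x \<in> uminus ` K"
  then show "x \<in> K" using assms by (elim imageE) simp
qed

lemma origin_symmetric_ridged_body: "origin_symmetric (ridged_body e \<beta> d)"
proof -
  have "- x \<in> ridged_body e \<beta> d" if "x \<in> ridged_body e \<beta> d" for x proof -
    have "norm (- x - ((- x) \<bullet> e) *\<^sub>R e) = axis_dist e x"
      by (metis inner_minus_left minus_diff_minus norm_minus_cancel scaleR_minus_left)
    then show ?thesis using that unfolding ridged_body_def by simp
  qed
  then show ?thesis by (rule origin_symmetricI)
qed

text \<open>Sine and cosine are nonnegative at normal angles, so each \<open>f \<alpha>\<close> is a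
  convex function. It is also positively homogeneous, which lets the scaling factor of
  \<open>klein\<close> pass to the right-hand side.\<close>

lemma hyp_convex_ridged_body:
  fixes e :: "'a::euclidean_space"
  assumes e: "norm e = 1" and \<beta>: "0 < \<beta>" "\<beta> \<le> 1 / 4" and d: "0 < d"
  shows "hyp_convex (ridged_body e \<beta> d)"
proof -
  define f where "f \<alpha> z = \<bar>z \<bullet> e\<bar> * cos \<alpha> + norm (z - (z \<bullet> e) *\<^sub>R e) * sin \<alpha>" for \<alpha> and z :: 'a
  define C where "C = (\<Inter>\<alpha>\<in>normal_angles \<beta>. {z. f \<alpha> z \<le> support_level \<beta> d})"
  have "convex {z. f \<alpha> z \<le> s}" if "\<alpha> \<in> normal_angles \<beta>" for \<alpha> s
  proof (rule convexI, clarify)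
    fix x y :: 'a and u v :: real
    assume xy: "f \<alpha> x \<le> s" "f \<alpha> y \<le> s" and uv: "0 \<le> u" "0 \<le> v" "u + v = 1"
    have cs: "0 \<le> cos \<alpha>" "0 \<le> sin \<alpha>" proof -
      have "0 \<le> \<alpha>" "\<alpha> \<le> pi / 2" using that unfolding normal_angles_def by auto
      then show "0 \<le> cos \<alpha>" "0 \<le> sin \<alpha>"
        using pi_gt_zero by (auto intro!: cos_ge_zero sin_ge_zero)
    qed
    let ?z = "u *\<^sub>R x + v *\<^sub>R y"
    have "\<bar>?z \<bullet> e\<bar> \<le> u * \<bar>x \<bullet> e\<bar> + v * \<bar>y \<bullet> e\<bar>"
      using uv abs_triangle_ineq[of "u * (x \<bullet> e)" "v * (y \<bullet> e)"] by (simp add: inner_add_left abs_mult)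
    moreover have "norm (?z - (?z \<bullet> e) *\<^sub>R e) \<le> u * axis_dist e x + v * norm (y - (y \<bullet> e) *\<^sub>R e)"
    proof -
      have "?z - (?z \<bullet> e) *\<^sub>R e = u *\<^sub>R (x - (x \<bullet> e) *\<^sub>R e) + v *\<^sub>R (y - (y \<bullet> e) *\<^sub>R e)"
        by (simp add: inner_add_left algebra_simps)
      then show ?thesis
        using uv norm_triangle_ineq[of "u *\<^sub>R (x - (x \<bullet> e) *\<^sub>R e)" "v *\<^sub>R (y - (y \<bullet> e) *\<^sub>R e)"] by simp
    qed
    ultimately have "f \<alpha> ?z \<le> (u * \<bar>x \<bullet> e\<bar> + v * \<bar>y \<bullet> e\<bar>) * cos \<alpha>
        + (u * axis_dist e x + v * norm (y - (y \<bullet> e) *\<^sub>R e)) * sin \<alpha>"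
      unfolding f_def using cs by (intro add_mono mult_right_mono) auto
    also have "\<dots> = u * f \<alpha> x + v * f \<alpha> y" by (simp add: f_def algebra_simps)
    also have "\<dots> \<le> u * s + v * s" using xy uv by (intro add_mono mult_left_mono) auto
    also have "\<dots> = s" using uv by (metis distrib_right mult_1)
    finally show "f \<alpha> ?z \<le> s" .
  qed
  then have "convex C" unfolding C_def by (intro convex_INT) auto
  moreover have "ridged_body e \<beta> d = {x \<in> ball 0 1. klein x \<in> C}" proof -
    have f: "f \<alpha> (klein x) \<le> s \<longleftrightarrow> f \<alpha> x \<le> s * (1 + (norm x)\<^sup>2) / 2" for \<alpha> x s
    proof -
      define l where "l = 2 / (1 + (norm x)\<^sup>2)"
      have pos: "0 < 1 + (norm x)\<^sup>2" by (simp add: add_pos_nonneg)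
      then have l: "0 < l" by (simp add: l_def)
      have "klein x - (klein x \<bullet> e) *\<^sub>R e = l *\<^sub>R (x - (x \<bullet> e) *\<^sub>R e)"
        by (simp add: klein_def l_def algebra_simps)
      then have "norm (klein x - (klein x \<bullet> e) *\<^sub>R e) = l * axis_dist e x" using l by simp
      moreover have "\<bar>klein x \<bullet> e\<bar> = l * \<bar>x \<bullet> e\<bar>"
        using l by (simp add: klein_def l_def abs_mult)
      ultimately have "f \<alpha> (klein x) = l * f \<alpha> x"
        unfolding f_def by (simp only: distrib_left mult.assoc)
      moreover have "l * f \<alpha> x \<le> s \<longleftrightarrow> f \<alpha> x \<le> s / l"
        using l by (simp add: pos_le_divide_eq mult.commute)
      moreover have "s / l = s * (1 + (norm x)\<^sup>2) / 2" by (simp add: l_def)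
      ultimately show ?thesis by simp
    qed
    have "x \<in> ridged_body e \<beta> d \<longleftrightarrow> x \<in> ball 0 1 \<and> klein x \<in> C" for x
    proof -
      have "x \<in> ridged_body e \<beta> d \<longleftrightarrow> norm x \<le> 1 \<and> klein x \<in> C"
        unfolding C_def INT_iff mem_Collect_eq f unfolding ridged_body_def mem_Collect_eq f_def by simp
      then show ?thesis using ridged_body_norm_less[OF e \<beta> d, of x] by (metis less_imp_le mem_ball_0)
    qed
    then show ?thesis by blast
  qed
  ultimately show ?thesis using hyp_convex_klein_vimage by simp
qed

text \<open>In the Klein model the ball is again a centred ball, because
  \<open>2 * r / (1 + r ^ 2)\<close> increases on the unit interval.\<close>

lemma hyp_convex_cball:
  assumes "s < 1"
  shows "hyp_convex (cball (0 :: 'a::euclidean_space) s)"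
proof (cases "0 \<le> s")
  case True
  have pos: "0 < 1 + t\<^sup>2" for t :: real by (simp add: add_pos_nonneg)
  have "cball (0 :: 'a) s = {x \<in> ball 0 1. klein x \<in> cball 0 (2 * s / (1 + s\<^sup>2))}"
  proof -
    have "norm x \<le> s \<longleftrightarrow> norm x < 1 \<and> norm (klein x) \<le> 2 * s / (1 + s\<^sup>2)" for x :: 'a
    proof (cases "norm x < 1")
      case True
      have "norm (klein x) \<le> 2 * s / (1 + s\<^sup>2) \<longleftrightarrow> norm x * (1 + s\<^sup>2) \<le> s * (1 + (norm x)\<^sup>2)"
      proof -
        have "norm (klein x) = 2 * norm x / (1 + (norm x)\<^sup>2)" by (simp add: klein_def)
        moreover have "2 * norm x / (1 + (norm x)\<^sup>2) \<le> 2 * s / (1 + s\<^sup>2)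
            \<longleftrightarrow> 2 * (norm x * (1 + s\<^sup>2)) \<le> 2 * (s * (1 + (norm x)\<^sup>2))"
          using pos[of s] pos[of "norm x"] by (simp add: field_simps)
        ultimately have "norm (klein x) \<le> 2 * s / (1 + s\<^sup>2) \<longleftrightarrow> 2 * (norm x * (1 + s\<^sup>2)) \<le> 2 * (s * (1 + (norm x)\<^sup>2))"
          by simp
        then show ?thesis by (simp only: mult_le_cancel_left_pos[OF zero_less_numeral])
      qed
      also have "\<dots> \<longleftrightarrow> 0 \<le> (s - norm x) * (1 - s * norm x)"
        by (simp add: power2_eq_square algebra_simps)
      also have "\<dots> \<longleftrightarrow> 0 \<le> s - norm x" proof -
        have "s * norm x < 1 * 1"
          using True \<open>0 \<le> s\<close> assms by (intro mult_strict_mono') auto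
        then have "0 < 1 - s * norm x" by simp
        then show ?thesis by (simp add: zero_le_mult_iff)
      qed
      finally show ?thesis using True by simp
    next
      case False
      then show ?thesis using assms by linarith
    qed
    then show ?thesis by (intro set_eqI) (simp only: mem_cball_0 mem_ball_0 mem_Collect_eq)
  qed
  then show ?thesis by (simp only: hyp_convex_klein_vimage convex_cball)
next
  case False
  then have "cball (0 :: 'a) s = {}" by simp
  then show ?thesis by (simp add: hyp_convex_def)
qed

lemma body_cball: "0 < s \<Longrightarrow> body (cball (0 :: 'a::euclidean_space) s)"
  unfolding body_def interior_cball by (simp only: compact_cball ball_eq_empty not_le simp_thms)

lemma origin_symmetric_cball: "origin_symmetric (cball (0 :: 'a::euclidean_space) s)"
proof (rule origin_symmetricI)
  fix x :: 'a assume "x \<in> cball 0 s"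
  then show "- x \<in> cball 0 s" by (simp only: mem_cball_0 norm_minus_cancel)
qed

section \<open>Cylindrical coordinates and volume bounds\<close>

abbreviation hyp_density :: "nat \<Rightarrow> 'a::euclidean_space \<Rightarrow> real" where
  "hyp_density m x \<equiv> 1 / (1 - (norm x)\<^sup>2) ^ m"

abbreviation hyp_integral :: "nat \<Rightarrow> 'a::euclidean_space set \<Rightarrow> 'a set \<Rightarrow> ennreal" where
  "hyp_integral m B A \<equiv> \<integral>\<^sup>+x\<in>A. ennreal (hyp_density m x) \<partial>frame_lborel B"

lemma orthonormal_insert_span_orth:
  assumes "orthonormal (insert e B)" "e \<notin> B" "y \<in> span B"
  shows "y \<bullet> e = 0"
proof -
  have "orthogonal e b" if "b \<in> B" for b
    using that assms(2) orthonormal_inner[OF assms(1), of e b] by (auto simp: orthogonal_def)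
  then have "orthogonal e y" by (rule orthogonal_to_span[OF assms(3)])
  then show ?thesis by (simp add: orthogonal_def inner_commute)
qed

text \<open>The cut-off at distance 1 from the axis matches the radial formula, which is stated for
  the unit ball; the bodies studied lie inside it.\<close>

abbreviation cyl_integral :: "(real \<Rightarrow> real \<Rightarrow> ennreal) \<Rightarrow> 'a::euclidean_space \<Rightarrow> 'a set \<Rightarrow> ennreal" where
  "cyl_integral G e B \<equiv> \<integral>\<^sup>+x. G (x \<bullet> e) (axis_dist e x) * indicator {..1} (axis_dist e x) \<partial>frame_lborel (insert e B)"

lemma nn_integral_cylindrical:
  fixes e :: "'a::euclidean_space" and G :: "real \<Rightarrow> real \<Rightarrow> ennreal"
  assumes B: "orthonormal (insert e B)" "e \<notin> B" "B \<noteq> {}"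
    and [measurable]: "case_prod G \<in> borel_measurable (borel \<Otimes>\<^sub>M borel)"
  shows "cyl_integral G e B
    = unit_ball_vol B *
      (\<integral>\<^sup>+s. \<integral>\<^sup>+r. ennreal (card B * r ^ (card B - 1)) * G s r * indicator {0..1} r \<partial>lborel \<partial>lborel)"
proof -
  let ?p = "card B" and ?\<kappa> = "unit_ball_vol B"
  have B': "orthonormal B" using B(1) by (rule orthonormal_subset) auto
  have e: "e \<bullet> e = 1" using orthonormal_inner[OF B(1), of e e] by simp
  have "cyl_integral G e B
      = (\<integral>\<^sup>+s. \<integral>\<^sup>+y. G ((s *\<^sub>R e + y) \<bullet> e) (axis_dist e (s *\<^sub>R e + y))
          * indicator {..1} (axis_dist e (s *\<^sub>R e + y)) \<partial>frame_lborel B \<partial>lborel)"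
    by (rule nn_integral_frame_lborel_insert[OF B(1,2)]) measurable
  also have "\<dots> = (\<integral>\<^sup>+s. \<integral>\<^sup>+y. G s (norm y) * indicator (cball 0 1) y \<partial>frame_lborel B \<partial>lborel)"
  proof (rule nn_integral_cong)
    fix s :: real
    show "(\<integral>\<^sup>+y. G ((s *\<^sub>R e + y) \<bullet> e) (axis_dist e (s *\<^sub>R e + y))
          * indicator {..1} (axis_dist e (s *\<^sub>R e + y)) \<partial>frame_lborel B)
        = (\<integral>\<^sup>+y\<in>(cball 0 1). G s (norm y) \<partial>frame_lborel B)"
    proof (rule nn_integral_cong_AE)
      show "AE y in frame_lborel B. G ((s *\<^sub>R e + y) \<bullet> e) (axis_dist e (s *\<^sub>R e + y))
          * indicator {..1} (axis_dist e (s *\<^sub>R e + y)) = G s (norm y) * indicator (cball 0 1) y"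
        using AE_frame_lborel_span[OF B']
      proof eventually_elim
        case (elim y)
        then have "(s *\<^sub>R e + y) \<bullet> e = s"
          using orthonormal_insert_span_orth[OF B(1,2) elim] e by (simp add: inner_add_left)
        then show ?case by (auto simp: indicator_def)
      qed
    qed
  qed
  also have "\<dots> = (\<integral>\<^sup>+s. ?\<kappa> * (\<integral>\<^sup>+r. ennreal (?p * r ^ (?p - 1)) * G s r * indicator {0..1} r \<partial>lborel) \<partial>lborel)"
    by (intro nn_integral_cong nn_integral_frame_radial B' B(3)) measurable
  also have "\<dots> = ?\<kappa> * (\<integral>\<^sup>+s. \<integral>\<^sup>+r. ennreal (?p * r ^ (?p - 1)) * G s r * indicator {0..1} r \<partial>lborel \<partial>lborel)"
    by (rule nn_integral_cmult) measurable
  finally show ?thesis .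
qed

text \<open>Here the radius \<open>r\<close> is replaced by the slope \<open>t = r / \<bar>s\<bar>\<close>, i.e. the tangent of the angle to the axis.\<close>

abbreviation slope_integrand :: "nat \<Rightarrow> (real \<Rightarrow> real \<Rightarrow> ennreal) \<Rightarrow> real \<Rightarrow> real \<Rightarrow> ennreal" where
  "slope_integrand p G s t \<equiv>
     ennreal \<bar>s\<bar> * (ennreal (p * (\<bar>s\<bar> * t) ^ (p - 1)) * G s (\<bar>s\<bar> * t) * indicator {0..1} (\<bar>s\<bar> * t))"

abbreviation slope_integral :: "nat \<Rightarrow> (real \<Rightarrow> real \<Rightarrow> ennreal) \<Rightarrow> ennreal" where
  "slope_integral p G \<equiv> \<integral>\<^sup>+t. \<integral>\<^sup>+s. slope_integrand p G s t \<partial>lborel \<partial>lborel"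

lemma nn_integral_slope:
  fixes e :: "'a::euclidean_space" and G :: "real \<Rightarrow> real \<Rightarrow> ennreal"
  assumes B: "orthonormal (insert e B)" "e \<notin> B" "B \<noteq> {}"
    and [measurable]: "case_prod G \<in> borel_measurable (borel \<Otimes>\<^sub>M borel)"
  shows "cyl_integral G e B = unit_ball_vol B * slope_integral (card B) G"
proof -
  let ?p = "card B"
  let ?F = "\<lambda>(s :: real) (r :: real). ennreal (?p * r ^ (?p - 1)) * G s r * indicator {0..1} r"
  have [measurable]: "case_prod ?F \<in> borel_measurable (borel \<Otimes>\<^sub>M borel)" by measurable
  have "(\<integral>\<^sup>+s. \<integral>\<^sup>+r. ?F s r \<partial>lborel \<partial>lborel) = (\<integral>\<^sup>+s. \<integral>\<^sup>+t. ennreal \<bar>s\<bar> * ?F s (\<bar>s\<bar> * t) \<partial>lborel \<partial>lborel)"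
  proof (rule nn_integral_cong_AE)
    \<comment> \<open>The slope has no meaning at height 0, a null set.\<close>
    show "AE s in lborel. (\<integral>\<^sup>+r. ?F s r \<partial>lborel) = (\<integral>\<^sup>+t. ennreal \<bar>s\<bar> * ?F s (\<bar>s\<bar> * t) \<partial>lborel)"
      using AE_lborel_singleton[of "0 :: real"]
    proof eventually_elim
      case (elim s)
      have "(\<integral>\<^sup>+r. ?F s r \<partial>lborel) = ennreal \<bar>\<bar>s\<bar>\<bar> * (\<integral>\<^sup>+t. ?F s (0 + \<bar>s\<bar> * t) \<partial>lborel)"
        by (rule nn_integral_real_affine) (use elim in auto)
      also have "\<dots> = (\<integral>\<^sup>+t. ennreal \<bar>s\<bar> * ?F s (\<bar>s\<bar> * t) \<partial>lborel)"
        unfolding abs_abs add_0_left by (rule nn_integral_cmult[symmetric]) measurable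
      finally show ?case .
    qed
  qed
  also have "\<dots> = (\<integral>\<^sup>+t. \<integral>\<^sup>+s. ennreal \<bar>s\<bar> * ?F s (\<bar>s\<bar> * t) \<partial>lborel \<partial>lborel)"
    by (rule lborel_pair.Fubini'[symmetric]) measurable
  finally show ?thesis by (simp only: nn_integral_cylindrical[OF assms])
qed

section \<open>Volume element on balls and on bodies with a given depth profile\<close>

lemma nn_integral_inverse_power_le:
  fixes h :: real
  assumes h: "0 < h" "h \<le> 1" and p: "1 \<le> p"
  shows "(\<integral>\<^sup>+t\<in>{0..1 - h}. ennreal ((1 / (1 - t)) ^ Suc p) \<partial>lborel) \<le> ennreal ((1 / h) ^ p)"
proof -
  let ?F = "\<lambda>t. (1 / (1 - t)) ^ p / real p"
  have "(\<integral>\<^sup>+t\<in>{0..1 - h}. ennreal ((1 / (1 - t)) ^ Suc p) \<partial>lborel) = ennreal (?F (1 - h) - ?F 0)"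
  proof (rule nn_integral_FTC_Icc[where F = ?F])
    fix t assume t: "t \<in> {0..1 - h}"
    then have t1: "1 - t > 0" using h by simp
    have "((\<lambda>t. 1 / (1 - t)) has_real_derivative (1 / (1 - t))\<^sup>2) (at t)"
      using t1 by (auto intro!: derivative_eq_intros simp: power2_eq_square)
    from DERIV_power[OF this, of p]
    have "((\<lambda>t. (1 / (1 - t)) ^ p) has_real_derivative real p * ((1 / (1 - t))\<^sup>2 * (1 / (1 - t)) ^ (p - Suc 0))) (at t)"
      by simp
    then have "(?F has_real_derivative real p * ((1 / (1 - t))\<^sup>2 * (1 / (1 - t)) ^ (p - Suc 0)) / real p) (at t)"
      by (rule DERIV_cdivide)
    moreover have "real p * ((1 / (1 - t))\<^sup>2 * (1 / (1 - t)) ^ (p - Suc 0)) / real p = (1 / (1 - t)) ^ Suc p"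
    proof -
      have "(1 / (1 - t))\<^sup>2 * (1 / (1 - t)) ^ (p - Suc 0) = (1 / (1 - t)) ^ (2 + (p - Suc 0))"
        by (rule power_add[symmetric])
      also have "2 + (p - Suc 0) = Suc p" using p by simp
      finally show ?thesis using p by simp
    qed
    ultimately show "(?F has_real_derivative (1 / (1 - t)) ^ Suc p) (at t)" by simp
    show "0 \<le> (1 / (1 - t)) ^ Suc p" using t1 by simp
  qed (use h in auto)
  also have "\<dots> \<le> ennreal ((1 / h) ^ p)"
  proof (rule ennreal_leI)
    have "(1 / h) ^ p / real p \<le> (1 / h) ^ p / 1" using p h by (intro divide_left_mono) auto
    moreover have "0 \<le> ?F 0" by simp
    ultimately have "(1 / h) ^ p / real p - ?F 0 \<le> (1 / h) ^ p / 1" by linarith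
    then show "?F (1 - h) - ?F 0 \<le> (1 / h) ^ p" by simp
  qed
  finally show ?thesis .
qed

lemma one_minus_square_bounds:
  fixes t :: real
  assumes "0 \<le> t" "t < 1"
  shows "1 - t \<le> 1 - t\<^sup>2" "1 - t\<^sup>2 \<le> 2 * (1 - t)" "0 < 1 - t\<^sup>2"
proof -
  have "t * t \<le> t * 1" using assms by (intro mult_left_mono) auto
  then show "1 - t \<le> 1 - t\<^sup>2" "0 < 1 - t\<^sup>2" using assms by (auto simp: power2_eq_square)
  have "0 \<le> (1 - t)\<^sup>2" by simp
  then show "1 - t\<^sup>2 \<le> 2 * (1 - t)" by (simp add: power2_eq_square algebra_simps)
qed

lemma hyp_density_le: "0 \<le> t \<Longrightarrow> t < 1 \<Longrightarrow> 1 / (1 - t\<^sup>2) ^ m \<le> (1 / (1 - t :: real)) ^ m"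
  using one_minus_square_bounds[of t] unfolding power_one_over
  by (intro divide_left_mono power_mono mult_pos_pos zero_less_power) auto

lemma hyp_density_ge: "0 \<le> t \<Longrightarrow> t < 1 \<Longrightarrow> (1 / (2 * (1 - t :: real))) ^ m \<le> 1 / (1 - t\<^sup>2) ^ m"
  using one_minus_square_bounds[of t] unfolding power_one_over
  by (intro divide_left_mono power_mono mult_pos_pos zero_less_power) auto

lemma nn_integral_ball_density_le:
  fixes B :: "'a::euclidean_space set"
  assumes B: "orthonormal B" "card B = Suc p" and p: "1 \<le> p" and h: "0 < h" "h \<le> 1"
  shows "hyp_integral (Suc p) B (cball 0 (1 - h))
    \<le> unit_ball_vol B * ennreal (Suc p * (1 / h) ^ p)"
proof -
  let ?\<omega> = "unit_ball_vol B"
  let ?f = "\<lambda>t. ennreal (1 / (1 - t\<^sup>2) ^ Suc p) * indicator {..1 - h} t"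
  have ne: "B \<noteq> {}" using B(2) by auto
  have "hyp_integral (Suc p) B (cball 0 (1 - h))
      = (\<integral>\<^sup>+x\<in>(cball 0 1). ?f (norm x) \<partial>frame_lborel B)"
    using h by (intro nn_integral_cong) (auto simp: indicator_def)
  also have "\<dots> = ?\<omega> * (\<integral>\<^sup>+t\<in>{0..1}. ennreal (card B * t ^ (card B - 1)) * ?f t \<partial>lborel)"
    by (rule nn_integral_frame_radial[OF B(1) ne]) measurable
  also have "\<dots> \<le> ?\<omega> * (\<integral>\<^sup>+t. ennreal (Suc p) * (ennreal ((1 / (1 - t)) ^ Suc p) * indicator {0..1 - h} t) \<partial>lborel)"
  proof (intro mult_left_mono nn_integral_mono)
    fix t :: real
    show "ennreal (card B * t ^ (card B - 1)) * ?f t * indicator {0..1} t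
        \<le> ennreal (Suc p) * (ennreal ((1 / (1 - t)) ^ Suc p) * indicator {0..1 - h} t)"
    proof (cases "t \<in> {0..1 - h}")
      case True
      then have t: "0 \<le> t" "t < 1" using h by auto
      have "real (card B) * t ^ (card B - 1) \<le> real (Suc p) * 1"
        unfolding B(2) using t by (intro mult_left_mono power_le_one) auto
      then have "ennreal (card B * t ^ (card B - 1)) * ennreal (1 / (1 - t\<^sup>2) ^ Suc p)
          \<le> ennreal (Suc p) * ennreal ((1 / (1 - t)) ^ Suc p)"
        using hyp_density_le[OF t, of "Suc p"] by (intro mult_mono ennreal_leI) auto
      then show ?thesis using True h by (simp add: indicator_def)
    next
      case False
      then show ?thesis by (auto simp: indicator_def)
    qed
  qed simp
  also have "\<dots> = ?\<omega> * (ennreal (Suc p) * (\<integral>\<^sup>+t\<in>{0..1 - h}. ennreal ((1 / (1 - t)) ^ Suc p) \<partial>lborel))"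
  proof -
    have "(\<lambda>t. ennreal ((1 / (1 - t)) ^ Suc p) * indicator {0..1 - h} t) \<in> borel_measurable lborel"
      by measurable
    then show ?thesis by (simp only: nn_integral_cmult)
  qed
  also have "\<dots> \<le> ?\<omega> * (ennreal (Suc p) * ennreal ((1 / h) ^ p))"
    by (intro mult_left_mono nn_integral_inverse_power_le h p) auto
  also have "ennreal (Suc p) * ennreal ((1 / h) ^ p) = ennreal (Suc p * (1 / h) ^ p)"
    using h by (intro ennreal_mult[symmetric]) auto
  finally show ?thesis .
qed

text \<open>The shell of radii between \<open>1 - 2 * r\<close> and \<open>1 - r\<close> already has
  the right order: its thickness is \<open>r\<close>, its radii are at least 1/2, and the density
  there is at least \<open>(1 / (4 * r)) ^ Suc p\<close>.\<close>

lemma nn_integral_ball_density_ge: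
  fixes B :: "'a::euclidean_space set"
  assumes B: "orthonormal B" "card B = Suc p" and r: "0 < r" "r \<le> 1 / 4"
  shows "unit_ball_vol B * ennreal ((1 / 8) ^ Suc p * (1 / r) ^ p)
    \<le> hyp_integral (Suc p) B (cball 0 (1 - r))"
proof -
  let ?\<omega> = "unit_ball_vol B"
  let ?f = "\<lambda>t. ennreal (1 / (1 - t\<^sup>2) ^ Suc p) * indicator {..1 - r} t"
  have ne: "B \<noteq> {}" using B(2) by auto
  have "ennreal ((1 / 8) ^ Suc p * (1 / r) ^ p) = ennreal ((1 / 8) ^ Suc p * (1 / r) ^ Suc p) * ennreal r"
    using r by (subst ennreal_mult[symmetric]) auto
  also have "\<dots> = ennreal ((1 / 8) ^ Suc p * (1 / r) ^ Suc p) * (\<integral>\<^sup>+t. indicator {1 - 2 * r..1 - r} t \<partial>lborel)"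
    using r by (simp add: algebra_simps)
  also have "\<dots> = (\<integral>\<^sup>+t\<in>{1 - 2 * r..1 - r}. ennreal ((1 / 8) ^ Suc p * (1 / r) ^ Suc p) \<partial>lborel)"
    by (rule nn_integral_cmult[symmetric]) measurable
  also have "\<dots> \<le> (\<integral>\<^sup>+t\<in>{0..1}. ennreal (card B * t ^ (card B - 1)) * ?f t \<partial>lborel)"
  proof (rule nn_integral_mono)
    fix t :: real
    show "ennreal ((1 / 8) ^ Suc p * (1 / r) ^ Suc p) * indicator {1 - 2 * r..1 - r} t
        \<le> ennreal (card B * t ^ (card B - 1)) * ?f t * indicator {0..1} t"
    proof (cases "t \<in> {1 - 2 * r..1 - r}")
      case True
      then have t: "1 / 2 \<le> t" "t < 1" "1 - t \<le> 2 * r" using r by auto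
      have "(1 / 2) ^ p \<le> t ^ p" using t by (intro power_mono) auto
      moreover have "(1 / 2) ^ Suc p \<le> (1 / 2 :: real) ^ p" by (intro power_decreasing) auto
      moreover have "1 * t ^ p \<le> real (Suc p) * t ^ p" using t by (intro mult_right_mono) auto
      ultimately have 1: "(1 / 2) ^ Suc p \<le> real (Suc p) * t ^ p" by linarith
      have "1 / (4 * r) \<le> 1 / (2 * (1 - t))" using t r by (intro divide_left_mono) auto
      then have "(1 / (4 * r)) ^ Suc p \<le> (1 / (2 * (1 - t))) ^ Suc p" using r by (intro power_mono) auto
      also have "\<dots> \<le> 1 / (1 - t\<^sup>2) ^ Suc p" using t by (intro hyp_density_ge) auto
      finally have 2: "(1 / (4 * r)) ^ Suc p \<le> 1 / (1 - t\<^sup>2) ^ Suc p" .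
      have "(1 / 8) ^ Suc p * (1 / r) ^ Suc p = (1 / 2) ^ Suc p * (1 / (4 * r)) ^ Suc p"
        unfolding power_mult_distrib[symmetric] using r by simp
      also have "ennreal \<dots> = ennreal ((1 / 2) ^ Suc p) * ennreal ((1 / (4 * r)) ^ Suc p)"
        using r by (intro ennreal_mult) auto
      also have "\<dots> \<le> ennreal (Suc p * t ^ p) * ennreal (1 / (1 - t\<^sup>2) ^ Suc p)"
        using 1 2 by (intro mult_mono ennreal_leI) auto
      finally show ?thesis using True r B(2) by (simp add: indicator_def)
    qed simp
  qed
  finally have "ennreal ((1 / 8) ^ Suc p * (1 / r) ^ p)
      \<le> (\<integral>\<^sup>+t\<in>{0..1}. ennreal (card B * t ^ (card B - 1)) * ?f t \<partial>lborel)" .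
  then have "?\<omega> * ennreal ((1 / 8) ^ Suc p * (1 / r) ^ p)
      \<le> ?\<omega> * (\<integral>\<^sup>+t\<in>{0..1}. ennreal (card B * t ^ (card B - 1)) * ?f t \<partial>lborel)"
    by (rule mult_left_mono) simp
  also have "\<dots> = (\<integral>\<^sup>+x\<in>(cball 0 1). ?f (norm x) \<partial>frame_lborel B)"
    by (rule nn_integral_frame_radial[OF B(1) ne, symmetric]) measurable
  also have "\<dots> = hyp_integral (Suc p) B (cball 0 (1 - r))"
    using r by (intro nn_integral_cong) (auto simp: indicator_def)
  finally show ?thesis .
qed

text \<open>A segment of length 1 times a ball of radius 1/2 fits into the unit ball. The comparison
  is needed because cylindrical coordinates produce the unit ball of one dimension less than the
  section.\<close>

lemma emeasure_cball_insert_ge: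
  fixes e :: "'a::euclidean_space"
  assumes B: "orthonormal (insert e B)" "e \<notin> B" "B \<noteq> {}"
  shows "unit_ball_vol B \<le> ennreal (2 ^ card B) * unit_ball_vol (insert e B)"
proof -
  let ?\<kappa> = "unit_ball_vol B" and ?\<omega> = "unit_ball_vol (insert e B)"
  have B': "orthonormal B" using B(1) by (rule orthonormal_subset) auto
  have e: "norm e = 1" using B(1) by (simp add: orthonormal_def)
  have "ennreal ((1 / 2) ^ card B) * ?\<kappa> = emeasure (frame_lborel B) (cball 0 (1 / 2))"
    by (rule emeasure_frame_lborel_cball_scale[OF B' _ B(3), symmetric]) simp
  also have "\<dots> = (\<integral>\<^sup>+s\<in>{-1/2..1/2 :: real}. emeasure (frame_lborel B) (cball 0 (1 / 2)) \<partial>lborel)"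
    by (subst nn_integral_cmult) auto
  also have "\<dots> \<le> (\<integral>\<^sup>+s. \<integral>\<^sup>+y. indicator (cball 0 1) (s *\<^sub>R e + y) \<partial>frame_lborel B \<partial>lborel)"
  proof (rule nn_integral_mono)
    fix s :: real
    show "emeasure (frame_lborel B) (cball 0 (1 / 2)) * indicator {-1/2..1/2} s
        \<le> (\<integral>\<^sup>+y. indicator (cball 0 1) (s *\<^sub>R e + y) \<partial>frame_lborel B)"
    proof (cases "s \<in> {-1/2..1/2}")
      case True
      have "emeasure (frame_lborel B) (cball 0 (1 / 2)) = (\<integral>\<^sup>+y. indicator (cball 0 (1 / 2)) y \<partial>frame_lborel B)"
        by simp
      also have "\<dots> \<le> (\<integral>\<^sup>+y. indicator (cball 0 1) (s *\<^sub>R e + y) \<partial>frame_lborel B)"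
      proof (rule nn_integral_mono)
        fix y
        have "norm (s *\<^sub>R e + y) \<le> 1" if "norm y \<le> 1 / 2"
          using that True norm_triangle_ineq[of "s *\<^sub>R e" y] e by (auto simp: abs_le_iff)
        then show "indicator (cball 0 (1 / 2)) y \<le> (indicator (cball 0 1) (s *\<^sub>R e + y) :: ennreal)"
          by (auto simp: indicator_def)
      qed
      finally show ?thesis using True by simp
    qed simp
  qed
  also have "\<dots> = (\<integral>\<^sup>+x. indicator (cball 0 1) x \<partial>frame_lborel (insert e B))"
    by (rule nn_integral_frame_lborel_insert[OF B(1,2), symmetric])
      (intro borel_measurable_indicator, simp)
  also have "\<dots> = ?\<omega>" by simp
  finally have le: "ennreal ((1 / 2) ^ card B) * ?\<kappa> \<le> ?\<omega>" .
  have "?\<kappa> = ennreal (2 ^ card B) * (ennreal ((1 / 2) ^ card B) * ?\<kappa>)" proof -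
    have "ennreal (2 ^ card B) * ennreal ((1 / 2) ^ card B) = 1"
      by (subst ennreal_mult[symmetric]) (auto simp: power_mult_distrib[symmetric])
    then show ?thesis by (simp only: mult.assoc[symmetric] mult_1)
  qed
  also have "\<dots> \<le> ennreal (2 ^ card B) * ?\<omega>" by (rule mult_left_mono[OF le]) simp
  finally show ?thesis .
qed

text \<open>On the ray of slope \<open>t\<close> the norm is
  \<open>sqrt (1 + t ^ 2) * \<bar>s\<bar>\<close>, so the integral along it is at most that of
  \<open>(1 / (1 - u)) ^ Suc p\<close> up to depth \<open>H t\<close>, hence
  \<open>(1 / H t) ^ p\<close>. The Jacobian is at most \<open>p\<close> inside the unit ball, and
  the factor 2 counts both signs of \<open>s\<close>.\<close>

lemma nn_integral_profile_le:
  fixes e :: "'a::euclidean_space" and H :: "real \<Rightarrow> real"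
  assumes B: "orthonormal (insert e B)" "e \<notin> B" "card B = p" and p: "1 \<le> p"
    and [measurable]: "H \<in> borel_measurable borel" and H: "\<And>t. 0 < H t" "\<And>t. H t \<le> 1"
  defines "S \<equiv> {x. x \<bullet> e \<noteq> 0 \<and> axis_dist e x \<le> \<bar>x \<bullet> e\<bar>
      \<and> norm x \<le> 1 - H (axis_dist e x / \<bar>x \<bullet> e\<bar>)}"
  shows "hyp_integral (Suc p) (insert e B) S
    \<le> unit_ball_vol B * (ennreal (2 * p) *
      (\<integral>\<^sup>+t\<in>{0..1}. ennreal ((1 / H t) ^ p) \<partial>lborel))"
proof -
  let ?\<kappa> = "unit_ball_vol B"
  define G where "G s r = (if s \<noteq> 0 \<and> r \<le> \<bar>s\<bar> \<and> sqrt (s\<^sup>2 + r\<^sup>2) \<le> 1 - H (r / \<bar>s\<bar>)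
      then ennreal ((1 / (1 - sqrt (s\<^sup>2 + r\<^sup>2))) ^ Suc p) else 0)" for s r
  have G [measurable]: "case_prod G \<in> borel_measurable (borel \<Otimes>\<^sub>M borel)"
    unfolding G_def by measurable
  have ne: "B \<noteq> {}" using B(3) p by auto
  have e: "norm e = 1" using B(1) by (simp add: orthonormal_def)
  have nx: "sqrt ((x \<bullet> e)\<^sup>2 + (axis_dist e x)\<^sup>2) = norm x" for x
    unfolding norm_diff_projection[OF e] by simp
  have "hyp_integral (Suc p) (insert e B) S
      \<le> cyl_integral G e B"
  proof (rule nn_integral_mono)
    fix x
    show "ennreal (hyp_density (Suc p) x) * indicator S x
        \<le> G (x \<bullet> e) (axis_dist e x) * indicator {..1} (axis_dist e x)"
    proof (cases "x \<in> S")
      case True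
      then have S: "x \<bullet> e \<noteq> 0" "axis_dist e x \<le> \<bar>x \<bullet> e\<bar>"
          "norm x \<le> 1 - H (axis_dist e x / \<bar>x \<bullet> e\<bar>)"
        unfolding S_def by auto
      then have x1: "norm x < 1" using H(1)[of "axis_dist e x / \<bar>x \<bullet> e\<bar>"] by linarith
      have "(axis_dist e x)\<^sup>2 \<le> (norm x)\<^sup>2" unfolding norm_diff_projection[OF e] by simp
      then have "axis_dist e x \<le> norm x" by (rule power2_le_imp_le) simp
      then have "axis_dist e x \<le> 1" using x1 by linarith
      moreover have "G (x \<bullet> e) (axis_dist e x) = ennreal ((1 / (1 - norm x)) ^ Suc p)"
        unfolding G_def nx using S by simp
      ultimately show ?thesis using True hyp_density_le[OF _ x1, of "Suc p"] by (simp add: ennreal_leI)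
    qed simp
  qed
  also have "\<dots> = ?\<kappa> * slope_integral (card B) G"
    by (rule nn_integral_slope[OF B(1,2) ne G])
  also have "\<dots> \<le> ?\<kappa> * (\<integral>\<^sup>+t. ennreal (2 * p) * (ennreal ((1 / H t) ^ p) * indicator {0..1} t) \<partial>lborel)"
  proof (intro mult_left_mono nn_integral_mono)
    fix t :: real
    let ?K = "\<lambda>s. slope_integrand (card B) G s t"
    let ?g = "\<lambda>u. ennreal ((1 / (1 - u)) ^ Suc p) * indicator {0..1 - H t} u"
    define c where "c = sqrt (1 + t\<^sup>2)"
    have c: "1 \<le> c" by (simp add: c_def)
    have le: "?K s \<le> ennreal p * indicator {0..1} t * (?g (0 + c * s) + ?g (0 + (- c) * s))" for s
    proof (cases "G s (\<bar>s\<bar> * t) \<noteq> 0 \<and> \<bar>s\<bar> * t \<in> {0..1}")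
      case True
      have s0: "s \<noteq> 0" and t1: "\<bar>s\<bar> * t \<le> \<bar>s\<bar>" and le: "sqrt (s\<^sup>2 + (\<bar>s\<bar> * t)\<^sup>2) \<le> 1 - H (\<bar>s\<bar> * t / \<bar>s\<bar>)"
        using True unfolding G_def by (auto split: if_splits)
      have "\<bar>s\<bar> * t \<le> \<bar>s\<bar> * 1" "0 \<le> \<bar>s\<bar> * t" using t1 True by auto
      then have t: "0 \<le> t" "t \<le> 1" using s0 by (simp_all add: zero_le_mult_iff)
      have "s\<^sup>2 + (\<bar>s\<bar> * t)\<^sup>2 = s\<^sup>2 * (1 + t\<^sup>2)"
        by (simp add: power_mult_distrib algebra_simps)
      then have sq: "sqrt (s\<^sup>2 + (\<bar>s\<bar> * t)\<^sup>2) = c * \<bar>s\<bar>"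
        by (simp add: real_sqrt_mult c_def)
      have le': "c * \<bar>s\<bar> \<le> 1 - H t" using le s0 unfolding sq by simp
      have "1 * \<bar>s\<bar> \<le> c * \<bar>s\<bar>" using c by (intro mult_right_mono) auto
      then have s1: "\<bar>s\<bar> \<le> 1" using le' H(1)[of t] by linarith
      have "\<bar>s\<bar> * t \<le> 1" using True by simp
      then have "real (card B) * (\<bar>s\<bar> * t) ^ (card B - 1) \<le> real (card B) * 1"
        using t by (intro mult_left_mono power_le_one) auto
      then have "ennreal \<bar>s\<bar> * ennreal (card B * (\<bar>s\<bar> * t) ^ (card B - 1)) \<le> ennreal 1 * ennreal p"
        using s1 B(3) by (intro mult_mono ennreal_leI) auto
      then have Kle: "?K s \<le> ennreal p * G s (\<bar>s\<bar> * t)"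
        using True by (simp add: mult.assoc[symmetric] mult_right_mono)
      have "G s (\<bar>s\<bar> * t) = ennreal ((1 / (1 - c * \<bar>s\<bar>)) ^ Suc p)"
        unfolding G_def sq using s0 t1 le' by simp
      also have "\<dots> \<le> ?g (0 + c * s) + ?g (0 + (- c) * s)"
        using le' c mult_nonneg_nonpos[of c s] by (cases "0 \<le> s") (auto simp: indicator_def zero_le_mult_iff)
      finally have "G s (\<bar>s\<bar> * t) \<le> ?g (0 + c * s) + ?g (0 + (- c) * s)" .
      then have "ennreal p * G s (\<bar>s\<bar> * t) \<le> ennreal p * (?g (0 + c * s) + ?g (0 + (- c) * s))"
        by (rule mult_left_mono) simp
      with Kle have "?K s \<le> ennreal p * (?g (0 + c * s) + ?g (0 + (- c) * s))" by (rule order_trans)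
      moreover have "indicator {0..1} t = (1 :: ennreal)" using t by simp
      ultimately show ?thesis by (simp only: mult_1_right)
    next
      case False
      then have "?K s = 0" by (auto simp: indicator_def)
      then show ?thesis by (simp only: zero_le)
    qed
    have half: "(\<integral>\<^sup>+s. ?g (0 + c' * s) \<partial>lborel) \<le> ennreal ((1 / H t) ^ p)" if c': "1 \<le> \<bar>c'\<bar>" for c'
    proof -
      have "1 * (\<integral>\<^sup>+s. ?g (0 + c' * s) \<partial>lborel) \<le> ennreal \<bar>c'\<bar> * (\<integral>\<^sup>+s. ?g (0 + c' * s) \<partial>lborel)"
        using c' by (intro mult_right_mono) (auto simp: ennreal_leI[of 1, simplified])
      also have "\<dots> = (\<integral>\<^sup>+u. ?g u \<partial>lborel)"
        by (rule nn_integral_real_affine[symmetric]) (use c' in auto)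
      also have "\<dots> \<le> ennreal ((1 / H t) ^ p)" by (rule nn_integral_inverse_power_le[OF H p])
      finally show ?thesis by simp
    qed
    have "(\<integral>\<^sup>+s. ?K s \<partial>lborel) \<le> (\<integral>\<^sup>+s. ennreal p * indicator {0..1} t * (?g (0 + c * s) + ?g (0 + (- c) * s)) \<partial>lborel)"
      by (rule nn_integral_mono, rule le)
    also have "\<dots> = ennreal p * indicator {0..1} t * (\<integral>\<^sup>+s. ?g (0 + c * s) + ?g (0 + (- c) * s) \<partial>lborel)"
      by (rule nn_integral_cmult) measurable
    also have "(\<integral>\<^sup>+s. ?g (0 + c * s) + ?g (0 + (- c) * s) \<partial>lborel)
        = (\<integral>\<^sup>+s. ?g (0 + c * s) \<partial>lborel) + (\<integral>\<^sup>+s. ?g (0 + (- c) * s) \<partial>lborel)"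
      by (rule nn_integral_add) measurable
    also have "ennreal p * indicator {0..1} t * \<dots>
        \<le> ennreal p * indicator {0..1} t * (ennreal ((1 / H t) ^ p) + ennreal ((1 / H t) ^ p))"
      using c by (intro mult_left_mono add_mono half) auto
    also have "\<dots> = ennreal (2 * p) * (ennreal ((1 / H t) ^ p) * indicator {0..1} t)" proof -
      have "ennreal (2 * p) = ennreal p + ennreal p" by (subst ennreal_plus[symmetric]) auto
      then show ?thesis by (simp add: indicator_def distrib_left distrib_right)
    qed
    finally show "(\<integral>\<^sup>+s. ?K s \<partial>lborel) \<le> ennreal (2 * p) * (ennreal ((1 / H t) ^ p) * indicator {0..1} t)" .
  qed simp
  also have "(\<integral>\<^sup>+t. ennreal (2 * p) * (ennreal ((1 / H t) ^ p) * indicator {0..1} t) \<partial>lborel)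
      = ennreal (2 * p) * (\<integral>\<^sup>+t\<in>{0..1}. ennreal ((1 / H t) ^ p) \<partial>lborel)"
    by (rule nn_integral_cmult) measurable
  finally show ?thesis .
qed

text \<open>Only depths between \<open>h t\<close> and \<open>2 * h t\<close> are kept. For these
  slopes \<open>sqrt (1 + t ^ 2) \<le> 5 / 4\<close>, so the kept range of heights has length at
  least \<open>4 / 5 * h t\<close>, and there \<open>s \<ge> 2 / 5\<close> and
  \<open>s * t \<ge> 1 / 5\<close>; this is the origin of the powers of 1/5.\<close>

lemma nn_integral_profile_ge:
  fixes e :: "'a::euclidean_space" and h :: "real \<Rightarrow> real"
  assumes B: "orthonormal (insert e B)" "e \<notin> B" "card B = p" and p: "1 \<le> p"
    and [measurable]: "h \<in> borel_measurable borel" and h: "\<And>t. 0 < h t" "\<And>t. h t \<le> 1 / 4"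
  defines "S \<equiv> {x. 0 < x \<bullet> e \<and> axis_dist e x / (x \<bullet> e) \<in> {1 / 2..3 / 4}
      \<and> norm x \<le> 1 - h (axis_dist e x / (x \<bullet> e))}"
  shows "unit_ball_vol B * (ennreal ((1 / 5) ^ Suc p) *
      (\<integral>\<^sup>+t\<in>{1 / 2..3 / 4}. ennreal ((1 / (4 * h t)) ^ p) \<partial>lborel))
    \<le> hyp_integral (Suc p) (insert e B) S"
proof -
  let ?\<kappa> = "unit_ball_vol B"
  define G where "G s r = (if 0 < s \<and> r / s \<in> {1 / 2..3 / 4} \<and> 1 - 2 * h (r / s) \<le> sqrt (s\<^sup>2 + r\<^sup>2)
      \<and> sqrt (s\<^sup>2 + r\<^sup>2) \<le> 1 - h (r / s) then ennreal ((1 / (4 * h (r / s))) ^ Suc p) else 0)" for s r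
  have G [measurable]: "case_prod G \<in> borel_measurable (borel \<Otimes>\<^sub>M borel)"
    unfolding G_def atLeastAtMost_iff by measurable
  have ne: "B \<noteq> {}" using B(3) p by auto
  have e: "norm e = 1" using B(1) by (simp add: orthonormal_def)
  have nx: "sqrt ((x \<bullet> e)\<^sup>2 + (axis_dist e x)\<^sup>2) = norm x" for x
    unfolding norm_diff_projection[OF e] by simp
  have "ennreal ((1 / 5) ^ Suc p) * (\<integral>\<^sup>+t\<in>{1 / 2..3 / 4}. ennreal ((1 / (4 * h t)) ^ p) \<partial>lborel)
      = (\<integral>\<^sup>+t. ennreal ((1 / 5) ^ Suc p) * (ennreal ((1 / (4 * h t)) ^ p) * indicator {1 / 2..3 / 4} t) \<partial>lborel)"
    by (rule nn_integral_cmult[symmetric]) measurable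
  also have "\<dots> \<le> slope_integral (card B) G"
  proof (rule nn_integral_mono)
    fix t :: real
    let ?K = "\<lambda>s. slope_integrand (card B) G s t"
    show "ennreal ((1 / 5) ^ Suc p) * (ennreal ((1 / (4 * h t)) ^ p) * indicator {1 / 2..3 / 4} t) \<le> (\<integral>\<^sup>+s. ?K s \<partial>lborel)"
    proof (cases "t \<in> {1 / 2..3 / 4}")
      case True
      then have t: "1 / 2 \<le> t" "t \<le> 3 / 4" by auto
      define c where "c = sqrt (1 + t\<^sup>2)"
      have "t\<^sup>2 \<le> (3 / 4)\<^sup>2" using t by (intro power_mono) auto
      then have "1 + t\<^sup>2 \<le> (5 / 4)\<^sup>2" by (simp add: power2_eq_square)
      then have c: "1 \<le> c" "c \<le> 5 / 4"
        unfolding c_def using real_sqrt_le_mono[of "1 + t\<^sup>2" "(5 / 4)\<^sup>2"] by auto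
      let ?l = "(1 - 2 * h t) / c" and ?u = "(1 - h t) / c"
      have lu: "?l \<le> ?u" using c h(1)[of t] by (intro divide_right_mono) auto
      have len: "4 / 5 * h t \<le> ?u - ?l" proof -
        have "?u - ?l = h t / c" by (simp add: diff_divide_distrib[symmetric])
        moreover have "h t / (5 / 4) \<le> h t / c" using c h(1)[of t] by (intro divide_left_mono) auto
        ultimately show ?thesis by simp
      qed
      have K: "ennreal ((1 / 5) ^ p * (1 / (4 * h t)) ^ Suc p) * indicator {?l..?u} s \<le> ?K s" for s
      proof (cases "s \<in> {?l..?u}")
        case True
        then have sc: "1 - 2 * h t \<le> c * s" "c * s \<le> 1 - h t" using c by (auto simp: field_simps)
        have "1 / 2 \<le> c * s" using sc h(2)[of t] by linarith
        moreover have s0: "0 < s"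
          using calculation c by (metis less_le_trans zero_less_divide_1_iff zero_less_numeral mult_le_0_iff not_le order_trans zero_le_one)
        moreover have "c * s \<le> 5 / 4 * s" using c s0 by (intro mult_right_mono) auto
        ultimately have s: "2 / 5 \<le> s" by linarith
        have "1 * s \<le> c * s" using c s0 by (intro mult_right_mono) auto
        then have s1: "s \<le> 1" using sc h(1)[of t] by linarith
        have "2 / 5 * (1 / 2) \<le> s * t" using s t by (intro mult_mono) auto
        then have st: "1 / 5 \<le> s * t" by simp
        have st1: "s * t \<le> 1" using mult_mono[of s 1 t 1] s1 s0 t by simp
        have "(1 / 5) ^ p = (1 / 5 :: real) * (1 / 5) ^ (p - 1)" using p by (cases p) auto
        also have "\<dots> \<le> s * (s * t) ^ (p - 1)" using s st by (intro mult_mono power_mono) auto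
        also have "\<dots> \<le> s * (real p * (s * t) ^ (p - 1))"
          using s0 st p mult_right_mono[of 1 "real p" "(s * t) ^ (p - 1)"] by (intro mult_left_mono) auto
        finally have w: "(1 / 5) ^ p \<le> s * (real p * (s * t) ^ (p - 1))" .
        have "s\<^sup>2 + (s * t)\<^sup>2 = s\<^sup>2 * (1 + t\<^sup>2)"
          by (simp add: power_mult_distrib algebra_simps)
        then have sq: "sqrt (s\<^sup>2 + (s * t)\<^sup>2) = c * s"
          using s0 by (simp add: real_sqrt_mult c_def)
        have g: "G s (s * t) = ennreal ((1 / (4 * h t)) ^ Suc p)" unfolding G_def sq using s0 t sc by simp
        have "ennreal ((1 / 5) ^ p * (1 / (4 * h t)) ^ Suc p) = ennreal ((1 / 5) ^ p) * ennreal ((1 / (4 * h t)) ^ Suc p)"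
          using h(1)[of t] by (intro ennreal_mult) (auto simp: less_imp_le)
        also have "\<dots> \<le> ennreal (s * (real p * (s * t) ^ (p - 1))) * ennreal ((1 / (4 * h t)) ^ Suc p)"
          using w by (intro mult_right_mono ennreal_leI) auto
        also have "ennreal (s * (real p * (s * t) ^ (p - 1))) = ennreal s * ennreal (real p * (s * t) ^ (p - 1))"
          using s0 t by (intro ennreal_mult) auto
        finally show ?thesis using True s0 st st1 g B(3) by (simp add: mult.assoc)
      qed simp
      have "ennreal ((1 / 5) ^ Suc p) * (ennreal ((1 / (4 * h t)) ^ p) * indicator {1 / 2..3 / 4} t)
          = ennreal ((1 / 5) ^ Suc p * (1 / (4 * h t)) ^ p)"
        using True h(1)[of t] by (subst ennreal_mult) (auto simp: less_imp_le)
      also have "(1 / 5) ^ Suc p * (1 / (4 * h t)) ^ p = ((1 / 5) ^ p * (1 / (4 * h t)) ^ Suc p) * (4 / 5 * h t)"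
        using h(1)[of t] by simp
      also have "ennreal \<dots> \<le> ennreal (((1 / 5) ^ p * (1 / (4 * h t)) ^ Suc p) * (?u - ?l))"
        using len h(1)[of t] by (intro ennreal_leI mult_left_mono) (auto simp: less_imp_le)
      also have "\<dots> = ennreal ((1 / 5) ^ p * (1 / (4 * h t)) ^ Suc p) * emeasure lborel {?l..?u}"
        using lu h(1)[of t] by (subst ennreal_mult) (auto simp: less_imp_le)
      also have "\<dots> = (\<integral>\<^sup>+s\<in>{?l..?u}. ennreal ((1 / 5) ^ p * (1 / (4 * h t)) ^ Suc p) \<partial>lborel)"
        by (rule nn_integral_cmult_indicator[symmetric]) simp
      also have "\<dots> \<le> (\<integral>\<^sup>+s. ?K s \<partial>lborel)"
        by (rule nn_integral_mono, rule K)
      finally show ?thesis .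
    qed simp
  qed
  finally have "?\<kappa> * (ennreal ((1 / 5) ^ Suc p) * (\<integral>\<^sup>+t\<in>{1 / 2..3 / 4}. ennreal ((1 / (4 * h t)) ^ p) \<partial>lborel))
      \<le> ?\<kappa> * slope_integral (card B) G"
    by (rule mult_left_mono) simp
  also have "\<dots> = cyl_integral G e B"
    by (rule nn_integral_slope[OF B(1,2) ne G, symmetric])
  also have "\<dots> \<le> hyp_integral (Suc p) (insert e B) S"
  proof (rule nn_integral_mono)
    fix x
    let ?t = "axis_dist e x / (x \<bullet> e)"
    show "G (x \<bullet> e) (axis_dist e x) * indicator {..1} (axis_dist e x)
        \<le> ennreal (hyp_density (Suc p) x) * indicator S x"
    proof (cases "0 < x \<bullet> e \<and> ?t \<in> {1 / 2..3 / 4} \<and> 1 - 2 * h ?t \<le> norm x \<and> norm x \<le> 1 - h ?t")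
      case True
      then have x1: "norm x < 1" using h(1)[of ?t] by linarith
      have "x \<in> S" using True unfolding S_def by blast
      have "1 / (4 * h ?t) \<le> 1 / (2 * (1 - norm x))"
        using True x1 h(1)[of ?t] by (intro divide_left_mono mult_pos_pos) auto
      then have "(1 / (4 * h ?t)) ^ Suc p \<le> (1 / (2 * (1 - norm x))) ^ Suc p"
        using h(1)[of ?t] by (intro power_mono) (auto simp: less_imp_le)
      also have "\<dots> \<le> hyp_density (Suc p) x" by (rule hyp_density_ge[OF norm_ge_zero x1])
      finally have le: "ennreal ((1 / (4 * h ?t)) ^ Suc p) \<le> ennreal (hyp_density (Suc p) x)"
        by (rule ennreal_leI)
      have "G (x \<bullet> e) (axis_dist e x) * indicator {..1} (axis_dist e x)
          \<le> ennreal ((1 / (4 * h ?t)) ^ Suc p) * 1"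
        unfolding G_def nx by (intro mult_mono) (auto simp: indicator_def)
      with le \<open>x \<in> S\<close> show ?thesis
        by simp
    next
      case False
      then have "G (x \<bullet> e) (axis_dist e x) = 0" unfolding G_def nx by (simp only: if_False)
      then show ?thesis by simp
    qed
  qed
  finally show ?thesis .
qed

section \<open>The counterexample\<close>

text \<open>\<open>e'\<close> is the direction of the orthogonal projection \<open>w\<close> of the
  axis to \<open>V\<close>, and \<open>a\<close> is the length of \<open>w\<close>; on
  \<open>V\<close> the inner products with \<open>e\<close> and with \<open>w\<close> agree.\<close>

lemma adapted_orthonormal_basis:
  fixes e :: "'a::euclidean_space"
  assumes e: "norm e = 1" and V: "subspace V" "dim V = Suc p"
  obtains e' B a where "orthonormal (insert e' B)" "e' \<notin> B" "card B = p" "span (insert e' B) = V"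
    "0 \<le> a" "a \<le> 1" "\<And>x. x \<in> V \<Longrightarrow> x \<bullet> e = a * (x \<bullet> e')"
proof -
  obtain D where D: "D \<subseteq> V" "pairwise orthogonal D" "\<And>x. x \<in> D \<Longrightarrow> norm x = 1"
      "independent D" "card D = dim V" "span D = V"
    using orthonormal_basis_subspace[OF V(1)] by metis
  have oD: "orthonormal D" using D by (simp add: orthonormal_def)
  define w where "w = (\<Sum>b\<in>D. (e \<bullet> b) *\<^sub>R b)"
  have wV: "w \<in> V" unfolding w_def using D(1) V(1) by (intro subspace_sum subspace_scale) auto
  have xw: "x \<bullet> e = x \<bullet> w" if "x \<in> V" for x proof -
    have "x \<bullet> e = (\<Sum>b\<in>D. (x \<bullet> b) *\<^sub>R b) \<bullet> e"
      using orthonormal_expansion[OF oD, of x] that D(6) by simp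
    also have "\<dots> = x \<bullet> w"
      unfolding w_def by (simp add: inner_sum_left inner_sum_right inner_commute mult.commute)
    finally show ?thesis .
  qed
  have w1: "norm w \<le> 1" proof -
    have "norm w * norm w = w \<bullet> e"
      using xw[OF wV] by (simp add: power2_eq_square flip: power2_norm_eq_inner)
    also have "\<dots> \<le> norm w * 1" using norm_cauchy_schwarz[of w e] e by simp
    finally show ?thesis by (cases "w = 0") auto
  qed
  obtain e' where e': "e' \<in> V" "norm e' = 1" "w = norm w *\<^sub>R e'"
  proof (cases "w = 0")
    \<comment> \<open>For a subspace orthogonal to the axis any unit vector serves, with
      \<open>a = 0\<close>.\<close>
    case True
    have "D \<noteq> {}" using D(5) V(2) by auto
    then show ?thesis using that D(1,3) True by auto
  next
    case False
    show ?thesis using that[of "w /\<^sub>R norm w"] wV V(1) False by (simp add: subspace_scale)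
  qed
  have e'1: "e' \<bullet> e' = 1" using e' by (simp add: norm_eq_1)
  let ?V = "V \<inter> {x. e' \<bullet> x = 0}"
  have "subspace ?V" by (rule subspace_inter[OF V(1) subspace_hyperplane])
  then obtain B where B: "B \<subseteq> ?V" "pairwise orthogonal B" "\<And>x. x \<in> B \<Longrightarrow> norm x = 1"
      "span B = ?V"
    using orthonormal_basis_subspace by metis
  have nB: "e' \<notin> B" using B(1) e'1 by auto
  have oB: "orthonormal (insert e' B)" unfolding orthonormal_def pairwise_insert using B e'(2)
    by (auto simp: orthogonal_def inner_commute)
  have sp: "span (insert e' B) = V"
  proof
    show "span (insert e' B) \<subseteq> V" using B(1) e'(1) V(1) by (intro span_minimal) auto
    show "V \<subseteq> span (insert e' B)"
    proof
      fix x assume x: "x \<in> V"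
      have "x - (e' \<bullet> x) *\<^sub>R e' \<in> ?V"
        using x e'(1) V(1) e'1 by (auto simp: inner_diff_right intro!: subspace_diff subspace_scale)
      then have "x - (e' \<bullet> x) *\<^sub>R e' \<in> span B" using B(4) by simp
      then show "x \<in> span (insert e' B)" by (auto simp: span_insert)
    qed
  qed
  have "card (insert e' B) = Suc p"
    using orthonormal_independent[OF oB] sp V(2) by (metis dim_eq_card_independent dim_span)
  then have "card B = p" using nB orthonormal_finite[OF oB] by simp
  moreover have "x \<bullet> e = norm w * (x \<bullet> e')" if "x \<in> V" for x
    unfolding xw[OF that] by (subst e'(3)) simp
  ultimately show ?thesis using that[of e' B "norm w"] oB nB sp w1 by simp
qed

section \<open>Sections and volume of the ridged body\<close>

lemma borel_measurable_arccos_cone: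
  assumes "0 \<le> a" "a \<le> 1"
  shows "(\<lambda>t. cone_angle a t) \<in> borel_measurable borel"
proof (rule borel_measurable_continuous_onI)
  have pos: "0 < sqrt (1 + t\<^sup>2)" for t :: real by (simp add: add_pos_nonneg)
  have "a / sqrt (1 + t\<^sup>2) \<le> 1" for t
    using assms pos[of t] order_trans[of a 1 "sqrt (1 + t\<^sup>2)"] by simp
  moreover have "- 1 \<le> a / sqrt (1 + t\<^sup>2)" for t
    using assms pos[of t] by (simp add: order_trans[of "- 1" 0])
  moreover have "continuous_on UNIV (\<lambda>t. a / sqrt (1 + t\<^sup>2))"
    using pos by (intro continuous_intros) (auto simp: less_imp_neq[symmetric])
  ultimately show "continuous_on UNIV (\<lambda>t. cone_angle a t)" by (intro continuous_on_arccos) auto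
qed

text \<open>From colatitude \<open>pi / 4\<close> on the depth is at least
  \<open>\<beta> / 3\<close>, so a point of smaller depth lies within 45 degrees of the axis. This
  forces \<open>a \<ge> sqrt 2 / 2\<close>, and since
  \<open>\<bar>x \<bullet> e\<bar> \<le> \<bar>x \<bullet> e'\<bar>\<close> the slope inside the
  section is at most 1. The colatitude is then the cone angle at that slope.\<close>

lemma ridged_body_profile:
  fixes e e' x :: "'a::euclidean_space"
  assumes e: "norm e = 1" and e': "norm e' = 1" and a: "0 \<le> a" "a \<le> 1" and xe: "x \<bullet> e = a * (x \<bullet> e')"
    and \<beta>: "0 < \<beta>" "\<beta> \<le> 1 / 4" and d: "0 < d"
    and x: "x \<in> ridged_body e \<beta> d" "x \<notin> cball 0 (1 - \<beta> / 3)"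
  defines "t \<equiv> axis_dist e' x / \<bar>x \<bullet> e'\<bar>"
  shows "7 / 10 \<le> a" "x \<bullet> e' \<noteq> 0" "axis_dist e' x \<le> \<bar>x \<bullet> e'\<bar>"
    "norm x \<le> 1 - \<beta> / 3 * sqrt (d + tri (cone_angle a t / \<beta>))"
proof -
  let ?s = "\<bar>x \<bullet> e'\<bar>" and ?y = "axis_dist e' x"
  obtain \<phi> where \<phi>: "0 \<le> \<phi>" "\<phi> \<le> pi / 2" "\<bar>x \<bullet> e\<bar> = norm x * cos \<phi>"
    using exists_colatitude[OF e] by metis
  have big: "1 - \<beta> / 3 < norm x" using x(2) by simp
  then have \<phi>4: "\<phi> < pi / 4" using ridged_body_depth(2)[OF e \<phi> \<beta> d x(1)] by linarith
  have depth: "\<beta> / 3 * sqrt (d + tri (\<phi> / \<beta>)) \<le> 1 - norm x"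
    using ridged_body_depth(1)[OF e \<phi> \<beta> d x(1)] \<phi>4 by simp
  have n0: "0 < norm x" using big \<beta> by linarith
  have "cos (pi / 4) \<le> cos \<phi>" using \<phi> \<phi>4 pi_gt_zero by (intro cos_monotone_0_pi_le) auto
  then have c: "sqrt 2 / 2 \<le> cos \<phi>" by (simp add: cos_45)
  have as: "a * ?s = norm x * cos \<phi>" using \<phi>(3) a unfolding xe by (simp add: abs_mult)
  have sn: "?s \<le> norm x" using Cauchy_Schwarz_ineq2[of x e'] e' by simp
  have "norm x * (sqrt 2 / 2) \<le> a * ?s" unfolding as using c by (intro mult_left_mono) auto
  moreover have "a * ?s \<le> a * norm x" using sn a by (intro mult_left_mono)
  ultimately have "norm x * (sqrt 2 / 2) \<le> norm x * a" by (simp add: mult.commute)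
  then have "sqrt 2 / 2 \<le> a" using n0 by (simp only: mult_le_cancel_left_pos)
  moreover have "7 / 5 \<le> sqrt 2" by (rule real_le_rsqrt) (simp add: power2_eq_square)
  ultimately show "7 / 10 \<le> a" by simp
  have "a * ?s \<le> 1 * ?s" using a by (intro mult_right_mono) auto
  then have ns: "norm x * (sqrt 2 / 2) \<le> ?s"
    using \<open>norm x * (sqrt 2 / 2) \<le> a * ?s\<close> by simp
  moreover have "0 < norm x * (sqrt 2 / 2)" using n0 by simp
  ultimately have s0: "0 < ?s" by linarith
  then show "x \<bullet> e' \<noteq> 0" by simp
  have "(norm x * (sqrt 2 / 2))\<^sup>2 \<le> ?s\<^sup>2" using ns n0 by (intro power_mono) auto
  then have "(norm x)\<^sup>2 \<le> 2 * ?s\<^sup>2" by (simp add: power_mult_distrib power_divide)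
  then have "?y\<^sup>2 \<le> ?s\<^sup>2" unfolding norm_diff_projection[OF e'] by simp
  then show "?y \<le> ?s" by (rule power2_le_imp_le) simp
  have "1 + t\<^sup>2 = (norm x / ?s)\<^sup>2"
    unfolding t_def power_divide norm_diff_projection[OF e'] using s0 by (simp add: diff_divide_distrib)
  then have "sqrt (1 + t\<^sup>2) = norm x / ?s" using s0 by simp
  then have "a / sqrt (1 + t\<^sup>2) = a * ?s / norm x" by simp
  also have "\<dots> = cos \<phi>" unfolding as using n0 by simp
  finally have "cone_angle a t = \<phi>" using \<phi> pi_gt_zero by (simp add: arccos_cos)
  then show "norm x \<le> 1 - \<beta> / 3 * sqrt (d + tri (cone_angle a t / \<beta>))" using depth by simp
qed

lemma ridged_body_borel [measurable]: "ridged_body e \<beta> d \<in> sets borel"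
  by (rule borel_closed[OF closed_ridged_body])

text \<open>The part of the body in the ball of radius \<open>1 - \<beta> / 3\<close> yields the
  summand \<open>Suc p\<close>; the remaining part is governed by the depth profile and
  equidistribution.\<close>

lemma nn_integral_ridged_body_le:
  fixes e :: "'a::euclidean_space"
  assumes e: "norm e = 1" and B: "orthonormal (insert e' B)" "e' \<notin> B" "card B = p" and p: "1 \<le> p"
    and a: "0 \<le> a" "a \<le> 1" and xe: "\<And>x. x \<in> span (insert e' B) \<Longrightarrow> x \<bullet> e = a * (x \<bullet> e')"
    and \<beta>: "0 < \<beta>" "\<beta> \<le> 1 / 12" and d: "0 < d" "d \<le> 1"
  shows "hyp_integral (Suc p) (insert e' B) (ridged_body e \<beta> d)
    \<le> unit_ball_vol (insert e' B) * ennreal ((3 / \<beta>) ^ p *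
      (Suc p + 2 ^ p * (2 * real p) * (sqrt (12 * \<beta>) * (1 / sqrt d) ^ p + 4 * enn2real (ridge_integral p d))))"
proof -
  let ?M = "frame_lborel (insert e' B)"
  let ?\<omega> = "emeasure ?M (cball 0 1)" and ?\<kappa> = "unit_ball_vol B"
  let ?W = "\<lambda>x. ennreal (hyp_density (Suc p) x)"
  let ?I = "ridge_integral p d"
  define H where "H t = \<beta> / 3 * sqrt (d + tri (cone_angle a t / \<beta>))" for t
  define S where "S = {x. x \<bullet> e' \<noteq> 0 \<and> axis_dist e' x \<le> \<bar>x \<bullet> e'\<bar>
      \<and> norm x \<le> 1 - H (axis_dist e' x / \<bar>x \<bullet> e'\<bar>)}"
  \<comment> \<open>A section with \<open>a < 7 / 10\<close> has no points outside the inner ball,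
    and the equidistribution estimate is available exactly for the other sections.\<close>
  define T where "T = (if 7 / 10 \<le> a then S else {})"
  have e': "norm e' = 1" using B(1) by (simp add: orthonormal_def)
  have ne: "B \<noteq> {}" using B(3) p by auto
  have [measurable]: "H \<in> borel_measurable borel"
    unfolding H_def using borel_measurable_arccos_cone[OF a, measurable] by measurable
  have H: "0 < H t" "H t \<le> 1" for t proof -
    let ?u = "tri (cone_angle a t / \<beta>)"
    show "0 < H t" unfolding H_def using \<beta> d tri_bounds[of "cone_angle a t / \<beta>"] by simp
    have "sqrt (d + ?u) \<le> sqrt 4"
      using d tri_bounds[of "cone_angle a t / \<beta>"] by (intro real_sqrt_le_mono) auto
    then have "\<beta> / 3 * sqrt (d + ?u) \<le> (1 / 12) / 3 * 2"
      using \<beta> d tri_bounds[of "cone_angle a t / \<beta>"] by (intro mult_mono) auto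
    then show "H t \<le> 1" by (simp add: H_def)
  qed
  have Sm [measurable]: "S \<in> sets borel" unfolding S_def by measurable
  have Tm: "T \<in> sets borel" unfolding T_def by simp
  have [measurable]: "(indicator T :: 'a \<Rightarrow> ennreal) \<in> borel_measurable borel"
      "(indicator (cball 0 (1 - \<beta> / 3)) :: 'a \<Rightarrow> ennreal) \<in> borel_measurable borel"
    by (intro borel_measurable_indicator Tm borel_closed closed_cball)+
  have "(\<integral>\<^sup>+x. ?W x * indicator (ridged_body e \<beta> d) x \<partial>?M)
      \<le> (\<integral>\<^sup>+x. ?W x * indicator (cball 0 (1 - \<beta> / 3)) x + ?W x * indicator T x \<partial>?M)"
  proof (rule nn_integral_mono_AE)
    show "AE x in ?M. ?W x * indicator (ridged_body e \<beta> d) x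
        \<le> ?W x * indicator (cball 0 (1 - \<beta> / 3)) x + ?W x * indicator T x"
      using AE_frame_lborel_span[OF B(1)]
    proof eventually_elim
      case (elim x)
      have "x \<in> T" if "x \<in> ridged_body e \<beta> d" "x \<notin> cball 0 (1 - \<beta> / 3)"
        using ridged_body_profile[OF e e' a xe[OF elim] \<beta>(1) _ d(1) that] \<beta>
        unfolding T_def S_def H_def by simp
      then show ?case by (auto simp: indicator_def)
    qed
  qed
  also have "\<dots> = (\<integral>\<^sup>+x\<in>(cball 0 (1 - \<beta> / 3)). ?W x \<partial>?M) + (\<integral>\<^sup>+x\<in>T. ?W x \<partial>?M)"
    by (rule nn_integral_add) measurable
  also have "\<dots> \<le> ?\<omega> * ennreal (Suc p * (3 / \<beta>) ^ p)
      + ?\<omega> * ennreal (2 ^ p * (2 * real p) * ((3 / \<beta>) ^ p * (sqrt (12 * \<beta>) * (1 / sqrt d) ^ p + 4 * enn2real ?I)))"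
  proof (rule add_mono)
    show "(\<integral>\<^sup>+x\<in>(cball 0 (1 - \<beta> / 3)). ?W x \<partial>?M) \<le> ?\<omega> * ennreal (Suc p * (3 / \<beta>) ^ p)"
      using nn_integral_ball_density_le[OF B(1) _ p, of "\<beta> / 3"] B(2,3) \<beta> orthonormal_finite[OF B(1)]
      by simp
    show "(\<integral>\<^sup>+x\<in>T. ?W x \<partial>?M)
        \<le> ?\<omega> * ennreal (2 ^ p * (2 * real p) * ((3 / \<beta>) ^ p * (sqrt (12 * \<beta>) * (1 / sqrt d) ^ p + 4 * enn2real ?I)))"
    proof (cases "7 / 10 \<le> a")
      case True
      then have "(\<integral>\<^sup>+x\<in>T. ?W x \<partial>?M) = (\<integral>\<^sup>+x\<in>S. ?W x \<partial>?M)"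
        by (simp add: T_def)
      also have "\<dots> \<le> ?\<kappa> * (ennreal (2 * p) * (\<integral>\<^sup>+t\<in>{0..1}. ennreal ((1 / H t) ^ p) \<partial>lborel))"
        unfolding S_def by (rule nn_integral_profile_le[OF B p _ H]) measurable
      also have "(\<integral>\<^sup>+t\<in>{0..1}. ennreal ((1 / H t) ^ p) \<partial>lborel)
          = (\<integral>\<^sup>+t. ennreal ((3 / \<beta>) ^ p) * (ennreal (ridge p d (tri (cone_angle a t / \<beta>))) * indicator {0..1} t) \<partial>lborel)"
      proof (rule nn_integral_cong)
        fix t :: real
        have "(1 / H t) ^ p = (3 / \<beta>) ^ p * ridge p d (tri (cone_angle a t / \<beta>))"
          unfolding ridge_def H_def power_mult_distrib[symmetric] by simp
        then show "ennreal ((1 / H t) ^ p) * indicator {0..1} t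
            = ennreal ((3 / \<beta>) ^ p) * (ennreal (ridge p d (tri (cone_angle a t / \<beta>))) * indicator {0..1} t)"
          using \<beta> d tri_bounds[of "cone_angle a t / \<beta>"]
          by (simp add: ennreal_mult ridge_nonneg mult.assoc)
      qed
      also have "\<dots> = ennreal ((3 / \<beta>) ^ p) * (\<integral>\<^sup>+t\<in>{0..1}. ennreal (ridge p d (tri (cone_angle a t / \<beta>))) \<partial>lborel)"
        using borel_measurable_arccos_cone[OF a, measurable] by (intro nn_integral_cmult) measurable
      also have "?\<kappa> * (ennreal (2 * p) * \<dots>) \<le> (ennreal (2 ^ p) * ?\<omega>) * (ennreal (2 * p) * (ennreal ((3 / \<beta>) ^ p)
          * (ennreal (sqrt (12 * \<beta>) * (1 / sqrt d) ^ p) + 4 * ?I)))"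
        using emeasure_cball_insert_ge[OF B(1,2) ne] nn_integral_ridge_angle_le[OF True a(2) \<beta> d(1)] B(3)
        by (intro mult_mono mult_left_mono) auto
      also have "?I = ennreal (enn2real ?I)" using ridge_integral_finite[OF d(1), of p] by simp
      also have "(ennreal (2 ^ p) * ?\<omega>) * (ennreal (2 * p) * (ennreal ((3 / \<beta>) ^ p)
          * (ennreal (sqrt (12 * \<beta>) * (1 / sqrt d) ^ p) + 4 * ennreal (enn2real ?I))))
          = ?\<omega> * ennreal (2 ^ p * (2 * real p) * ((3 / \<beta>) ^ p * (sqrt (12 * \<beta>) * (1 / sqrt d) ^ p + 4 * enn2real ?I)))"
      proof -
        define u where "u = sqrt (12 * \<beta>) * (1 / sqrt d) ^ p"
        define v where "v = enn2real ?I"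
        define w where "w = (3 / \<beta>) ^ p"
        have nn: "0 \<le> u" "0 \<le> v" "0 \<le> w" using \<beta> d by (auto simp: u_def v_def w_def)
        have "ennreal u + 4 * ennreal v = ennreal (u + 4 * v)"
          using nn by (simp add: ennreal_plus ennreal_mult)
        then have eq: "ennreal (2 ^ p) * (ennreal (2 * p) * (ennreal w * (ennreal u + 4 * ennreal v)))
            = ennreal (2 ^ p * (2 * real p) * (w * (u + 4 * v)))"
          using nn by (simp only: ennreal_mult[symmetric] mult_nonneg_nonneg add_nonneg_nonneg
              zero_le_numeral zero_le_power of_nat_0_le_iff mult.assoc of_nat_mult of_nat_numeral)
        have swap: "(ennreal (2 ^ p) * ?\<omega>) * Y = ?\<omega> * (ennreal (2 ^ p) * Y)" for Y
          by (simp only: mult_ac)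
        show ?thesis unfolding u_def[symmetric] v_def[symmetric] w_def[symmetric] swap eq ..
      qed
      finally show ?thesis .
    next
      case False
      then show ?thesis by (simp add: T_def)
    qed
  qed
  also have "\<dots> = ?\<omega> * ennreal ((3 / \<beta>) ^ p *
      (Suc p + 2 ^ p * (2 * real p) * (sqrt (12 * \<beta>) * (1 / sqrt d) ^ p + 4 * enn2real ?I)))"
  proof -
    have "0 \<le> Suc p * (3 / \<beta>) ^ p" "0 \<le> 2 ^ p * (2 * real p) * ((3 / \<beta>) ^ p * (sqrt (12 * \<beta>) * (1 / sqrt d) ^ p + 4 * enn2real ?I))"
      using \<beta> d by (auto intro!: mult_nonneg_nonneg add_nonneg_nonneg)
    then show ?thesis
      unfolding distrib_left[symmetric] by (subst ennreal_plus[symmetric]) (auto simp: algebra_simps)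
  qed
  finally show ?thesis .
qed

text \<open>The axis is a basis vector here, so the cone angle is \<open>arctan t\<close>; the
  sufficient depth \<open>h\<close> places the region \<open>S\<close> inside the body.\<close>

lemma nn_integral_ridged_body_ge:
  fixes e :: "'a::euclidean_space"
  assumes B: "orthonormal (insert e B)" "e \<notin> B" "card B = p" and p: "1 \<le> p"
    and \<beta>: "0 < \<beta>" "\<beta> \<le> 1 / 50" and d: "0 < d" "d \<le> 1"
  shows "unit_ball_vol B * (ennreal ((1 / 5) ^ Suc p * (1 / (12 * \<beta>)) ^ p / 25) * ridge_integral p d)
    \<le> hyp_integral (Suc p) (insert e B) (ridged_body e \<beta> d)"
proof -
  let ?M = "frame_lborel (insert e B)"
  let ?\<kappa> = "unit_ball_vol B"
  let ?W = "\<lambda>x. ennreal (hyp_density (Suc p) x)"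
  define h where "h t = 3 * \<beta> * sqrt (d + tri (arctan t / \<beta>))" for t
  define S where "S = {x. 0 < x \<bullet> e \<and> axis_dist e x / (x \<bullet> e) \<in> {1 / 2..3 / 4}
      \<and> norm x \<le> 1 - h (axis_dist e x / (x \<bullet> e))}"
  have e: "norm e = 1" using B(1) by (simp add: orthonormal_def)
  have hm [measurable]: "h \<in> borel_measurable borel" unfolding h_def by measurable
  have h: "0 < h t" "h t \<le> 1 / 4" for t proof -
    show "0 < h t" unfolding h_def using \<beta> d tri_bounds[of "arctan t / \<beta>"] by simp
    have "sqrt (d + tri (arctan t / \<beta>)) \<le> sqrt 4"
      using d tri_bounds[of "arctan t / \<beta>"] by (intro real_sqrt_le_mono) auto
    then have "3 * \<beta> * sqrt (d + tri (arctan t / \<beta>)) \<le> 3 * (1 / 50) * 2"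
      using \<beta> d tri_bounds[of "arctan t / \<beta>"] by (intro mult_mono) auto
    then show "h t \<le> 1 / 4" by (simp add: h_def)
  qed
  have S: "x \<in> ridged_body e \<beta> d" if "x \<in> S" for x proof -
    let ?y = "axis_dist e x"
    define t where "t = ?y / (x \<bullet> e)"
    have s: "0 < x \<bullet> e" "1 / 2 \<le> t" "t \<le> 3 / 4" "norm x \<le> 1 - h t"
      using that unfolding S_def t_def by auto
    have "x \<noteq> 0" using s(1) by auto
    have "1 + t\<^sup>2 = (norm x / (x \<bullet> e))\<^sup>2"
      unfolding t_def power_divide norm_diff_projection[OF e] using s(1) by (simp add: diff_divide_distrib)
    then have "sqrt (1 + t\<^sup>2) = norm x / (x \<bullet> e)" using s(1) by simp
    then have xe: "\<bar>x \<bullet> e\<bar> = norm x * cos (arctan t)"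
      using s(1) \<open>x \<noteq> 0\<close> by (simp add: cos_arctan)
    \<comment> \<open>Slopes up to 3/4 stay at least 1/8 below the angle \<open>pi / 4\<close>,
      which leaves the margin \<beta> that membership requires.\<close>
    have "1 / 8 \<le> arctan 1 - arctan (3 / 4)" using arctan_diff_ge[of "3 / 4" 1] by simp
    moreover have "arctan t \<le> arctan (3 / 4)" using s by (simp add: arctan_le_iff)
    ultimately have "arctan t \<le> pi / 4 - \<beta>" using \<beta> by (simp add: arctan_one)
    then show ?thesis
      using s(2,4) xe \<beta> d e by (intro ridged_body_memI[of e "arctan t"]) (auto simp: h_def)
  qed
  have "?\<kappa> * (ennreal ((1 / 5) ^ Suc p * (1 / (12 * \<beta>)) ^ p / 25) * ridge_integral p d)
      = ?\<kappa> * (ennreal ((1 / 5) ^ Suc p) * (ennreal ((1 / (12 * \<beta>)) ^ p) * (ennreal (1 / 25) * ridge_integral p d)))"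
  proof -
    have "ennreal ((1 / 5) ^ Suc p * (1 / (12 * \<beta>)) ^ p / 25)
        = ennreal ((1 / 5) ^ Suc p) * (ennreal ((1 / (12 * \<beta>)) ^ p) * ennreal (1 / 25))"
      using \<beta> by (simp add: ennreal_mult[symmetric] del: power_Suc)
    then show ?thesis by (simp only: mult.assoc)
  qed
  also have "\<dots> \<le> ?\<kappa> * (ennreal ((1 / 5) ^ Suc p) * (ennreal ((1 / (12 * \<beta>)) ^ p)
      * (\<integral>\<^sup>+t\<in>{1 / 2..3 / 4}. ennreal (ridge p d (tri (arctan t / \<beta>))) \<partial>lborel)))"
    by (intro mult_left_mono nn_integral_ridge_angle_ge \<beta> d) auto
  also have "ennreal ((1 / (12 * \<beta>)) ^ p) * (\<integral>\<^sup>+t\<in>{1 / 2..3 / 4}. ennreal (ridge p d (tri (arctan t / \<beta>))) \<partial>lborel)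
      = (\<integral>\<^sup>+t. ennreal ((1 / (12 * \<beta>)) ^ p) * (ennreal (ridge p d (tri (arctan t / \<beta>))) * indicator {1 / 2..3 / 4} t) \<partial>lborel)"
    by (rule nn_integral_cmult[symmetric]) measurable
  also have "\<dots> = (\<integral>\<^sup>+t\<in>{1 / 2..3 / 4}. ennreal ((1 / (4 * h t)) ^ p) \<partial>lborel)"
  proof (rule nn_integral_cong)
    fix t :: real
    have "(1 / (4 * h t)) ^ p = (1 / (12 * \<beta>)) ^ p * ridge p d (tri (arctan t / \<beta>))"
      unfolding ridge_def h_def power_mult_distrib[symmetric] by (simp add: mult.assoc)
    then show "ennreal ((1 / (12 * \<beta>)) ^ p) * (ennreal (ridge p d (tri (arctan t / \<beta>))) * indicator {1 / 2..3 / 4} t)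
        = ennreal ((1 / (4 * h t)) ^ p) * indicator {1 / 2..3 / 4} t"
      using \<beta> d tri_bounds[of "arctan t / \<beta>"]
      by (simp add: ennreal_mult ridge_nonneg mult.assoc)
  qed
  also have "?\<kappa> * (ennreal ((1 / 5) ^ Suc p) * \<dots>) \<le> (\<integral>\<^sup>+x\<in>S. ?W x \<partial>?M)"
    unfolding S_def by (rule nn_integral_profile_ge[OF B p hm h])
  also have "\<dots> \<le> (\<integral>\<^sup>+x. ?W x * indicator (ridged_body e \<beta> d) x \<partial>?M)"
    using S by (intro nn_integral_mono) (auto simp: indicator_def)
  finally show ?thesis .
qed

section \<open>From nonnegative integrals to the stated volumes\<close>

lemma set_integral_hyp_density:
  fixes A :: "'a::euclidean_space set"
  assumes M [measurable_cong]: "sets M = sets borel" and A: "A \<in> sets borel" "A \<subseteq> ball 0 1"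
  shows "(LINT x:A|M. hyp_density m x)
    = enn2real (\<integral>\<^sup>+x. ennreal (hyp_density m x) * indicator A x \<partial>M)"
proof -
  have [measurable]: "A \<in> sets M" using A M by simp
  have nn: "0 \<le> indicator A x *\<^sub>R (hyp_density m x)" for x
    using A(2) one_minus_square_bounds(3)[of "norm x"] by (auto simp: indicator_def)
  have "(LINT x:A|M. hyp_density m x)
      = enn2real (\<integral>\<^sup>+x. ennreal (indicator A x *\<^sub>R (hyp_density m x)) \<partial>M)"
    unfolding set_lebesgue_integral_def using nn by (intro integral_eq_nn_integral) auto
  also have "(\<integral>\<^sup>+x. ennreal (indicator A x *\<^sub>R (hyp_density m x)) \<partial>M)
      = (\<integral>\<^sup>+x. ennreal (hyp_density m x) * indicator A x \<partial>M)"
    by (intro nn_integral_cong) (auto simp: indicator_def)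
  finally show ?thesis .
qed

lemma span_central_plane:
  fixes V :: "'a::euclidean_space set"
  assumes V: "subspace V"
  shows "span (V \<inter> ball 0 1) = V"
proof
  show "span (V \<inter> ball 0 1) \<subseteq> V" using V by (intro span_minimal) auto
  show "V \<subseteq> span (V \<inter> ball 0 1)"
  proof
    fix v assume v: "v \<in> V"
    define c where "c = 1 / (norm v + 1)"
    have c: "0 < c" unfolding c_def by (simp add: add_nonneg_pos)
    have "norm (c *\<^sub>R v) < 1" unfolding c_def by (simp add: add_nonneg_pos divide_less_eq_1_pos)
    then have "c *\<^sub>R v \<in> V \<inter> ball 0 1" using v V by (simp add: subspace_scale)
    then have "(1 / c) *\<^sub>R (c *\<^sub>R v) \<in> span (V \<inter> ball 0 1)"
      by (intro span_scale span_base)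
    then show "v \<in> span (V \<inter> ball 0 1)" using c by simp
  qed
qed

text \<open>The frame measure is carried by \<open>span B\<close>, so on it the intersection with
  the plane changes nothing.\<close>

lemma hyp_section_vol_frame:
  fixes K :: "'a::euclidean_space set"
  assumes B: "orthonormal B" and K: "K \<in> sets borel" "K \<subseteq> ball 0 1"
  shows "hyp_section_vol m K (span B \<inter> ball 0 1)
    = 2 ^ m * enn2real (hyp_integral m B K)"
proof -
  let ?A = "K \<inter> (span B \<inter> ball 0 1)"
  have A: "?A \<in> sets borel" "?A \<subseteq> ball 0 1"
    using K by (auto intro!: borel_closed closed_subspace)
  have "(LINT x:?A|frame_lborel B. hyp_density m x)
      = enn2real (\<integral>\<^sup>+x. ennreal (hyp_density m x) * indicator ?A x \<partial>frame_lborel B)"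
    by (rule set_integral_hyp_density[OF _ A]) simp
  also have "(\<integral>\<^sup>+x. ennreal (hyp_density m x) * indicator ?A x \<partial>frame_lborel B)
      = hyp_integral m B K"
    using AE_frame_lborel_span[OF B] K(2)
    by (intro nn_integral_cong_AE) (auto elim!: eventually_mono simp: indicator_def)
  finally show ?thesis
    unfolding hyp_section_vol_def span_central_plane[OF subspace_span] subspace_lborel_eq_frame[OF B] by simp
qed

lemma hyp_vol_eq:
  fixes K :: "'a::euclidean_space set"
  assumes "K \<in> sets borel" "K \<subseteq> ball 0 1"
  shows "hyp_vol K = 2 ^ DIM('a) *
    enn2real (\<integral>\<^sup>+x\<in>K. ennreal (hyp_density DIM('a) x) \<partial>lborel)"
  unfolding hyp_vol_def using set_integral_hyp_density[OF _ assms, of lborel] by simp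

theorem theorem4p2:
  fixes k :: nat
  assumes "CARD('n::finite) \<ge> 3"
    and "1 \<le> k" and "k < CARD('n) - 1"
  shows "\<exists>K L :: (real ^ 'n) set.
           body K \<and> hyp_convex K \<and> origin_symmetric K \<and>
           body L \<and> hyp_convex L \<and> origin_symmetric L \<and>
           (\<forall>H. central_plane (CARD('n) - k) H \<longrightarrow>
              hyp_section_vol (CARD('n) - k) K H \<le> hyp_section_vol (CARD('n) - k) L H) \<and>
           hyp_vol K > hyp_vol L"
proof -
  define N where "N = CARD('n) - 1"
  define p where "p = CARD('n) - k - 1"
  \<comment> \<open>\<open>k < n - 1\<close> gives \<open>1 \<le> p\<close>, and
    \<open>1 \<le> k\<close> gives \<open>p < N\<close>.\<close>
  have p: "1 \<le> p" "p < N" and N: "1 \<le> N" and dims: "CARD('n) - k = Suc p" "CARD('n) = Suc N" "DIM(real ^ 'n) = Suc N"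
    using assms by (auto simp: N_def p_def)
  obtain e :: "real ^ 'n" where eB: "e \<in> Basis" using nonempty_Basis by blast
  \<comment> \<open>An axis taken from \<open>Basis\<close> makes \<open>lborel\<close> the frame
    measure of a basis that contains the axis.\<close>
  define B where "B = (Basis :: (real ^ 'n) set) - {e}"
  have BB: "insert e B = Basis" "e \<notin> B" using eB by (auto simp: B_def)
  have oB: "orthonormal (insert e B)" unfolding BB by (rule orthonormal_Basis)
  have cB: "card B = N" using eB dims by (simp add: B_def)
  have e: "norm e = 1" using eB by simp
  define \<kappa> where "\<kappa> = enn2real (unit_ball_vol B)"
  define \<Omega> where "\<Omega> = enn2real (emeasure (lborel :: (real ^ 'n) measure) (cball 0 1))"
  have oB': "orthonormal B" using oB by (rule orthonormal_subset) auto
  have \<kappa>: "unit_ball_vol B = ennreal \<kappa>" "0 < \<kappa>"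
    using emeasure_frame_lborel_cball_pos_finite[OF oB', of 1]
    by (auto simp: \<kappa>_def enn2real_positive_iff less_top)
  have \<Omega>: "emeasure (lborel :: (real ^ 'n) measure) (cball 0 1) = ennreal \<Omega>" "0 \<le> \<Omega>"
    using emeasure_lborel_cball_finite[of "0 :: real ^ 'n" 1] by (auto simp: \<Omega>_def less_top)
  \<comment> \<open>\<open>C1\<close> collects the constants of the two section estimates, upper for
    \<open>K\<close> and lower for the ball; \<open>C2\<close> collects those of the two volume
    estimates, with the roles exchanged.\<close>
  define C1 where "C1 = 8 ^ Suc p * (3 ^ p * (real (Suc p) + 2 ^ p * (2 * real p) * 4))"
  define c2 where "c2 = \<kappa> * ((1 / 5) ^ Suc N * (1 / 12) ^ N / 25)"
  define C2 where "C2 = \<Omega> * real (Suc N) / c2"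
  have c2: "0 < c2" using \<kappa> by (simp add: c2_def)
  have C1: "0 < C1" unfolding C1_def by (intro mult_pos_pos add_pos_nonneg) auto
  obtain d X where dX: "0 < d" "d \<le> 1" "1 \<le> X"
      "max C1 C2 * (1 + enn2real (ridge_integral p d)) \<le> X ^ p"
      "max C1 C2 * X ^ N < enn2real (ridge_integral N d)"
    using exists_ridge_parameters[of "max C1 C2" p N] p C1 by (metis less_max_iff_disj)
  define Jp where "Jp = enn2real (ridge_integral p d)"
  define JN where "JN = enn2real (ridge_integral N d)"
  have J: "ridge_integral N d = ennreal JN" "0 \<le> Jp" "0 \<le> JN"
    using ridge_integral_finite[OF dX(1)] by (auto simp: JN_def Jp_def)
  have XJ: "C1 * (1 + Jp) \<le> X ^ p" "C2 * X ^ N < JN" proof -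
    have "C1 * (1 + Jp) \<le> max C1 C2 * (1 + Jp)" using J by (intro mult_right_mono) auto
    then show "C1 * (1 + Jp) \<le> X ^ p" using dX(4) by (simp add: Jp_def)
    have "C2 * X ^ N \<le> max C1 C2 * X ^ N" using dX(3) by (intro mult_right_mono) auto
    then show "C2 * X ^ N < JN" using dX(5) by (simp add: JN_def)
  qed
  \<comment> \<open>\<beta> depends on \<open>d\<close>: the bound \<open>d ^ p / 12\<close> makes
    the contribution of the initial stretch at most 1, and 1/50 serves the lower volume
    estimate.\<close>
  define \<beta> where "\<beta> = min (1 / 50) (d ^ p / 12)"
  have \<beta>: "0 < \<beta>" "\<beta> \<le> 1 / 50" "\<beta> \<le> 1 / 12" "\<beta> \<le> 1 / 4" "12 * \<beta> \<le> d ^ p"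
    using dX(1) by (auto simp: \<beta>_def)
  have small: "sqrt (12 * \<beta>) * (1 / sqrt d) ^ p \<le> 1" proof -
    have "sqrt (12 * \<beta>) \<le> sqrt d ^ p"
      using real_sqrt_le_mono[OF \<beta>(5)] by (simp add: real_sqrt_power)
    then have "sqrt (12 * \<beta>) * (1 / sqrt d) ^ p \<le> sqrt d ^ p * (1 / sqrt d) ^ p"
      using dX(1) by (intro mult_right_mono) auto
    also have "\<dots> = 1" using dX(1) by (simp flip: power_mult_distrib)
    finally show ?thesis .
  qed
  \<comment> \<open>The depth of the ball \<open>L\<close>. Its sections have order
    \<open>(X / \<beta>) ^ p\<close> and its volume has order \<open>(X / \<beta>) ^ N\<close>, so
    the powers of \<beta> cancel against those of \<open>K\<close>.\<close>
  define r where "r = \<beta> / X"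
  have r: "0 < r" "r \<le> 1 / 4" "1 / r = X / \<beta>" proof -
    show "0 < r" using \<beta> dX by (simp add: r_def)
    have "\<beta> / X \<le> \<beta> / 1" using \<beta> dX by (intro divide_left_mono) auto
    then show "r \<le> 1 / 4" using \<beta> by (simp add: r_def)
  qed (simp add: r_def)
  define K where "K = ridged_body e \<beta> d"
  define L where "L = cball (0 :: real ^ 'n) (1 - r)"
  have KL: "K \<in> sets borel" "L \<in> sets borel" "K \<subseteq> ball 0 1" "L \<subseteq> ball 0 1"
    using ridged_body_norm_less[OF e \<beta>(1,4) dX(1)] r by (auto simp: K_def L_def)
  have sections: "hyp_section_vol (Suc p) K H \<le> hyp_section_vol (Suc p) L H" if H: "central_plane (Suc p) H" for H
  proof -
    obtain V where V: "subspace V" "dim V = Suc p" "H = V \<inter> ball 0 1"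
      using H unfolding central_plane_def by blast
    obtain e' D a where D: "orthonormal (insert e' D)" "e' \<notin> D" "card D = p" "span (insert e' D) = V"
        and a: "0 \<le> a" "a \<le> 1" "\<And>x. x \<in> V \<Longrightarrow> x \<bullet> e = a * (x \<bullet> e')"
      using adapted_orthonormal_basis[OF e V(1,2)] by metis
    let ?M = "frame_lborel (insert e' D)"
    let ?W = "\<lambda>x. ennreal (hyp_density (Suc p) x)"
    have cD: "card (insert e' D) = Suc p" using D orthonormal_finite[OF D(1)] by simp
    have "(\<integral>\<^sup>+x\<in>K. ?W x \<partial>?M) \<le> emeasure ?M (cball 0 1) * ennreal ((3 / \<beta>) ^ p *
        (Suc p + 2 ^ p * (2 * real p) * (sqrt (12 * \<beta>) * (1 / sqrt d) ^ p + 4 * Jp)))"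
      unfolding K_def Jp_def
    proof (rule nn_integral_ridged_body_le[OF e D(1-3) p(1) a(1,2) _ \<beta>(1,3) dX(1,2)])
      show "x \<bullet> e = a * (x \<bullet> e')" if "x \<in> span (insert e' D)" for x
        using a(3) that unfolding D(4) .
    qed
    also have "\<dots> \<le> emeasure ?M (cball 0 1) * ennreal ((1 / 8) ^ Suc p * (1 / r) ^ p)"
    proof (intro mult_left_mono ennreal_leI)
      have "real (Suc p) + 2 ^ p * (2 * real p) * (sqrt (12 * \<beta>) * (1 / sqrt d) ^ p + 4 * Jp)
          \<le> real (Suc p) * (1 + Jp) + 2 ^ p * (2 * real p) * (4 * (1 + Jp))"
        using small J(2) by (intro add_mono mult_left_mono) (auto simp: mult_le_cancel_left1)
      also have "\<dots> = C1 / (8 ^ Suc p * 3 ^ p) * (1 + Jp)" proof -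
        have "C1 / (8 ^ Suc p * 3 ^ p) = real (Suc p) + 2 ^ p * (2 * real p) * 4" by (simp add: C1_def)
        then show ?thesis by (simp only: distrib_right mult.assoc)
      qed
      finally have "(3 / \<beta>) ^ p * (real (Suc p) + 2 ^ p * (2 * real p) * (sqrt (12 * \<beta>) * (1 / sqrt d) ^ p + 4 * Jp))
          \<le> (3 / \<beta>) ^ p * (C1 / (8 ^ Suc p * 3 ^ p) * (1 + Jp))"
        using \<beta> by (intro mult_left_mono) auto
      also have "\<dots> = (1 / 8) ^ Suc p * (1 / \<beta>) ^ p * (C1 * (1 + Jp))"
        by (simp add: power_divide)
      also have "\<dots> \<le> (1 / 8) ^ Suc p * (1 / \<beta>) ^ p * X ^ p"
        using XJ(1) \<beta> by (intro mult_left_mono) auto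
      also have "\<dots> = (1 / 8) ^ Suc p * (1 / r) ^ p" unfolding r(3) by (simp add: power_divide)
      finally show "(3 / \<beta>) ^ p * (real (Suc p) + 2 ^ p * (2 * real p) * (sqrt (12 * \<beta>) * (1 / sqrt d) ^ p + 4 * Jp))
          \<le> (1 / 8) ^ Suc p * (1 / r) ^ p" .
    qed simp
    also have "\<dots> \<le> (\<integral>\<^sup>+x\<in>L. ?W x \<partial>?M)"
      unfolding L_def by (rule nn_integral_ball_density_ge[OF D(1) cD r(1,2)])
    finally have le: "(\<integral>\<^sup>+x\<in>K. ?W x \<partial>?M) \<le> (\<integral>\<^sup>+x\<in>L. ?W x \<partial>?M)" .
    \<comment> \<open>\<open>enn2real\<close> sends infinity to 0, so monotonicity requires the
      larger integral to be finite.\<close>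
    have "(\<integral>\<^sup>+x\<in>L. ?W x \<partial>?M) \<le> emeasure ?M (cball 0 1) * ennreal (Suc p * (1 / r) ^ p)"
      unfolding L_def using r by (intro nn_integral_ball_density_le[OF D(1) cD p(1)]) auto
    also have "\<dots> < \<infinity>"
      using emeasure_frame_lborel_cball_pos_finite(2)[OF D(1), of 1] by (simp add: ennreal_mult_less_top)
    finally have "enn2real (\<integral>\<^sup>+x\<in>K. ?W x \<partial>?M) \<le> enn2real (\<integral>\<^sup>+x\<in>L. ?W x \<partial>?M)"
      using le by (intro enn2real_mono) auto
    then show ?thesis unfolding V(3) D(4)[symmetric] using hyp_section_vol_frame[OF D(1)] KL by simp
  qed
  have volume: "hyp_vol L < hyp_vol K" proof -
    let ?W = "\<lambda>x :: real ^ 'n. ennreal (hyp_density (Suc N) x)"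
    have lb: "lborel = frame_lborel (insert e B)" unfolding BB by (rule frame_lborel_Basis[symmetric])
    have cB': "card (insert e B) = Suc N" using cB BB(2) orthonormal_finite[OF oB] by simp
    have "(\<integral>\<^sup>+x\<in>L. ?W x \<partial>lborel) \<le> unit_ball_vol (insert e B) * ennreal (Suc N * (1 / r) ^ N)"
      unfolding lb L_def using r by (intro nn_integral_ball_density_le[OF oB cB' N]) auto
    also have "\<dots> = ennreal (\<Omega> * (Suc N * (1 / r) ^ N))"
      unfolding lb[symmetric] \<Omega>(1) using \<Omega>(2) r(1) by (intro ennreal_mult[symmetric]) auto
    finally have L: "(\<integral>\<^sup>+x\<in>L. ?W x \<partial>lborel) \<le> ennreal (\<Omega> * (Suc N * (1 / r) ^ N))" .
    \<comment> \<open>The section estimate for the whole space, with \<open>a = 1\<close>; only the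
      finiteness of the volume of \<open>K\<close> is drawn from it.\<close>
    have "(\<integral>\<^sup>+x\<in>K. ?W x \<partial>lborel) \<le> unit_ball_vol (insert e B) * ennreal ((3 / \<beta>) ^ N *
        (Suc N + 2 ^ N * (2 * real N) * (sqrt (12 * \<beta>) * (1 / sqrt d) ^ N + 4 * JN)))"
      unfolding lb K_def JN_def
      by (intro nn_integral_ridged_body_le[OF e oB BB(2) cB N _ _ _ \<beta>(1,3) dX(1,2), of 1]) auto
    also have "\<dots> < \<infinity>"
      using emeasure_frame_lborel_cball_pos_finite(2)[OF oB, of 1] by (simp add: ennreal_mult_less_top)
    finally have fin: "(\<integral>\<^sup>+x\<in>K. ?W x \<partial>lborel) < \<infinity>" .
    have "ennreal (c2 * (1 / \<beta>) ^ N * JN) = unit_ball_vol B * (ennreal ((1 / 5) ^ Suc N * (1 / (12 * \<beta>)) ^ N / 25) * ridge_integral N d)"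
    proof -
      have eq: "c2 * (1 / \<beta>) ^ N * JN = \<kappa> * ((1 / 5) ^ Suc N * (1 / (12 * \<beta>)) ^ N / 25 * JN)"
        by (simp add: c2_def power_divide power_mult_distrib)
      have nn: "0 \<le> (1 / 5) ^ Suc N * (1 / (12 * \<beta>)) ^ N / 25" using \<beta>(1) by simp
      show ?thesis
        unfolding eq \<kappa>(1) J(1) ennreal_mult[OF less_imp_le[OF \<kappa>(2)] mult_nonneg_nonneg[OF nn J(3)]]
          ennreal_mult[OF nn J(3)] ..
    qed
    also have "\<dots> \<le> (\<integral>\<^sup>+x\<in>K. ?W x \<partial>lborel)"
      unfolding lb K_def by (rule nn_integral_ridged_body_ge[OF oB BB(2) cB N \<beta>(1,2) dX(1,2)])
    finally have K: "ennreal (c2 * (1 / \<beta>) ^ N * JN) \<le> (\<integral>\<^sup>+x\<in>K. ?W x \<partial>lborel)" .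
    have "\<Omega> * (Suc N * (1 / r) ^ N) = c2 * (1 / \<beta>) ^ N * (C2 * X ^ N)"
      using c2 by (simp add: C2_def r(3) power_divide)
    also have "\<dots> < c2 * (1 / \<beta>) ^ N * JN"
      using XJ(2) c2 \<beta> by (intro mult_strict_left_mono) auto
    finally have lt: "\<Omega> * (Suc N * (1 / r) ^ N) < c2 * (1 / \<beta>) ^ N * JN" .
    have "enn2real (\<integral>\<^sup>+x\<in>L. ?W x \<partial>lborel) \<le> \<Omega> * (Suc N * (1 / r) ^ N)"
      using enn2real_mono[OF L] \<Omega>(2) r(1) by simp
    also note lt
    also have "c2 * (1 / \<beta>) ^ N * JN \<le> enn2real (\<integral>\<^sup>+x\<in>K. ?W x \<partial>lborel)"
      using enn2real_mono[OF K] fin c2 \<beta> J by simp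
    finally show ?thesis
      unfolding hyp_vol_eq[OF KL(1,3)] hyp_vol_eq[OF KL(2,4)] dims(3) by (rule mult_strict_left_mono) simp
  qed
  have "body K" "hyp_convex K" "origin_symmetric K"
    unfolding K_def using body_ridged_body[OF e \<beta>(1,4) dX(1,2)] hyp_convex_ridged_body[OF e \<beta>(1,4) dX(1)]
    by (auto intro: origin_symmetric_ridged_body)
  moreover have "body L" "hyp_convex L" "origin_symmetric L"
    unfolding L_def using r by (auto intro: body_cball hyp_convex_cball origin_symmetric_cball)
  ultimately show ?thesis unfolding dims(1) using sections volume by blast
qed

end
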